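(* Let $E$ be a graph and let $R$ be a unital commutative ring. Then: (1) If $X$ is a hereditary subset of $E^0$, then the ideal $I(X)$ of $L_R(E)$ generated by $X$ and the Leavitt path algebra $L_R(E_X)$ are Morita equivalent as rings, where $E_X:=(X,s^{-1}(X),r,s)$. (2) If $(H,S)$ is an admissible pair in $E$, then the ideal $I(H,S)$ and the Leavitt path algebra $L_R(E_{(H,S)})$ are Morita equivalent as rings. (3) If $(H,S)$ is an admissible pair in $E$, then the quotient algebra $L_R(E)/I(H,S)$ is canonically isomorphic to the Leavitt path algebra $L_R(E/(H,S))$. (4) The map $(H,S)\mapsto I(H,S)$ is a one-to-one correspondence between the set of admissible pairs in $E$ and the set of graded basic ideals of $L_R(E)$.
   Context: Graphs and algebras. A graph $E=(E^0,E^1,r,s)$ consists of countable sets $E^0$ (vertices) and $E^1$ (edges) and range and source maps $r,s:E^1\to E^0$. A path of length $n\ge 1$ is $\alpha=e_1\cdots e_n$ with $r(e_i)=s(e_{i+1})$; $s(\alpha)=s(e_1)$, $r(\alpha)=r(e_n)$; vertices are paths of length $0$. For a unital commutative ring $R$ (with $1\neq 0$), $L_R(E)$ is the universal $R$-algebra generated by pairwise orthogonal idempotents $\{v:v\in E^0\}$ and elements $\{e,e^*:e\in E^1\}$ subject to: $s(e)e=er(e)=e$; $r(e)e^*=e^*s(e)=e^*$; $e^*f=\delta_{e,f}r(e)$; and $v=\sum_{s(e)=v}ee^*$ whenever $0<|s^{-1}(v)|<\infty$. For a path $\alpha=e_1\cdots e_n$, $\alpha^*:=e_n^*\cdots e_1^*$,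 and $v^*:=v$. $L_R(E)$ is $\mathbb Z$-graded with $L_R(E)_k=\mathrm{span}_R\{\alpha\beta^*: r(\alpha)=r(\beta),\ |\alpha|-|\beta|=k\}$; an ideal $I$ (two-sided) is graded if $I=\bigoplus_k (I\cap L_R(E)_k)$. Admissible pairs. $X\subseteq E^0$ is hereditary if $s(e)\in X$ implies $r(e)\in X$, and saturated if every $v$ with $0<|s^{-1}(v)|<\infty$ and $r(s^{-1}(v))\subseteq X$ lies in $X$. For $H$ saturated hereditary, $B_H:=\{v\in E^0\setminus H: |s^{-1}(v)|=\infty,\ 0<|s^{-1}(v)\cap r^{-1}(E^0\setminus H)|<\infty\}$ and, for $v\in B_H$, $v^H:=v-\sum_{s(e)=v,\,r(e)\notin H}ee^*$. An admissible pair is $(H,S)$ with $H$ saturated hereditary and $S\subseteq B_H$; $I(H,S)$ is the ideal of $L_R(E)$ generated by $\{v:v\in H\}\cup\{v^H:v\in S\}$. Basic ideals. An ideal $I$ of $L_R(E)$ is basic if $\lambda x\in I$ with $\lambda\in R\setminus\{0\}$ implies $x\in I$, whenever either $x\in E^0$ or $x=v-\sum_{i=1}^n e_ie_i^*$ with $v\in E^0$ and distinct edges $e_1,\dots,e_n\in s^{-1}(v)$. Auxiliary graphs. $E/(H,S)$ has vertices $(E^0\setminus H)\cup\{v':v\in B_H\setminus S\}$ and edges $\{e\in E^1:r(e)\in E^0\setminus H\}\cup\{e':e\in E^1,\ r(e)\in B_H\setminus S\}$, with $r,s$ as in $E$ on old edges and $s(e')=s(e)$, $r(e')=r(e)'$.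 $E_{(H,S)}$ has vertices $H\cup S$ and edges $\{e\in E^1:s(e)\in H\}\cup\{e\in E^1:s(e)\in S,\ r(e)\in H\}$, with $r,s$ restricted. Canonical isomorphism in (3): the $R$-algebra homomorphism $L_R(E/(H,S))\to L_R(E)/I(H,S)$ sending a vertex $v\in (E^0\setminus H)\setminus(B_H\setminus S)$ to the class of $v$, and for $v\in B_H\setminus S$ sending $v$ to the class of $v-v^H$ and $v'$ to the class of $v^H$; sending $e$ (and $e^*$) to the class of $e$ (resp. $e^*$) if $r(e)\notin B_H\setminus S$, and, if $r(e)=w\in B_H\setminus S$, sending $e\mapsto [e(w-w^H)]$, $e'\mapsto[ew^H]$, $e^*\mapsto[(w-w^H)e^*]$, $(e')^*\mapsto[w^He^*]$. Morita equivalence of rings with local units is the usual notion: the categories of unital left modules ($AM=M$) are equivalent (equivalently, there is a surjective Morita context). *)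

theory Defs
  imports
    "HOL-Algebra.QuotRing"
    "HOL-Algebra.Module"
    "HOL-Algebra.Generated_Groups"
    "HOL-Library.Poly_Mapping"
    "HOL-Library.Countable_Set"
    "Graph_Theory.Arc_Walk"
begin

section \<open>Rings without identity\<close>

text \<open>
  Leavitt path algebras and their ideals need not have an identity. They are carried by the
  library's ring and module records, whose field \<^const>\<open>one\<close> is never constrained or used.
  Scalars form a type of class \<^class>\<open>comm_ring_1\<close>, which includes \<open>0 \<noteq> 1\<close>.
\<close>

locale rng = abelian_group A for A (structure) +
  assumes m_closed: "\<lbrakk>x \<in> carrier A; y \<in> carrier A\<rbrakk> \<Longrightarrow> x \<otimes> y \<in> carrier A"
    and m_assoc: "\<lbrakk>x \<in> carrier A; y \<in> carrier A; z \<in> carrier A\<rbrakk> \<Longrightarrow> (x \<otimes> y) \<otimes> z = x \<otimes> (y \<otimes> z)"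
    and l_distr: "\<lbrakk>x \<in> carrier A; y \<in> carrier A; z \<in> carrier A\<rbrakk> \<Longrightarrow> (x \<oplus> y) \<otimes> z = x \<otimes> z \<oplus> y \<otimes> z"
    and r_distr: "\<lbrakk>x \<in> carrier A; y \<in> carrier A; z \<in> carrier A\<rbrakk> \<Longrightarrow> z \<otimes> (x \<oplus> y) = z \<otimes> x \<oplus> z \<otimes> y"

locale rng_ideal = additive_subgroup I A + rng A for I and A (structure) +
  assumes I_l_closed: "\<lbrakk>a \<in> I; x \<in> carrier A\<rbrakk> \<Longrightarrow> x \<otimes> a \<in> I"
    and I_r_closed: "\<lbrakk>a \<in> I; x \<in> carrier A\<rbrakk> \<Longrightarrow> a \<otimes> x \<in> I"

definition rng_genideal :: "('a, 'b) ring_scheme \<Rightarrow> 'a set \<Rightarrow> 'a set"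
  where "rng_genideal A S = \<Inter>{I. rng_ideal I A \<and> S \<subseteq> I}"

definition alg_quot :: "('r, 'a) module \<Rightarrow> 'a set \<Rightarrow> ('r, 'a set) module"
  where "alg_quot A I =
    ring.extend (A Quot I) (module.fields (\<lambda>c X. \<Union>x\<in>X. I +>\<^bsub>A\<^esub> (c \<odot>\<^bsub>A\<^esub> x)))"

definition alg_hom :: "('r, 'a) module \<Rightarrow> ('r, 'b) module \<Rightarrow> ('a \<Rightarrow> 'b) set"
  where "alg_hom A B = {h \<in> carrier A \<rightarrow> carrier B.
    (\<forall>x\<in>carrier A. \<forall>y\<in>carrier A. h (x \<oplus>\<^bsub>A\<^esub> y) = h x \<oplus>\<^bsub>B\<^esub> h y) \<and>
    (\<forall>x\<in>carrier A. \<forall>y\<in>carrier A. h (x \<otimes>\<^bsub>A\<^esub> y) = h x \<otimes>\<^bsub>B\<^esub> h y) \<and>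
    (\<forall>c. \<forall>x\<in>carrier A. h (c \<odot>\<^bsub>A\<^esub> x) = c \<odot>\<^bsub>B\<^esub> h x)}"

text \<open>\<open>I\<close> is the internal direct sum of the additive subgroups \<open>M k\<close>.\<close>

definition internal_direct_sum :: "('a, 'b) ring_scheme \<Rightarrow> 'a set \<Rightarrow> ('k \<Rightarrow> 'a set) \<Rightarrow> bool"
  where "internal_direct_sum A I M \<longleftrightarrow>
    (\<forall>k. additive_subgroup (M k) A) \<and>
    bij_betw (\<lambda>f. finsum A f {k. f k \<noteq> \<zero>\<^bsub>A\<^esub>})
      {f. (\<forall>k. f k \<in> M k) \<and> finite {k. f k \<noteq> \<zero>\<^bsub>A\<^esub>}} I"


section \<open>Morita equivalence of rings with local units\<close>

definition has_local_units :: "('a, 'b) ring_scheme \<Rightarrow> bool"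
  where "has_local_units A \<longleftrightarrow>
    (\<forall>F. finite F \<and> F \<subseteq> carrier A \<longrightarrow>
      (\<exists>u\<in>carrier A. u \<otimes>\<^bsub>A\<^esub> u = u \<and> (\<forall>x\<in>F. u \<otimes>\<^bsub>A\<^esub> x = x \<and> x \<otimes>\<^bsub>A\<^esub> u = x)))"

record ('a, 'b, 'm) bimodule = "('a, 'm) module" +
  rsmult :: "'m \<Rightarrow> 'b \<Rightarrow> 'm" (infixl \<open>\<boxdot>\<index>\<close> 70)

abbreviation add_span :: "('a, 'b) ring_scheme \<Rightarrow> 'a set \<Rightarrow> 'a set"
  where "add_span A S \<equiv> generate (add_monoid A) S"

locale unital_bimodule = A: rng A + B: rng B + M: abelian_group M
  for A :: "('a, 'x) ring_scheme" and B :: "('b, 'y) ring_scheme"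
    and M :: "('a, 'b, 'm) bimodule" +
  assumes l_closed: "\<lbrakk>a \<in> carrier A; m \<in> carrier M\<rbrakk> \<Longrightarrow> a \<odot>\<^bsub>M\<^esub> m \<in> carrier M"
    and r_closed: "\<lbrakk>b \<in> carrier B; m \<in> carrier M\<rbrakk> \<Longrightarrow> m \<boxdot>\<^bsub>M\<^esub> b \<in> carrier M"
    and l_distr_scal: "\<lbrakk>a \<in> carrier A; a' \<in> carrier A; m \<in> carrier M\<rbrakk>
      \<Longrightarrow> (a \<oplus>\<^bsub>A\<^esub> a') \<odot>\<^bsub>M\<^esub> m = a \<odot>\<^bsub>M\<^esub> m \<oplus>\<^bsub>M\<^esub> a' \<odot>\<^bsub>M\<^esub> m"
    and l_distr_vec: "\<lbrakk>a \<in> carrier A; m \<in> carrier M; m' \<in> carrier M\<rbrakk>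
      \<Longrightarrow> a \<odot>\<^bsub>M\<^esub> (m \<oplus>\<^bsub>M\<^esub> m') = a \<odot>\<^bsub>M\<^esub> m \<oplus>\<^bsub>M\<^esub> a \<odot>\<^bsub>M\<^esub> m'"
    and l_assoc: "\<lbrakk>a \<in> carrier A; a' \<in> carrier A; m \<in> carrier M\<rbrakk>
      \<Longrightarrow> (a \<otimes>\<^bsub>A\<^esub> a') \<odot>\<^bsub>M\<^esub> m = a \<odot>\<^bsub>M\<^esub> (a' \<odot>\<^bsub>M\<^esub> m)"
    and r_distr_scal: "\<lbrakk>b \<in> carrier B; b' \<in> carrier B; m \<in> carrier M\<rbrakk>
      \<Longrightarrow> m \<boxdot>\<^bsub>M\<^esub> (b \<oplus>\<^bsub>B\<^esub> b') = m \<boxdot>\<^bsub>M\<^esub> b \<oplus>\<^bsub>M\<^esub> m \<boxdot>\<^bsub>M\<^esub> b'"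
    and r_distr_vec: "\<lbrakk>b \<in> carrier B; m \<in> carrier M; m' \<in> carrier M\<rbrakk>
      \<Longrightarrow> (m \<oplus>\<^bsub>M\<^esub> m') \<boxdot>\<^bsub>M\<^esub> b = m \<boxdot>\<^bsub>M\<^esub> b \<oplus>\<^bsub>M\<^esub> m' \<boxdot>\<^bsub>M\<^esub> b"
    and r_assoc: "\<lbrakk>b \<in> carrier B; b' \<in> carrier B; m \<in> carrier M\<rbrakk>
      \<Longrightarrow> m \<boxdot>\<^bsub>M\<^esub> (b \<otimes>\<^bsub>B\<^esub> b') = (m \<boxdot>\<^bsub>M\<^esub> b) \<boxdot>\<^bsub>M\<^esub> b'"
    and lr_assoc: "\<lbrakk>a \<in> carrier A; b \<in> carrier B; m \<in> carrier M\<rbrakk>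
      \<Longrightarrow> (a \<odot>\<^bsub>M\<^esub> m) \<boxdot>\<^bsub>M\<^esub> b = a \<odot>\<^bsub>M\<^esub> (m \<boxdot>\<^bsub>M\<^esub> b)"
    and l_unital: "add_span M {a \<odot>\<^bsub>M\<^esub> m | a m. a \<in> carrier A \<and> m \<in> carrier M} = carrier M"
    and r_unital: "add_span M {m \<boxdot>\<^bsub>M\<^esub> b | b m. b \<in> carrier B \<and> m \<in> carrier M} = carrier M"

text \<open>
  Balanced biadditive maps that are bimodule homomorphisms, i.e. bimodule homomorphisms
  \<open>M \<otimes>\<^sub>B N \<rightarrow> A\<close> written without forming the tensor product; surjectivity of the induced map
  says that the values generate \<open>A\<close> additively.
\<close>

definition surj_pairing ::
  "('a, 'x) ring_scheme \<Rightarrow> ('b, 'y) ring_scheme \<Rightarrow> ('a, 'b, 'm) bimodule \<Rightarrow> ('b, 'a, 'n) bimodule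
    \<Rightarrow> ('m \<Rightarrow> 'n \<Rightarrow> 'a) \<Rightarrow> bool"
  where "surj_pairing A B M N \<phi> \<longleftrightarrow>
    (\<forall>m\<in>carrier M. \<forall>n\<in>carrier N. \<phi> m n \<in> carrier A) \<and>
    (\<forall>m\<in>carrier M. \<forall>m'\<in>carrier M. \<forall>n\<in>carrier N. \<phi> (m \<oplus>\<^bsub>M\<^esub> m') n = \<phi> m n \<oplus>\<^bsub>A\<^esub> \<phi> m' n) \<and>
    (\<forall>m\<in>carrier M. \<forall>n\<in>carrier N. \<forall>n'\<in>carrier N. \<phi> m (n \<oplus>\<^bsub>N\<^esub> n') = \<phi> m n \<oplus>\<^bsub>A\<^esub> \<phi> m n') \<and>
    (\<forall>m\<in>carrier M. \<forall>n\<in>carrier N. \<forall>b\<in>carrier B. \<phi> (m \<boxdot>\<^bsub>M\<^esub> b) n = \<phi> m (b \<odot>\<^bsub>N\<^esub> n)) \<and>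
    (\<forall>m\<in>carrier M. \<forall>n\<in>carrier N. \<forall>a\<in>carrier A. \<phi> (a \<odot>\<^bsub>M\<^esub> m) n = a \<otimes>\<^bsub>A\<^esub> \<phi> m n) \<and>
    (\<forall>m\<in>carrier M. \<forall>n\<in>carrier N. \<forall>a\<in>carrier A. \<phi> m (n \<boxdot>\<^bsub>N\<^esub> a) = \<phi> m n \<otimes>\<^bsub>A\<^esub> a) \<and>
    add_span A {\<phi> m n | m n. m \<in> carrier M \<and> n \<in> carrier N} = carrier A"

definition surj_morita_context ::
  "('a, 'x) ring_scheme \<Rightarrow> ('b, 'y) ring_scheme \<Rightarrow> ('a, 'b, 'm) bimodule \<Rightarrow> ('b, 'a, 'n) bimodule
    \<Rightarrow> ('m \<Rightarrow> 'n \<Rightarrow> 'a) \<Rightarrow> ('n \<Rightarrow> 'm \<Rightarrow> 'b) \<Rightarrow> bool"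
  where "surj_morita_context A B M N \<phi> \<psi> \<longleftrightarrow>
    unital_bimodule A B M \<and> unital_bimodule B A N \<and>
    surj_pairing A B M N \<phi> \<and> surj_pairing B A N M \<psi> \<and>
    (\<forall>m\<in>carrier M. \<forall>n\<in>carrier N. \<forall>m'\<in>carrier M. \<phi> m n \<odot>\<^bsub>M\<^esub> m' = m \<boxdot>\<^bsub>M\<^esub> \<psi> n m') \<and>
    (\<forall>n\<in>carrier N. \<forall>m\<in>carrier M. \<forall>n'\<in>carrier N. \<psi> n m \<odot>\<^bsub>N\<^esub> n' = n \<boxdot>\<^bsub>N\<^esub> \<phi> m n')"

text \<open>
  The bimodules are quantified over one fixed type, which is no restriction: if
  \<open>u = (\<Sum>i. \<phi> (m i) (n i))\<close> is an idempotent of \<open>A\<close> with \<open>u m = m\<close>, then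
  \<open>m = (\<Sum>i. m i \<psi> (n i) m)\<close>, so \<open>m\<close> is determined by \<open>u\<close> and the finite list of the elements
  \<open>\<psi> (n i) m\<close> of \<open>B\<close>. Hence the carrier of \<open>M\<close>, and likewise that of \<open>N\<close>, embeds into the lists
  over \<open>A + B\<close>.
\<close>

definition morita_equivalent :: "('a, 'x) ring_scheme \<Rightarrow> ('b, 'y) ring_scheme \<Rightarrow> bool"
  where "morita_equivalent A B \<longleftrightarrow>
    rng A \<and> has_local_units A \<and> rng B \<and> has_local_units B \<and>
    (\<exists>(M :: ('a, 'b, ('a + 'b) list) bimodule) (N :: ('b, 'a, ('a + 'b) list) bimodule) \<phi> \<psi>.
      surj_morita_context A B M N \<phi> \<psi>)"


section \<open>Free algebras\<close>

text \<open>
  Words form the free monoid, written additively as \<open>poly_mapping\<close> requires; finitely supported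
  functions on words then have the convolution product.
\<close>

datatype 'g fword = FWord (letters: "'g list")

instantiation fword :: (type) monoid_add
begin

definition zero_fword :: "'a fword"
  where "zero_fword = FWord []"

definition plus_fword :: "'a fword \<Rightarrow> 'a fword \<Rightarrow> 'a fword"
  where "plus_fword x y = FWord (letters x @ letters y)"

instance
  by standard (simp_all add: zero_fword_def plus_fword_def)

end

abbreviation wmon :: "'g list \<Rightarrow> 'g fword \<Rightarrow>\<^sub>0 'r::comm_ring_1"
  where "wmon w \<equiv> Poly_Mapping.single (FWord w) 1"

text \<open>The free algebra without identity on \<open>G\<close>: words are nonempty.\<close>

definition free_alg :: "'g set \<Rightarrow> ('r, 'g fword \<Rightarrow>\<^sub>0 'r::comm_ring_1) module"
  where "free_alg G =
    \<lparr>carrier = {f. \<forall>w\<in>Poly_Mapping.keys f. letters w \<noteq> [] \<and> set (letters w) \<subseteq> G},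
     mult = (*), one = 1, zero = 0, add = (+),
     smult = (\<lambda>c f. Poly_Mapping.single 0 c * f)\<rparr>"


section \<open>Leavitt path algebras\<close>

text \<open>The source and range of an edge are its \<^const>\<open>tail\<close> and its \<^const>\<open>head\<close>.\<close>

datatype ('v, 'e) lgen = Vtx 'v | Edg 'e | Gst 'e

definition lpa_gens :: "('v, 'e) pre_digraph \<Rightarrow> ('v, 'e) lgen set"
  where "lpa_gens E = Vtx ` verts E \<union> Edg ` arcs E \<union> Gst ` arcs E"

definition lpa_relations ::
  "'r itself \<Rightarrow> ('v, 'e) pre_digraph \<Rightarrow> (('v, 'e) lgen fword \<Rightarrow>\<^sub>0 'r::comm_ring_1) set"
  where "lpa_relations R E =
    {wmon [Vtx v] * wmon [Vtx v] - wmon [Vtx v] | v. v \<in> verts E} \<union>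
    {wmon [Vtx v] * wmon [Vtx w] | v w. v \<in> verts E \<and> w \<in> verts E \<and> v \<noteq> w} \<union>
    {wmon [Vtx (tail E e)] * wmon [Edg e] - wmon [Edg e] | e. e \<in> arcs E} \<union>
    {wmon [Edg e] * wmon [Vtx (head E e)] - wmon [Edg e] | e. e \<in> arcs E} \<union>
    {wmon [Vtx (head E e)] * wmon [Gst e] - wmon [Gst e] | e. e \<in> arcs E} \<union>
    {wmon [Gst e] * wmon [Vtx (tail E e)] - wmon [Gst e] | e. e \<in> arcs E} \<union>
    {wmon [Gst e] * wmon [Edg e] - wmon [Vtx (head E e)] | e. e \<in> arcs E} \<union>
    {wmon [Gst e] * wmon [Edg f] | e f. e \<in> arcs E \<and> f \<in> arcs E \<and> e \<noteq> f} \<union>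
    {wmon [Vtx v] - (\<Sum>e\<in>out_arcs E v. wmon [Edg e] * wmon [Gst e]) | v.
      v \<in> verts E \<and> finite (out_arcs E v) \<and> out_arcs E v \<noteq> {}}"

text \<open>
  All scalar multiples of the relations are taken as generators, since in a ring without identity
  the ring ideal generated by a set need not be closed under scalar multiplication.
\<close>

definition lpa_relideal ::
  "'r itself \<Rightarrow> ('v, 'e) pre_digraph \<Rightarrow> (('v, 'e) lgen fword \<Rightarrow>\<^sub>0 'r::comm_ring_1) set"
  where "lpa_relideal R E =
    rng_genideal (free_alg (lpa_gens E))
      {c \<odot>\<^bsub>free_alg (lpa_gens E)\<^esub> x | c x. x \<in> lpa_relations R E}"

type_synonym ('r, 'v, 'e) lpa = "(('v, 'e) lgen fword \<Rightarrow>\<^sub>0 'r) set"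

definition leavitt ::
  "'r itself \<Rightarrow> ('v, 'e) pre_digraph \<Rightarrow> ('r::comm_ring_1, ('r, 'v, 'e) lpa) module"
  where "leavitt R E = alg_quot (free_alg (lpa_gens E)) (lpa_relideal R E)"

definition lword ::
  "'r itself \<Rightarrow> ('v, 'e) pre_digraph \<Rightarrow> ('v, 'e) lgen list \<Rightarrow> ('r::comm_ring_1, 'v, 'e) lpa"
  where "lword R E w = lpa_relideal R E +>\<^bsub>free_alg (lpa_gens E)\<^esub> wmon w"

abbreviation "lvtx R E v \<equiv> lword R E [Vtx v]"
abbreviation "ledg R E e \<equiv> lword R E [Edg e]"
abbreviation "lgst R E e \<equiv> lword R E [Gst e]"

text \<open>
  A path is given by its source \<open>u\<close> and its list \<open>p\<close> of edges; the former is needed for paths of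
  length zero. The second definition is \<open>\<alpha>\<^sup>*\<close> for the path \<open>\<alpha> = (u, p)\<close>.
\<close>

definition lpath ::
  "'r itself \<Rightarrow> ('v, 'e) pre_digraph \<Rightarrow> 'v \<Rightarrow> 'e list \<Rightarrow> ('r::comm_ring_1, 'v, 'e) lpa"
  where "lpath R E u p = lword R E (if p = [] then [Vtx u] else map Edg p)"

definition lpath_star ::
  "'r itself \<Rightarrow> ('v, 'e) pre_digraph \<Rightarrow> 'v \<Rightarrow> 'e list \<Rightarrow> ('r::comm_ring_1, 'v, 'e) lpa"
  where "lpath_star R E u p = lword R E (if p = [] then [Vtx u] else map Gst (rev p))"

definition homogeneous ::
  "'r itself \<Rightarrow> ('v, 'e) pre_digraph \<Rightarrow> int \<Rightarrow> ('r::comm_ring_1, 'v, 'e) lpa set"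
  where "homogeneous R E k =
    add_span (leavitt R E)
      {c \<odot>\<^bsub>leavitt R E\<^esub> (lpath R E u p \<otimes>\<^bsub>leavitt R E\<^esub> lpath_star R E v q) | c u p v q w.
        pre_digraph.awalk E u p w \<and> pre_digraph.awalk E v q w \<and>
        int (length p) - int (length q) = k}"

definition graded_ideal ::
  "'r itself \<Rightarrow> ('v, 'e) pre_digraph \<Rightarrow> ('r::comm_ring_1, 'v, 'e) lpa set \<Rightarrow> bool"
  where "graded_ideal R E I \<longleftrightarrow>
    rng_ideal I (leavitt R E) \<and>
    internal_direct_sum (leavitt R E) I (\<lambda>k. I \<inter> homogeneous R E k)"

text \<open>\<open>v - (\<Sum>e\<in>F. e e\<^sup>*)\<close>\<close>

definition lgap ::
  "'r itself \<Rightarrow> ('v, 'e) pre_digraph \<Rightarrow> 'v \<Rightarrow> 'e set \<Rightarrow> ('r::comm_ring_1, 'v, 'e) lpa"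
  where "lgap R E v F =
    lvtx R E v \<ominus>\<^bsub>leavitt R E\<^esub>
      finsum (leavitt R E) (\<lambda>e. ledg R E e \<otimes>\<^bsub>leavitt R E\<^esub> lgst R E e) F"

definition basic_ideal ::
  "'r itself \<Rightarrow> ('v, 'e) pre_digraph \<Rightarrow> ('r::comm_ring_1, 'v, 'e) lpa set \<Rightarrow> bool"
  where "basic_ideal R E I \<longleftrightarrow>
    rng_ideal I (leavitt R E) \<and>
    (\<forall>c x. c \<noteq> 0 \<and>
      ((\<exists>v\<in>verts E. x = lvtx R E v) \<or>
       (\<exists>v\<in>verts E. \<exists>F. finite F \<and> F \<subseteq> out_arcs E v \<and> x = lgap R E v F)) \<and>
      c \<odot>\<^bsub>leavitt R E\<^esub> x \<in> I \<longrightarrow> x \<in> I)"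


section \<open>Admissible pairs and auxiliary graphs\<close>

definition hereditary :: "('v, 'e) pre_digraph \<Rightarrow> 'v set \<Rightarrow> bool"
  where "hereditary E X \<longleftrightarrow> X \<subseteq> verts E \<and> (\<forall>e\<in>arcs E. tail E e \<in> X \<longrightarrow> head E e \<in> X)"

definition saturated :: "('v, 'e) pre_digraph \<Rightarrow> 'v set \<Rightarrow> bool"
  where "saturated E X \<longleftrightarrow> X \<subseteq> verts E \<and>
    (\<forall>v\<in>verts E. finite (out_arcs E v) \<and> out_arcs E v \<noteq> {} \<and> head E ` out_arcs E v \<subseteq> X \<longrightarrow> v \<in> X)"

definition breaking :: "('v, 'e) pre_digraph \<Rightarrow> 'v set \<Rightarrow> 'v set"
  where "breaking E H = {v \<in> verts E - H. infinite (out_arcs E v) \<and>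
    finite {e \<in> out_arcs E v. head E e \<notin> H} \<and> {e \<in> out_arcs E v. head E e \<notin> H} \<noteq> {}}"

definition admissible_pair :: "('v, 'e) pre_digraph \<Rightarrow> 'v set \<Rightarrow> 'v set \<Rightarrow> bool"
  where "admissible_pair E H S \<longleftrightarrow> hereditary E H \<and> saturated E H \<and> S \<subseteq> breaking E H"

text \<open>The element \<open>v\<^sup>H\<close>.\<close>

definition lbreak ::
  "'r itself \<Rightarrow> ('v, 'e) pre_digraph \<Rightarrow> 'v set \<Rightarrow> 'v \<Rightarrow> ('r::comm_ring_1, 'v, 'e) lpa"
  where "lbreak R E H v = lgap R E v {e \<in> out_arcs E v. head E e \<notin> H}"

definition vertex_ideal ::
  "'r itself \<Rightarrow> ('v, 'e) pre_digraph \<Rightarrow> 'v set \<Rightarrow> ('r::comm_ring_1, 'v, 'e) lpa set"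
  where "vertex_ideal R E X = rng_genideal (leavitt R E) (lvtx R E ` X)"

definition pair_ideal ::
  "'r itself \<Rightarrow> ('v, 'e) pre_digraph \<Rightarrow> 'v set \<Rightarrow> 'v set \<Rightarrow> ('r::comm_ring_1, 'v, 'e) lpa set"
  where "pair_ideal R E H S = rng_genideal (leavitt R E) (lvtx R E ` H \<union> lbreak R E H ` S)"

definition restrict_graph :: "('v, 'e) pre_digraph \<Rightarrow> 'v set \<Rightarrow> ('v, 'e) pre_digraph"
  where "restrict_graph E X =
    \<lparr>verts = X, arcs = {e \<in> arcs E. tail E e \<in> X}, tail = tail E, head = head E\<rparr>"

definition pair_graph :: "('v, 'e) pre_digraph \<Rightarrow> 'v set \<Rightarrow> 'v set \<Rightarrow> ('v, 'e) pre_digraph"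
  where "pair_graph E H S =
    \<lparr>verts = H \<union> S,
     arcs = {e \<in> arcs E. tail E e \<in> H} \<union> {e \<in> arcs E. tail E e \<in> S \<and> head E e \<in> H},
     tail = tail E, head = head E\<rparr>"

datatype 'a primed = Old 'a | Prime 'a

fun quotient_tail :: "('v, 'e) pre_digraph \<Rightarrow> 'e primed \<Rightarrow> 'v primed"
  where
    "quotient_tail E (Old e) = Old (tail E e)"
  | "quotient_tail E (Prime e) = Old (tail E e)"

fun quotient_head :: "('v, 'e) pre_digraph \<Rightarrow> 'e primed \<Rightarrow> 'v primed"
  where
    "quotient_head E (Old e) = Old (head E e)"
  | "quotient_head E (Prime e) = Prime (head E e)"

definition quotient_graph ::
  "('v, 'e) pre_digraph \<Rightarrow> 'v set \<Rightarrow> 'v set \<Rightarrow> ('v primed, 'e primed) pre_digraph"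
  where "quotient_graph E H S =
    \<lparr>verts = Old ` (verts E - H) \<union> Prime ` (breaking E H - S),
     arcs = Old ` {e \<in> arcs E. head E e \<in> verts E - H}
       \<union> Prime ` {e \<in> arcs E. head E e \<in> breaking E H - S},
     tail = quotient_tail E, head = quotient_head E\<rparr>"

definition canonical_on_generators ::
  "'r itself \<Rightarrow> ('v, 'e) pre_digraph \<Rightarrow> 'v set \<Rightarrow> 'v set
    \<Rightarrow> (('r::comm_ring_1, 'v primed, 'e primed) lpa \<Rightarrow> ('r, 'v, 'e) lpa set) \<Rightarrow> bool"
  where "canonical_on_generators R E H S \<theta> \<longleftrightarrow>
    (let L = leavitt R E;
         Q = quotient_graph E H S;
         B = breaking E H - S;
         cls = (\<lambda>x. pair_ideal R E H S +>\<^bsub>L\<^esub> x);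
         gap = lbreak R E H;
         cut = (\<lambda>w. lvtx R E w \<ominus>\<^bsub>L\<^esub> lbreak R E H w)
     in
      (\<forall>v\<in>verts E - H - B. \<theta> (lvtx R Q (Old v)) = cls (lvtx R E v)) \<and>
      (\<forall>v\<in>B. \<theta> (lvtx R Q (Old v)) = cls (cut v) \<and> \<theta> (lvtx R Q (Prime v)) = cls (gap v)) \<and>
      (\<forall>e\<in>arcs E. head E e \<in> verts E - H - B \<longrightarrow>
        \<theta> (ledg R Q (Old e)) = cls (ledg R E e) \<and>
        \<theta> (lgst R Q (Old e)) = cls (lgst R E e)) \<and>
      (\<forall>e\<in>arcs E. head E e \<in> B \<longrightarrow>
        \<theta> (ledg R Q (Old e)) = cls (ledg R E e \<otimes>\<^bsub>L\<^esub> cut (head E e)) \<and>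
        \<theta> (ledg R Q (Prime e)) = cls (ledg R E e \<otimes>\<^bsub>L\<^esub> gap (head E e)) \<and>
        \<theta> (lgst R Q (Old e)) = cls (cut (head E e) \<otimes>\<^bsub>L\<^esub> lgst R E e) \<and>
        \<theta> (lgst R Q (Prime e)) = cls (gap (head E e) \<otimes>\<^bsub>L\<^esub> lgst R E e)))"

end

theory Submission imports Defs begin

text \<open>
  Let \<open>I\<close> be the ideal of an admissible pair \<open>(H, S)\<close>. If an ideal \<open>J\<close> containing \<open>I\<close> has a homogeneous
  element outside \<open>I\<close>, multiplying it by suitable edges and ghost edges yields in \<open>J\<close> some \<open>c v\<close> with
  \<open>v \<notin> H\<close>, or \<open>c v\<^sup>H\<close> with \<open>v\<close> a breaking vertex not in \<open>S\<close>, where \<open>c \<noteq> 0\<close>. For the kernel \<open>J\<close> of the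
  map onto the algebra of the quotient graph this is impossible, which gives (3); for graded basic
  ideals \<open>J\<close> it gives (4). That nonzero multiples of vertices do not vanish and that homogeneous
  components are independent is seen on a representation by operators on functions on
  \<open>E\<^sup>0 \<times> \<nat> \<times> \<int>\<close>.

  For (1) and (2), the algebra of the restricted graph embeds as a subring \<open>D\<close> that generates the ideal
  and satisfies \<open>D L D \<subseteq> D\<close>, where \<open>L\<close> is the whole algebra. The idempotents \<open>\<alpha> \<alpha>\<^sup>*\<close> and \<open>\<alpha> v\<^sup>H \<alpha>\<^sup>*\<close> commute
  with each other, hence yield local units of the ideal, and \<open>L D\<close>, \<open>D L\<close> form a Morita context.
\<close>

section \<open>Additive spans and rings without identity\<close>

text \<open>A nonzero coefficient from R cannot be divided out, so the reduction ends in
  \<open>c v\<close> and not in \<open>v\<close>. For kernels this means that every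
  \<open>c v\<close> with \<open>c \<noteq> 0\<close> has to survive, which is why the
  representation acts on functions with values in R itself. For graded ideals, being basic is
  exactly what removes the coefficient again. The representation is not claimed to be faithful. It
  shows that no \<open>c v\<close> vanishes and that operators of different degrees are independent;
  the reduction, applied with the zero ideal, then excludes nonzero homogeneous elements from its
  kernel. The same argument gives the injectivity of the embedding behind (1) and (2). Parts (1) and
  (2) are one statement about a hereditary set X and a set S of vertices that are breaking for X; in
  (1) the set S is empty. Nothing here has an identity: sums of vertices and joins of commuting
  idempotents stand in for it.\<close>

context abelian_group
begin

lemma add_subgroupI:
  assumes "H \<subseteq> carrier G" "\<zero> \<in> H"
    and "\<And>x y. x \<in> H \<Longrightarrow> y \<in> H \<Longrightarrow> x \<oplus> y \<in> H"
    and "\<And>x. x \<in> H \<Longrightarrow> \<ominus> x \<in> H"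
  shows "additive_subgroup H G"
  by (rule additive_subgroupI, rule add.subgroupI) (use assms in auto)

lemma add_span_subset: "S \<subseteq> carrier G \<Longrightarrow> add_span G S \<subseteq> carrier G"
  by (rule add.generate_incl)

lemma add_span_subgroup: "S \<subseteq> carrier G \<Longrightarrow> additive_subgroup (add_span G S) G"
  by (rule additive_subgroupI, rule add.generate_is_subgroup)

lemma add_span_least: "additive_subgroup H G \<Longrightarrow> S \<subseteq> H \<Longrightarrow> add_span G S \<subseteq> H"
  by (rule add.generate_subgroup_incl) (auto dest: additive_subgroup.a_subgroup)

lemma add_span_eq_carrier: "S \<subseteq> carrier G \<Longrightarrow> carrier G \<subseteq> S \<Longrightarrow> add_span G S = carrier G"
  using add_span_subset generate.incl by fastforce

lemma minus_eq_zero_iff: "x \<in> carrier G \<Longrightarrow> y \<in> carrier G \<Longrightarrow> x \<ominus> y = \<zero> \<longleftrightarrow> x = y"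
  by (metis a_minus_def add.inv_closed minus_equality minus_minus r_neg)

lemma add_diff_cancel: "x \<in> carrier G \<Longrightarrow> y \<in> carrier G \<Longrightarrow> x \<ominus> y \<oplus> y = x"
  by (simp add: a_minus_def a_assoc l_neg)

lemma diff_add_cancel: "x \<in> carrier G \<Longrightarrow> y \<in> carrier G \<Longrightarrow> x \<oplus> y \<ominus> y = x"
  by (simp add: a_minus_def a_assoc r_neg)

lemma diff_zero [simp]: "x \<in> carrier G \<Longrightarrow> x \<ominus> \<zero> = x"
  by (simp add: a_minus_def)

lemma finsum_mono_neutral:
  assumes "finite B" "A \<subseteq> B" "f \<in> B \<rightarrow> carrier G" "\<And>x. x \<in> B - A \<Longrightarrow> f x = \<zero>"
  shows "finsum G f B = finsum G f A"
  by (rule sym, rule add.finprod_mono_neutral_cong_left) (use assms in auto)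

lemma finsum_in_subgroup:
  assumes "additive_subgroup H G" "\<And>x. x \<in> A \<Longrightarrow> f x \<in> H"
  shows "finsum G f A \<in> H"
proof -
  interpret additive_subgroup H G by fact
  show ?thesis
    using assms(2)
  proof (induction A rule: infinite_finite_induct)
    case (insert x F)
    then show ?case
      using a_subset by (subst finsum_insert) auto
  qed auto
qed

lemma finsum_singleton_support:
  assumes "finite A" "a \<in> A" "f a \<in> carrier G" "\<And>x. x \<in> A \<Longrightarrow> x \<noteq> a \<Longrightarrow> f x = \<zero>"
  shows "finsum G f A = f a"
proof -
  have "finsum G f A = finsum G f {a}"
  proof (rule finsum_mono_neutral)
    show "f \<in> A \<rightarrow> carrier G"
      using assms(3,4) by (metis Pi_I zero_closed)
  qed (use assms in auto)
  then show ?thesis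
    using assms by (simp add: Pi_def)
qed

end

section \<open>Arithmetic and generated ideals in rings without identity\<close>

context rng
begin

declare m_closed [simp, intro]

lemma l_null [simp]: "x \<in> carrier A \<Longrightarrow> \<zero> \<otimes> x = \<zero>"
  by (metis add.l_cancel_one l_distr m_closed r_zero zero_closed)

lemma r_null [simp]: "x \<in> carrier A \<Longrightarrow> x \<otimes> \<zero> = \<zero>"
  by (metis add.l_cancel_one r_distr m_closed r_zero zero_closed)

lemma l_minus: "x \<in> carrier A \<Longrightarrow> y \<in> carrier A \<Longrightarrow> (\<ominus> x) \<otimes> y = \<ominus> (x \<otimes> y)"
  by (rule minus_equality[symmetric]) (simp_all add: l_distr[symmetric] l_neg)

lemma r_minus: "x \<in> carrier A \<Longrightarrow> y \<in> carrier A \<Longrightarrow> x \<otimes> (\<ominus> y) = \<ominus> (x \<otimes> y)"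
  by (rule minus_equality[symmetric]) (simp_all add: r_distr[symmetric] l_neg)

lemma l_diff_distr:
  "x \<in> carrier A \<Longrightarrow> y \<in> carrier A \<Longrightarrow> z \<in> carrier A \<Longrightarrow> (x \<ominus> y) \<otimes> z = x \<otimes> z \<ominus> y \<otimes> z"
  by (simp add: a_minus_def l_distr l_minus)

lemma r_diff_distr:
  "x \<in> carrier A \<Longrightarrow> y \<in> carrier A \<Longrightarrow> z \<in> carrier A \<Longrightarrow> z \<otimes> (x \<ominus> y) = z \<otimes> x \<ominus> z \<otimes> y"
  by (simp add: a_minus_def r_distr r_minus)

lemma finsum_l_distr:
  assumes "f \<in> F \<rightarrow> carrier A" "x \<in> carrier A" "finite F"
  shows "finsum A f F \<otimes> x = finsum A (\<lambda>i. f i \<otimes> x) F"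
  using assms(3,1)
  by (induction F rule: finite_induct) (use assms(2) in \<open>auto simp: l_distr Pi_def\<close>)

lemma finsum_r_distr:
  assumes "f \<in> F \<rightarrow> carrier A" "x \<in> carrier A" "finite F"
  shows "x \<otimes> finsum A f F = finsum A (\<lambda>i. x \<otimes> f i) F"
  using assms(3,1)
  by (induction F rule: finite_induct) (use assms(2) in \<open>auto simp: r_distr Pi_def\<close>)

lemma rng_idealI:
  assumes "I \<subseteq> carrier A" "\<zero> \<in> I"
    and "\<And>x y. x \<in> I \<Longrightarrow> y \<in> I \<Longrightarrow> x \<oplus> y \<in> I"
    and "\<And>x. x \<in> I \<Longrightarrow> \<ominus> x \<in> I"
    and "\<And>a x. a \<in> I \<Longrightarrow> x \<in> carrier A \<Longrightarrow> x \<otimes> a \<in> I"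
    and "\<And>a x. a \<in> I \<Longrightarrow> x \<in> carrier A \<Longrightarrow> a \<otimes> x \<in> I"
  shows "rng_ideal I A"
proof -
  interpret additive_subgroup I A
    using assms(1-4) by (rule add_subgroupI)
  show ?thesis
    by unfold_locales (use assms in auto)
qed

lemma rng_ideal_carrier: "rng_ideal (carrier A) A"
  by (rule rng_idealI) auto

lemma rng_genideal_ideal:
  assumes "S \<subseteq> carrier A"
  shows "rng_ideal (rng_genideal A S) A"
proof (rule rng_idealI)
  show "rng_genideal A S \<subseteq> carrier A"
    using rng_ideal_carrier assms by (auto simp: rng_genideal_def)
qed (auto simp: rng_genideal_def
      intro: additive_subgroup.zero_closed additive_subgroup.a_closed
        additive_subgroup.a_inv_closed rng_ideal.I_l_closed rng_ideal.I_r_closed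
        rng_ideal.axioms(1))

lemma rng_genideal_incl: "x \<in> S \<Longrightarrow> x \<in> rng_genideal A S"
  by (auto simp: rng_genideal_def)

lemma rng_genideal_least: "rng_ideal I A \<Longrightarrow> S \<subseteq> I \<Longrightarrow> rng_genideal A S \<subseteq> I"
  by (auto simp: rng_genideal_def)

end

section \<open>Algebras over a commutative ring and their linear spans\<close>

locale ralg = rng A for A :: "('r::comm_ring_1, 'a) module" (structure) +
  assumes smult_closed [simp, intro]: "x \<in> carrier A \<Longrightarrow> c \<odot> x \<in> carrier A"
    and smult_l_distr: "x \<in> carrier A \<Longrightarrow> (c + d) \<odot> x = c \<odot> x \<oplus> d \<odot> x"
    and smult_r_distr: "x \<in> carrier A \<Longrightarrow> y \<in> carrier A \<Longrightarrow> c \<odot> (x \<oplus> y) = c \<odot> x \<oplus> c \<odot> y"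
    and smult_assoc: "x \<in> carrier A \<Longrightarrow> c \<odot> (d \<odot> x) = (c * d) \<odot> x"
    and smult_one [simp]: "x \<in> carrier A \<Longrightarrow> 1 \<odot> x = x"
    and smult_mult_l: "x \<in> carrier A \<Longrightarrow> y \<in> carrier A \<Longrightarrow> (c \<odot> x) \<otimes> y = c \<odot> (x \<otimes> y)"
    and smult_mult_r: "x \<in> carrier A \<Longrightarrow> y \<in> carrier A \<Longrightarrow> x \<otimes> (c \<odot> y) = c \<odot> (x \<otimes> y)"
begin

lemma smult_zero_l [simp]: "x \<in> carrier A \<Longrightarrow> 0 \<odot> x = \<zero>"
  by (metis add.l_cancel_one add_0 smult_closed smult_l_distr)

lemma smult_zero_r [simp]: "c \<odot> \<zero> = \<zero>"
  by (metis add.l_cancel_one l_zero smult_closed smult_r_distr zero_closed)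

lemma smult_uminus: "x \<in> carrier A \<Longrightarrow> (- c) \<odot> x = \<ominus> (c \<odot> x)"
  by (rule minus_equality[symmetric]) (auto simp: smult_l_distr[symmetric])

lemma a_inv_smult: "x \<in> carrier A \<Longrightarrow> \<ominus> x = (- 1) \<odot> x"
  by (simp add: smult_uminus)

lemma smult_a_inv: "x \<in> carrier A \<Longrightarrow> c \<odot> (\<ominus> x) = \<ominus> (c \<odot> x)"
  by (simp add: a_inv_smult smult_assoc mult.commute)

lemma smult_diff: "x \<in> carrier A \<Longrightarrow> y \<in> carrier A \<Longrightarrow> c \<odot> (x \<ominus> y) = c \<odot> x \<ominus> c \<odot> y"
  by (simp add: a_minus_def smult_r_distr smult_a_inv)

lemma smult_finsum:
  assumes "f \<in> F \<rightarrow> carrier A" "finite F"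
  shows "c \<odot> finsum A f F = finsum A (\<lambda>i. c \<odot> f i) F"
  using assms(2,1) by (induction F rule: finite_induct) (auto simp: smult_r_distr Pi_def)

text \<open>\<open>add_span\<close> only takes sums and negatives, so the scalars are built into the
  generators.\<close>

definition lspan :: "'a set \<Rightarrow> 'a set"
  where "lspan M = add_span A {c \<odot> m | c m. m \<in> M}"

lemma lspan_base: "M \<subseteq> carrier A \<Longrightarrow> m \<in> M \<Longrightarrow> c \<odot> m \<in> lspan M"
  unfolding lspan_def by (rule generate.incl) auto

lemma lspan_incl: "M \<subseteq> carrier A \<Longrightarrow> m \<in> M \<Longrightarrow> m \<in> lspan M"
  using lspan_base[of M m 1] by auto

lemma lspan_zero [simp]: "\<zero> \<in> lspan M"
  unfolding lspan_def using generate.one[of "add_monoid A"] by simp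

lemma lspan_add: "x \<in> lspan M \<Longrightarrow> y \<in> lspan M \<Longrightarrow> x \<oplus> y \<in> lspan M"
  unfolding lspan_def using generate.eng[of _ "add_monoid A"] by simp

text \<open>Negatives need no case of their own, because the negative of \<open>c \<odot> m\<close>
  is \<open>(- c) \<odot> m\<close>.\<close>

lemma lspan_induct [consumes 2, case_names zero base add]:
  assumes "x \<in> lspan M" "M \<subseteq> carrier A"
    and "P \<zero>" "\<And>c m. m \<in> M \<Longrightarrow> P (c \<odot> m)"
    and "\<And>x y. x \<in> lspan M \<Longrightarrow> y \<in> lspan M \<Longrightarrow> P x \<Longrightarrow> P y \<Longrightarrow> P (x \<oplus> y)"
  shows "P x"
  using assms(1)[unfolded lspan_def]
proof (induction x rule: generate.induct)
  case (inv h)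
  then obtain c m where h: "h = c \<odot> m" "m \<in> M" by auto
  then have "inv\<^bsub>add_monoid A\<^esub> h = (- c) \<odot> m"
    using assms(2) by (auto simp: smult_uminus a_inv_def[symmetric])
  then show ?case
    using assms(4) h by simp
next
  case (eng h1 h2)
  then show ?case
    using assms(5) unfolding lspan_def by auto
qed (use assms(3,4) in auto)

lemma lspan_subset: "M \<subseteq> carrier A \<Longrightarrow> lspan M \<subseteq> carrier A"
  unfolding lspan_def by (rule add_span_subset) auto

lemma lspan_smult:
  assumes "M \<subseteq> carrier A" "x \<in> lspan M"
  shows "c \<odot> x \<in> lspan M"
  using assms(2,1)
proof (induction x rule: lspan_induct)
  case (base d m)
  then have "c \<odot> (d \<odot> m) = (c * d) \<odot> m"
    using assms(1) by (auto intro: smult_assoc)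
  then show ?case
    using base assms(1) by (simp add: lspan_base)
next
  case (add x y)
  then have "c \<odot> (x \<oplus> y) = c \<odot> x \<oplus> c \<odot> y"
    using lspan_subset[OF assms(1)] by (intro smult_r_distr) auto
  then show ?case
    using add by (simp add: lspan_add)
qed auto

lemma lspan_subgroup: "M \<subseteq> carrier A \<Longrightarrow> additive_subgroup (lspan M) A"
  unfolding lspan_def by (rule add_span_subgroup) auto

lemma lspan_mono: "M \<subseteq> N \<Longrightarrow> lspan M \<subseteq> lspan N"
  unfolding lspan_def by (rule add.mono_generate) auto

end

section \<open>Cosets and quotient algebras\<close>

context rng_ideal
begin

lemma ideal_carrier: "x \<in> I \<Longrightarrow> x \<in> carrier A"
  using a_subset by auto

lemma ideal_diff: "x \<in> I \<Longrightarrow> y \<in> I \<Longrightarrow> x \<ominus> y \<in> I"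
  by (simp add: a_minus_def)

lemma ideal_subgroup: "abelian_subgroup I A"
  by (rule abelian_subgroupI3) unfold_locales

sublocale abelian_subgroup I A
  by (rule ideal_subgroup)

lemma ideal_add_iff: "x \<in> I \<Longrightarrow> y \<in> carrier A \<Longrightarrow> y \<oplus> x \<in> I \<longleftrightarrow> y \<in> I"
  using ideal_diff[of "y \<oplus> x" x] by (auto simp: diff_add_cancel ideal_carrier)

lemma coset_eq_iff:
  assumes "x \<in> carrier A" "y \<in> carrier A"
  shows "I +> x = I +> y \<longleftrightarrow> x \<ominus> y \<in> I"
proof
  assume "I +> x = I +> y"
  then have "x \<in> I +> y"
    using a_rcos_self[OF assms(1)] by simp
  then show "x \<ominus> y \<in> I"
    using a_rcos_module[OF assms(2,1)] by (simp add: a_minus_def)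
next
  assume "x \<ominus> y \<in> I"
  then have "x \<in> I +> y"
    using a_rcos_module[OF assms(2,1)] by (simp add: a_minus_def)
  then show "I +> x = I +> y"
    using a_repr_independence'[OF _ assms(2)] by simp
qed

text \<open>\<open>rcoset_mult\<close> is the union of the cosets of all products of
  representatives. These cosets coincide because \<open>a b - x y = (a - x) b + x (b - y)\<close>
  lies in the ideal.\<close>

lemma coset_mult:
  assumes "x \<in> carrier A" "y \<in> carrier A"
  shows "rcoset_mult A I (I +> x) (I +> y) = I +> (x \<otimes> y)"
proof -
  have eq: "I +> (a \<otimes> b) = I +> (x \<otimes> y)" if a: "a \<in> I +> x" and b: "b \<in> I +> y" for a b
  proof -
    have ca: "a \<in> carrier A" "b \<in> carrier A"
      using assms a b a_elemrcos_carrier by auto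
    have d: "a \<ominus> x \<in> I" "b \<ominus> y \<in> I"
      using a b assms ca a_rcos_module unfolding a_minus_def by auto
    have "(a \<ominus> x) \<otimes> b \<oplus> x \<otimes> (b \<ominus> y) = (a \<otimes> b \<ominus> x \<otimes> b) \<oplus> (x \<otimes> b \<ominus> x \<otimes> y)"
      using ca assms by (simp add: l_diff_distr r_diff_distr)
    also have "\<dots> = a \<otimes> b \<ominus> x \<otimes> y"
      using ca assms by (simp add: a_minus_def a_assoc r_neg1)
    finally have "a \<otimes> b \<ominus> x \<otimes> y = (a \<ominus> x) \<otimes> b \<oplus> x \<otimes> (b \<ominus> y)" ..
    also have "\<dots> \<in> I"
      using d ca assms I_l_closed I_r_closed by auto
    finally show ?thesis
      using ca assms by (subst coset_eq_iff) auto
  qed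
  show ?thesis
    unfolding rcoset_mult_def
    by (intro UN_constant_eq[OF a_rcos_self[OF assms(1)]] UN_constant_eq[OF a_rcos_self[OF assms(2)]] ballI eq)
qed

end

text \<open>In a ring without identity \<open>c \<odot> x\<close> need not be a product with
  \<open>x\<close>, so stability under scalars is a condition of its own. It is what makes the union
  of cosets in the scalar action of \<open>alg_quot\<close> a single coset.\<close>

locale alg_ideal = ralg A + rng_ideal I A for A :: "('r::comm_ring_1, 'a) module" (structure) and I +
  assumes I_smult: "x \<in> I \<Longrightarrow> c \<odot> x \<in> I"
begin

abbreviation (input) Q where "Q \<equiv> alg_quot A I"

lemma quot_carrier: "carrier Q = (\<lambda>x. I +> x) ` carrier A"
  by (auto simp: alg_quot_def ring.defs module.defs FactRing_def A_RCOSETS_def RCOSETS_def a_r_coset_def)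

lemma quot_add: "x \<in> carrier A \<Longrightarrow> y \<in> carrier A \<Longrightarrow> (I +> x) \<oplus>\<^bsub>Q\<^esub> (I +> y) = I +> (x \<oplus> y)"
  by (simp add: alg_quot_def ring.defs module.defs FactRing_def a_rcos_sum)

lemma quot_mult: "x \<in> carrier A \<Longrightarrow> y \<in> carrier A \<Longrightarrow> (I +> x) \<otimes>\<^bsub>Q\<^esub> (I +> y) = I +> (x \<otimes> y)"
  by (simp add: alg_quot_def ring.defs module.defs FactRing_def coset_mult)

lemma quot_zero: "\<zero>\<^bsub>Q\<^esub> = I +> \<zero>"
  by (simp add: alg_quot_def ring.defs module.defs FactRing_def a_rcos_const)

lemma quot_smult: "x \<in> carrier A \<Longrightarrow> c \<odot>\<^bsub>Q\<^esub> (I +> x) = I +> (c \<odot> x)"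
proof -
  assume x: "x \<in> carrier A"
  have "I +> (c \<odot> y) = I +> (c \<odot> x)" if y: "y \<in> I +> x" for y
  proof -
    have cy: "y \<in> carrier A"
      using x y a_elemrcos_carrier by auto
    have "y \<ominus> x \<in> I"
      using y x cy a_rcos_module unfolding a_minus_def by auto
    then have "c \<odot> y \<ominus> c \<odot> x \<in> I"
      using I_smult x cy by (simp add: smult_diff[symmetric])
    then show ?thesis
      using x cy by (subst coset_eq_iff) auto
  qed
  then have "(\<Union>y\<in>I +> x. I +> (c \<odot> y)) = I +> (c \<odot> x)"
    by (intro UN_constant_eq[OF a_rcos_self[OF x]] ballI)
  then show ?thesis
    by (simp add: alg_quot_def ring.defs module.defs FactRing_def)
qed

lemma quot_ralg: "ralg Q"
proof -
  have ag: "abelian_group Q"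
  proof (rule abelian_groupI)
    fix x assume "x \<in> carrier Q"
    then obtain a where a: "a \<in> carrier A" "x = I +> a" by (auto simp: quot_carrier)
    then show "\<exists>y\<in>carrier Q. y \<oplus>\<^bsub>Q\<^esub> x = \<zero>\<^bsub>Q\<^esub>"
      by (intro bexI[of _ "I +> (\<ominus> a)"]) (auto simp: quot_carrier quot_add quot_zero l_neg)
  qed (auto simp: quot_carrier quot_add quot_zero a_ac)
  show ?thesis
    by (intro ralg.intro rng.intro ag rng_axioms.intro ralg_axioms.intro)
      (auto simp: quot_carrier quot_add quot_zero quot_mult quot_smult m_assoc l_distr r_distr
        smult_l_distr smult_r_distr smult_assoc smult_mult_l smult_mult_r)
qed

end

section \<open>Free algebras\<close>

lemma free_alg_simps [simp]:
  "carrier (free_alg G) = {f. \<forall>w\<in>Poly_Mapping.keys f. letters w \<noteq> [] \<and> set (letters w) \<subseteq> G}"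
  "mult (free_alg G) = (*)" "zero (free_alg G) = 0" "add (free_alg G) = (+)"
  "smult (free_alg G) = (\<lambda>c f. Poly_Mapping.single 0 c * f)"
  by (simp_all add: free_alg_def)

lemma letters_plus [simp]: "letters (x + y) = letters x @ letters y"
  by (simp add: plus_fword_def)

lemma keys_smult: "Poly_Mapping.keys (Poly_Mapping.single 0 c * f) \<subseteq> Poly_Mapping.keys f"
  using keys_mult[of "Poly_Mapping.single 0 c" f] by (auto split: if_splits)

text \<open>The case of a single word is asked only for keys of \<open>f\<close>. In the free
  algebra without identity this is how an induction knows that the word is nonempty and consists of
  generators.\<close>

lemma poly_mapping_single_induct [case_names zero single add]:
  fixes f :: "'k \<Rightarrow>\<^sub>0 'c::comm_monoid_add"
  assumes "P 0" "\<And>k c. k \<in> Poly_Mapping.keys f \<Longrightarrow> P (Poly_Mapping.single k c)"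
    and "\<And>f g. P f \<Longrightarrow> P g \<Longrightarrow> P (f + g)"
  shows "P f"
proof -
  have "P (\<Sum>k\<in>K. Poly_Mapping.single k (Poly_Mapping.lookup f k))" if "K \<subseteq> Poly_Mapping.keys f" for K
    using finite_subset[OF that finite_keys] that
    by (induction K rule: finite_induct) (use assms in auto)
  moreover have "f = (\<Sum>k\<in>Poly_Mapping.keys f. Poly_Mapping.single k (Poly_Mapping.lookup f k))"
    by (rule poly_mapping_eqI) (auto simp: lookup_sum lookup_single when_def in_keys_iff)
  ultimately show ?thesis
    by (metis order_refl)
qed

text \<open>Words do not commute, but a constant sits at the neutral word and R is commutative, so
  constants are central. This lets scalars pass to the right factor of a product.\<close>

lemma single_zero_commute:
  fixes f :: "'a::monoid_add \<Rightarrow>\<^sub>0 'r::comm_ring_1"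
  shows "f * Poly_Mapping.single 0 c = Poly_Mapping.single 0 c * f"
  by (induction f rule: poly_mapping_single_induct) (auto simp: mult_single algebra_simps)

lemma free_alg_ralg: "ralg (free_alg G :: ('r::comm_ring_1, 'g fword \<Rightarrow>\<^sub>0 'r) module)"
proof -
  have add: "abelian_group (free_alg G :: ('r, 'g fword \<Rightarrow>\<^sub>0 'r) module)"
  proof (rule abelian_groupI)
    fix x y :: "'g fword \<Rightarrow>\<^sub>0 'r"
    show "x \<in> carrier (free_alg G) \<Longrightarrow> y \<in> carrier (free_alg G) \<Longrightarrow> x \<oplus>\<^bsub>free_alg G\<^esub> y \<in> carrier (free_alg G)"
      using keys_add[of x y] by auto
    show "x \<in> carrier (free_alg G) \<Longrightarrow> \<exists>y\<in>carrier (free_alg G). y \<oplus>\<^bsub>free_alg G\<^esub> x = \<zero>\<^bsub>free_alg G\<^esub>"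
      by (intro bexI[of _ "-x"]) (auto simp: in_keys_iff)
  qed (auto simp: algebra_simps)
  have mult: "x * y \<in> carrier (free_alg G)"
    if "x \<in> carrier (free_alg G)" "y \<in> carrier (free_alg G)" for x y :: "'g fword \<Rightarrow>\<^sub>0 'r"
    using that keys_mult[of x y] by fastforce
  have smult: "Poly_Mapping.single 0 c * x \<in> carrier (free_alg G)"
    if "x \<in> carrier (free_alg G)" for c and x :: "'g fword \<Rightarrow>\<^sub>0 'r"
    using that keys_smult[of c x] by auto
  have comm: "x * (Poly_Mapping.single 0 c * y) = Poly_Mapping.single 0 c * (x * y)"
    for c and x y :: "'g fword \<Rightarrow>\<^sub>0 'r"
    by (metis mult.assoc single_zero_commute)
  have assoc: "Poly_Mapping.single 0 c * (Poly_Mapping.single 0 d * x) = Poly_Mapping.single 0 (c * d) * x"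
    for c d and x :: "'g fword \<Rightarrow>\<^sub>0 'r"
    by (simp add: mult.assoc[symmetric] mult_single)
  show ?thesis
  proof (intro ralg.intro rng.intro add rng_axioms.intro ralg_axioms.intro)
    fix x y :: "'g fword \<Rightarrow>\<^sub>0 'r" and c d :: 'r
    show "c \<odot>\<^bsub>free_alg G\<^esub> (d \<odot>\<^bsub>free_alg G\<^esub> x) = (c * d) \<odot>\<^bsub>free_alg G\<^esub> x"
      by (simp add: assoc)
    show "x \<otimes>\<^bsub>free_alg G\<^esub> (c \<odot>\<^bsub>free_alg G\<^esub> y) = c \<odot>\<^bsub>free_alg G\<^esub> (x \<otimes>\<^bsub>free_alg G\<^esub> y)"
      by (simp add: comm)
  qed (use mult smult in \<open>auto simp del: free_alg_simps(1) simp: distrib_left distrib_right single_add mult.assoc\<close>)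
qed

section \<open>Leavitt families\<close>

text \<open>\<open>P e\<close> and \<open>G e\<close> stand for the edge \<open>e\<close> and its
  ghost edge. Working with families serves twice: the computations with paths apply to the
  generators of every \<open>leavitt R E\<close>, and a family in another algebra is what defines a
  homomorphism into it.\<close>

locale lfam = ralg A + wf_digraph E
  for A :: "('r::comm_ring_1, 'a) module" (structure) and E :: "('v, 'e) pre_digraph" +
  fixes V :: "'v \<Rightarrow> 'a" and P :: "'e \<Rightarrow> 'a" and G :: "'e \<Rightarrow> 'a"
  assumes V_closed [simp]: "v \<in> verts E \<Longrightarrow> V v \<in> carrier A"
    and P_closed [simp]: "e \<in> arcs E \<Longrightarrow> P e \<in> carrier A"
    and G_closed [simp]: "e \<in> arcs E \<Longrightarrow> G e \<in> carrier A"
    and V_idem: "v \<in> verts E \<Longrightarrow> V v \<otimes> V v = V v"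
    and V_orth: "v \<in> verts E \<Longrightarrow> w \<in> verts E \<Longrightarrow> v \<noteq> w \<Longrightarrow> V v \<otimes> V w = \<zero>"
    and V_P: "e \<in> arcs E \<Longrightarrow> V (tail E e) \<otimes> P e = P e"
    and P_V: "e \<in> arcs E \<Longrightarrow> P e \<otimes> V (head E e) = P e"
    and V_G: "e \<in> arcs E \<Longrightarrow> V (head E e) \<otimes> G e = G e"
    and G_V: "e \<in> arcs E \<Longrightarrow> G e \<otimes> V (tail E e) = G e"
    and G_P: "e \<in> arcs E \<Longrightarrow> G e \<otimes> P e = V (head E e)"
    and G_P_neq: "e \<in> arcs E \<Longrightarrow> f \<in> arcs E \<Longrightarrow> e \<noteq> f \<Longrightarrow> G e \<otimes> P f = \<zero>"
    and V_sum: "v \<in> verts E \<Longrightarrow> finite (out_arcs E v) \<Longrightarrow> out_arcs E v \<noteq> {} \<Longrightarrow>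
      V v = finsum A (\<lambda>e. P e \<otimes> G e) (out_arcs E v)"

text \<open>The elements of the generated ideal all of whose multiples stay in it form an ideal that
  contains S, hence they are the whole ideal.\<close>

lemma (in ralg) alg_ideal_genideal:
  assumes "S \<subseteq> carrier A" "\<And>c x. x \<in> S \<Longrightarrow> c \<odot> x \<in> S"
  shows "alg_ideal A (rng_genideal A S)"
proof -
  let ?I = "rng_genideal A S"
  interpret I: rng_ideal ?I A
    by (rule rng_genideal_ideal) fact
  let ?J = "{x \<in> ?I. \<forall>c. c \<odot> x \<in> ?I}"
  have "rng_ideal ?J A"
    by (rule rng_idealI)
      (auto simp: smult_r_distr smult_a_inv I.ideal_carrier smult_mult_l[symmetric] smult_mult_r[symmetric]
        I.I_l_closed I.I_r_closed)
  moreover have "S \<subseteq> ?J"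
    using assms(2) rng_genideal_incl by blast
  ultimately have "?I \<subseteq> ?J"
    by (rule rng_genideal_least)
  then show ?thesis
    by unfold_locales auto
qed

lemma wmon_carrier: "w \<noteq> [] \<Longrightarrow> set w \<subseteq> G \<Longrightarrow> wmon w \<in> carrier (free_alg G)"
  by simp

lemma wmon_mult: "wmon u * wmon w = (wmon (u @ w) :: 'g fword \<Rightarrow>\<^sub>0 'r::comm_ring_1)"
  by (simp add: mult_single plus_fword_def)

lemma free_alg_closed:
  fixes x y :: "'g fword \<Rightarrow>\<^sub>0 'r::comm_ring_1"
  assumes "x \<in> carrier (free_alg G)" "y \<in> carrier (free_alg G)"
  shows "x * y \<in> carrier (free_alg G)" "x - y \<in> carrier (free_alg G)" "x + y \<in> carrier (free_alg G)"
proof -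
  interpret ralg "free_alg G :: ('r, 'g fword \<Rightarrow>\<^sub>0 'r) module" by (rule free_alg_ralg)
  show "x * y \<in> carrier (free_alg G)" "x + y \<in> carrier (free_alg G)"
    using m_closed[OF assms] a_closed[OF assms]
    by (simp_all del: free_alg_simps(1))
  have "Poly_Mapping.keys (x - y) \<subseteq> Poly_Mapping.keys x \<union> Poly_Mapping.keys y"
    by (auto simp: in_keys_iff lookup_minus)
  then show "x - y \<in> carrier (free_alg G)"
    using assms by (simp add: subset_iff) blast
qed

lemma free_alg_smult_closed:
  fixes x :: "'g fword \<Rightarrow>\<^sub>0 'r::comm_ring_1"
  assumes "x \<in> carrier (free_alg G)"
  shows "Poly_Mapping.single 0 c * x \<in> carrier (free_alg G)"
  using ralg.smult_closed[OF free_alg_ralg assms, of c] by (simp del: free_alg_simps(1))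

lemma free_alg_sum:
  fixes f :: "'i \<Rightarrow> 'g fword \<Rightarrow>\<^sub>0 'r::comm_ring_1"
  assumes "\<And>i. i \<in> I \<Longrightarrow> f i \<in> carrier (free_alg G)"
  shows "(\<Sum>i\<in>I. f i) \<in> carrier (free_alg G)"
  using assms
proof (induction I rule: infinite_finite_induct)
  case (insert i I)
  then show ?case
    by (simp add: free_alg_closed del: free_alg_simps(1))
qed simp_all

lemma free_alg_a_inv:
  fixes x :: "'g fword \<Rightarrow>\<^sub>0 'r::comm_ring_1"
  assumes "x \<in> carrier (free_alg G)"
  shows "\<ominus>\<^bsub>free_alg G\<^esub> x = - x"
proof -
  interpret ralg "free_alg G :: ('r, 'g fword \<Rightarrow>\<^sub>0 'r) module" by (rule free_alg_ralg)
  show ?thesis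
    by (rule minus_equality) (use assms in \<open>auto simp: in_keys_iff\<close>)
qed

section \<open>The Leavitt path algebra as a quotient of the free algebra\<close>

locale lpa = wf_digraph E for E :: "('v, 'e) pre_digraph" +
  fixes R :: "'r::comm_ring_1 itself"
begin

abbreviation "gens \<equiv> lpa_gens E"
abbreviation "FA \<equiv> free_alg gens :: ('r, ('v, 'e) lgen fword \<Rightarrow>\<^sub>0 'r) module"
abbreviation "K \<equiv> lpa_relideal R E"
abbreviation "L \<equiv> leavitt R E"

sublocale FA: ralg FA
  by (rule free_alg_ralg)

lemma gens_simps [simp]:
  "Vtx v \<in> gens \<longleftrightarrow> v \<in> verts E" "Edg e \<in> gens \<longleftrightarrow> e \<in> arcs E" "Gst e \<in> gens \<longleftrightarrow> e \<in> arcs E"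
  by (auto simp: lpa_gens_def)

lemma relations_carrier: "lpa_relations R E \<subseteq> carrier FA"
  unfolding lpa_relations_def
  by (auto simp del: free_alg_simps(1) simp: out_arcs_def
      intro!: free_alg_closed free_alg_sum wmon_carrier)

sublocale K: alg_ideal FA K
  unfolding lpa_relideal_def
proof (rule FA.alg_ideal_genideal)
  show "{c \<odot>\<^bsub>FA\<^esub> x |c x. x \<in> lpa_relations R E} \<subseteq> carrier FA"
    using relations_carrier FA.smult_closed by blast
  show "c \<odot>\<^bsub>FA\<^esub> x \<in> {c \<odot>\<^bsub>FA\<^esub> x |c x. x \<in> lpa_relations R E}"
    if "x \<in> {c \<odot>\<^bsub>FA\<^esub> x |c x. x \<in> lpa_relations R E}" for c x
    using that FA.smult_assoc relations_carrier by blast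
qed

sublocale L: ralg L
  unfolding leavitt_def by (rule K.quot_ralg)

lemma relation_K: "x \<in> lpa_relations R E \<Longrightarrow> x \<in> K"
  unfolding lpa_relideal_def
  using relations_carrier FA.smult_one[of x]
  by (intro FA.rng_genideal_incl CollectI exI[of _ 1] exI[of _ x]) (auto simp del: free_alg_simps)

definition q where "q x = K +>\<^bsub>FA\<^esub> x"

lemma q_lword: "lword R E w = q (wmon w)"
  by (simp add: lword_def q_def)

lemma q_closed: "x \<in> carrier FA \<Longrightarrow> q x \<in> carrier L"
  unfolding leavitt_def q_def K.quot_carrier by (rule imageI)

lemma q_simps:
  assumes "x \<in> carrier FA" "y \<in> carrier FA"
  shows "q (x + y) = q x \<oplus>\<^bsub>L\<^esub> q y" "q (x * y) = q x \<otimes>\<^bsub>L\<^esub> q y"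
  using assms K.quot_add[of x y] K.quot_mult[of x y]
  unfolding leavitt_def q_def by (simp_all del: free_alg_simps(1))

lemma q_smult: "x \<in> carrier FA \<Longrightarrow> q (Poly_Mapping.single 0 c * x) = c \<odot>\<^bsub>L\<^esub> q x"
  using K.quot_smult[of x c] unfolding leavitt_def q_def by (simp del: free_alg_simps(1))

lemma q_zero: "q 0 = \<zero>\<^bsub>L\<^esub>"
  unfolding leavitt_def q_def K.quot_zero by simp

lemma carrier_L: "carrier L = q ` carrier FA"
  unfolding leavitt_def q_def K.quot_carrier by simp

lemma q_eq_iff: "x \<in> carrier FA \<Longrightarrow> y \<in> carrier FA \<Longrightarrow> q x = q y \<longleftrightarrow> x - y \<in> K"
  unfolding q_def K.coset_eq_iff by (simp add: a_minus_def free_alg_a_inv del: free_alg_simps(1))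

lemma q_sum:
  assumes "\<And>i. i \<in> I \<Longrightarrow> f i \<in> carrier FA"
  shows "q (\<Sum>i\<in>I. f i) = finsum L (\<lambda>i. q (f i)) I"
  using assms
proof (induction I rule: infinite_finite_induct)
  case (insert i I)
  then show ?case
    by (subst L.finsum_insert)
      (auto simp: q_simps q_closed free_alg_sum simp del: free_alg_simps(1))
qed (auto simp: q_zero)

lemma lword_closed [simp]: "w \<noteq> [] \<Longrightarrow> set w \<subseteq> gens \<Longrightarrow> lword R E w \<in> carrier L"
  unfolding q_lword by (rule q_closed) (auto intro: wmon_carrier)

lemma lword_append:
  "u \<noteq> [] \<Longrightarrow> set u \<subseteq> gens \<Longrightarrow> w \<noteq> [] \<Longrightarrow> set w \<subseteq> gens \<Longrightarrow>
    lword R E (u @ w) = lword R E u \<otimes>\<^bsub>L\<^esub> lword R E w"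
  unfolding q_lword using q_simps(2)[of "wmon u" "wmon w"] by (auto simp: wmon_mult)

lemma lword_Cons:
  "g \<in> gens \<Longrightarrow> w \<noteq> [] \<Longrightarrow> set w \<subseteq> gens \<Longrightarrow> lword R E (g # w) = lword R E [g] \<otimes>\<^bsub>L\<^esub> lword R E w"
  using lword_append[of "[g]" w] by simp

lemma relation_eq:
  "x - y \<in> lpa_relations R E \<Longrightarrow> x \<in> carrier FA \<Longrightarrow> y \<in> carrier FA \<Longrightarrow> q x = q y"
  by (subst q_eq_iff) (auto intro: relation_K simp del: free_alg_simps(1))

lemma relation_zero: "x \<in> lpa_relations R E \<Longrightarrow> q x = \<zero>\<^bsub>L\<^esub>"
  using relation_eq[of x 0] relations_carrier q_zero by (auto simp del: free_alg_simps(1) intro: FA.zero_closed[simplified])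

text \<open>After the three closure conditions the cases follow the assumptions of
  \<open>lfam\<close> in their order; each is one member of \<open>lpa_relations\<close> read
  through the quotient map \<open>q\<close>.\<close>

lemma leavitt_lfam: "lfam L E (lvtx R E) (ledg R E) (lgst R E)"
proof (unfold_locales, goal_cases)
  note [simp] = free_alg_closed wmon_carrier free_alg_sum
  note [simp del] = free_alg_simps(1)
  have m: "lword R E [g] \<otimes>\<^bsub>L\<^esub> lword R E [h] = q (wmon [g] * wmon [h])" if "g \<in> gens" "h \<in> gens" for g h
    unfolding q_lword using that by (simp add: q_simps)
  {
    case 4
    then show ?case
      by (simp add: m) (unfold q_lword, rule relation_eq, unfold lpa_relations_def, blast, simp_all)
  next
    case 5
    then show ?case
      by (simp add: m) (rule relation_zero, unfold lpa_relations_def, blast)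
  next
    case 6
    then show ?case
      by (simp add: m) (unfold q_lword, rule relation_eq, unfold lpa_relations_def, blast, simp_all)
  next
    case 7
    then show ?case
      by (simp add: m) (unfold q_lword, rule relation_eq, unfold lpa_relations_def, blast, simp_all)
  next
    case 8
    then show ?case
      by (simp add: m) (unfold q_lword, rule relation_eq, unfold lpa_relations_def, blast, simp_all)
  next
    case 9
    then show ?case
      by (simp add: m) (unfold q_lword, rule relation_eq, unfold lpa_relations_def, blast, simp_all)
  next
    case 10
    then show ?case
      by (simp add: m) (unfold q_lword, rule relation_eq, unfold lpa_relations_def, blast, simp_all)
  next
    case 11
    then show ?case
      by (simp add: m) (rule relation_zero, unfold lpa_relations_def, blast)
  next
    case (12 v)
    have "q (wmon [Vtx v]) = q (\<Sum>e\<in>out_arcs E v. wmon [Edg e] * wmon [Gst e])"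
    proof (rule relation_eq)
      show "wmon [Vtx v] - (\<Sum>e\<in>out_arcs E v. wmon [Edg e] * wmon [Gst e]) \<in> lpa_relations R E"
        unfolding lpa_relations_def using 12 by (intro UnI2 CollectI exI[of _ v] conjI refl)
    qed (use 12 in \<open>auto intro!: free_alg_sum\<close>)
    also have "\<dots> = finsum L (\<lambda>e. q (wmon [Edg e] * wmon [Gst e])) (out_arcs E v)"
      by (rule q_sum) auto
    also have "\<dots> = finsum L (\<lambda>e. ledg R E e \<otimes>\<^bsub>L\<^esub> lgst R E e) (out_arcs E v)"
      by (rule L.finsum_cong') (auto simp: m)
    finally show ?case
      by (simp add: q_lword)
  }
qed auto

lemma leavitt_induct [consumes 1, case_names zero word add]:
  assumes "x \<in> carrier L"
    and "Q \<zero>\<^bsub>L\<^esub>"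
    and "\<And>c w. w \<noteq> [] \<Longrightarrow> set w \<subseteq> gens \<Longrightarrow> Q (c \<odot>\<^bsub>L\<^esub> lword R E w)"
    and "\<And>x y. x \<in> carrier L \<Longrightarrow> y \<in> carrier L \<Longrightarrow> Q x \<Longrightarrow> Q y \<Longrightarrow> Q (x \<oplus>\<^bsub>L\<^esub> y)"
  shows "Q x"
proof -
  obtain f where f: "f \<in> carrier FA" "x = q f"
    using assms(1) carrier_L by auto
  have "f \<in> carrier FA \<and> Q (q f)"
  proof (induction f rule: poly_mapping_single_induct)
    case zero
    then show ?case
      using assms(2) q_zero by simp
  next
    case (single k c)
    obtain w where k: "k = FWord w" by (cases k)
    have w: "w \<noteq> []" "set w \<subseteq> gens"
      using bspec[OF f(1)[simplified] single] k by auto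
    have "Poly_Mapping.single k c = Poly_Mapping.single 0 c * wmon w"
      by (simp add: mult_single k)
    then show ?case
      using assms(3)[OF w] w
      by (simp add: q_lword q_smult free_alg_smult_closed wmon_carrier del: free_alg_simps(1))
  next
    case (add f g)
    then show ?case
      using assms(4) by (simp add: q_simps q_closed free_alg_closed del: free_alg_simps(1))
  qed
  then show ?thesis
    using f by simp
qed

lemma lword_in_subset:
  assumes "\<And>g. g \<in> gens \<Longrightarrow> lword R E [g] \<in> W"
    and "\<And>x y. x \<in> W \<Longrightarrow> y \<in> W \<Longrightarrow> x \<otimes>\<^bsub>L\<^esub> y \<in> W"
    and "w \<noteq> []" "set w \<subseteq> gens"
  shows "lword R E w \<in> W"
  using assms(3,4)
proof (induction w)
  case (Cons g w)
  then show ?case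
    using assms(1,2) by (cases "w = []") (auto simp: lword_Cons)
qed simp

lemma leavitt_generated:
  assumes "\<And>v. v \<in> verts E \<Longrightarrow> lvtx R E v \<in> W"
    and "\<And>e. e \<in> arcs E \<Longrightarrow> ledg R E e \<in> W" "\<And>e. e \<in> arcs E \<Longrightarrow> lgst R E e \<in> W"
    and "\<zero>\<^bsub>L\<^esub> \<in> W" "\<And>x y. x \<in> W \<Longrightarrow> y \<in> W \<Longrightarrow> x \<otimes>\<^bsub>L\<^esub> y \<in> W"
    and "\<And>x y. x \<in> W \<Longrightarrow> y \<in> W \<Longrightarrow> x \<oplus>\<^bsub>L\<^esub> y \<in> W" "\<And>c x. x \<in> W \<Longrightarrow> c \<odot>\<^bsub>L\<^esub> x \<in> W"
  shows "carrier L \<subseteq> W"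
proof
  fix x assume "x \<in> carrier L"
  then show "x \<in> W"
  proof (induction rule: leavitt_induct)
    case (word c w)
    have "lword R E w \<in> W"
      by (rule lword_in_subset[OF _ _ word]) (use assms in \<open>auto simp: lpa_gens_def\<close>)
    then show ?case
      by (rule assms)
  qed (use assms in auto)
qed

end

section \<open>Evaluation of words and the universal property\<close>

context lfam
begin

definition gval :: "('v, 'e) lgen \<Rightarrow> 'a"
  where "gval g = (case g of Vtx v \<Rightarrow> V v | Edg e \<Rightarrow> P e | Gst e \<Rightarrow> G e)"

lemma gval_simps [simp]: "gval (Vtx v) = V v" "gval (Edg e) = P e" "gval (Gst e) = G e"
  by (simp_all add: gval_def)

text \<open>Without an identity the empty word has no value; \<open>\<zero>\<close> is a
  placeholder, and the separate case of a single letter keeps it out of every product. Elements of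
  \<open>free_alg\<close> contain nonempty words only.\<close>

fun wval :: "('v, 'e) lgen list \<Rightarrow> 'a" where
  "wval [] = \<zero>"
| "wval [g] = gval g"
| "wval (g # h # w) = gval g \<otimes> wval (h # w)"

abbreviation "good w \<equiv> w \<noteq> [] \<and> set w \<subseteq> lpa_gens E"

lemma gval_closed: "g \<in> lpa_gens E \<Longrightarrow> gval g \<in> carrier A"
  by (auto simp: lpa_gens_def)

lemma wval_closed: "set w \<subseteq> lpa_gens E \<Longrightarrow> wval w \<in> carrier A"
  by (induction w rule: wval.induct) (auto simp: gval_closed)

lemma wval_append:
  "u \<noteq> [] \<Longrightarrow> set u \<subseteq> lpa_gens E \<Longrightarrow> w \<noteq> [] \<Longrightarrow> set w \<subseteq> lpa_gens E \<Longrightarrow> wval (u @ w) = wval u \<otimes> wval w"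
proof (induction u rule: wval.induct)
  case (2 g)
  then show ?case by (cases w) auto
next
  case (3 g h u)
  have "wval (g # h # u @ w) = gval g \<otimes> (wval (h # u) \<otimes> wval w)"
    using 3 by simp
  also have "\<dots> = gval g \<otimes> wval (h # u) \<otimes> wval w"
    using 3 by (intro m_assoc[symmetric] gval_closed wval_closed) auto
  finally show ?case by simp
qed simp

definition ev :: "(('v, 'e) lgen fword \<Rightarrow>\<^sub>0 'r) \<Rightarrow> 'a"
  where "ev f = finsum A (\<lambda>w. Poly_Mapping.lookup f w \<odot> wval (letters w)) (Poly_Mapping.keys f)"

abbreviation "FC \<equiv> carrier (free_alg (lpa_gens E) :: ('r, ('v, 'e) lgen fword \<Rightarrow>\<^sub>0 'r) module)"

text \<open>Elements with different supports are compared by summing over a common finite set of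
  words, on which additivity is seen term by term.\<close>

lemma ev_superset:
  assumes "finite S" "Poly_Mapping.keys f \<subseteq> S" "\<And>w. w \<in> S \<Longrightarrow> set (letters w) \<subseteq> lpa_gens E"
  shows "ev f = finsum A (\<lambda>w. Poly_Mapping.lookup f w \<odot> wval (letters w)) S"
  unfolding ev_def
  by (rule finsum_mono_neutral[symmetric]) (use assms in \<open>auto simp: in_keys_iff wval_closed\<close>)

lemma ev_closed: "f \<in> FC \<Longrightarrow> ev f \<in> carrier A"
  unfolding ev_def by (rule finsum_closed) (auto intro!: wval_closed)

lemma ev_add:
  assumes "f \<in> FC" "g \<in> FC"
  shows "ev (f + g) = ev f \<oplus> ev g"
proof -
  let ?S = "Poly_Mapping.keys f \<union> Poly_Mapping.keys g"
  have S: "set (letters w) \<subseteq> lpa_gens E" if "w \<in> ?S" for w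
    using that assms by auto
  have "ev (f + g) = finsum A (\<lambda>w. Poly_Mapping.lookup (f + g) w \<odot> wval (letters w)) ?S"
    by (rule ev_superset) (use S keys_add[of f g] in auto)
  also have "\<dots> = finsum A (\<lambda>w. Poly_Mapping.lookup f w \<odot> wval (letters w) \<oplus>
      Poly_Mapping.lookup g w \<odot> wval (letters w)) ?S"
    by (rule finsum_cong') (auto simp: lookup_add smult_l_distr wval_closed S)
  also have "\<dots> = finsum A (\<lambda>w. Poly_Mapping.lookup f w \<odot> wval (letters w)) ?S \<oplus>
      finsum A (\<lambda>w. Poly_Mapping.lookup g w \<odot> wval (letters w)) ?S"
    by (rule finsum_addf) (auto simp: wval_closed S)
  also have "\<dots> = ev f \<oplus> ev g"
    using S by (subst (1 2) ev_superset[of ?S]) auto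
  finally show ?thesis .
qed

lemma ev_zero [simp]: "ev 0 = \<zero>"
  by (simp add: ev_def)

lemma ev_single: "good w \<Longrightarrow> ev (Poly_Mapping.single (FWord w) c) = c \<odot> wval w"
  using ev_superset[of "{FWord w}" "Poly_Mapping.single (FWord w) c"] by (simp add: wval_closed)

text \<open>Both sides are additive in each factor, so induction on the two factors leaves single
  words, where the claim is \<open>wval_append\<close>.\<close>

lemma ev_mult:
  assumes "f \<in> FC" "g \<in> FC"
  shows "ev (f * g) = ev f \<otimes> ev g"
proof -
  note [simp] = free_alg_closed ev_closed
  have ev_single_mult: "ev (Poly_Mapping.single (FWord u) c * g) = c \<odot> wval u \<otimes> ev g"
    if u: "good u" and "g \<in> FC" for u c g
  proof -
    have su: "Poly_Mapping.single (FWord u) c \<in> FC"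
      using u by simp
    have "g \<in> FC \<and> ev (Poly_Mapping.single (FWord u) c * g) = c \<odot> wval u \<otimes> ev g"
    proof (induction g rule: poly_mapping_single_induct)
      case (single k d)
      obtain w where k: "k = FWord w" by (cases k)
      have w: "good w"
        using bspec[OF \<open>g \<in> FC\<close>[simplified] single] k by simp
      have "ev (Poly_Mapping.single (FWord u) c * Poly_Mapping.single k d) =
          ev (Poly_Mapping.single (FWord (u @ w)) (c * d))"
        by (simp add: mult_single k plus_fword_def)
      also have "\<dots> = (c * d) \<odot> (wval u \<otimes> wval w)"
        using u w by (simp add: ev_single wval_append)
      also have "\<dots> = (c \<odot> wval u) \<otimes> (d \<odot> wval w)"
        using u w by (simp add: smult_mult_l smult_mult_r smult_assoc mult.commute wval_closed)
      finally show ?case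
        using w k by (simp add: ev_single)
    next
      case (add f g)
      then show ?case
        using su u by (simp add: distrib_left ev_add r_distr wval_closed del: free_alg_simps(1))
    qed (use u in \<open>simp add: wval_closed\<close>)
    then show ?thesis ..
  qed
  have "f \<in> FC \<and> ev (f * g) = ev f \<otimes> ev g"
  proof (induction f rule: poly_mapping_single_induct)
    case (single k c)
    obtain w where k: "k = FWord w" by (cases k)
    have w: "good w"
      using bspec[OF \<open>f \<in> FC\<close>[simplified] single] k by simp
    then show ?case
      using k assms(2) by (simp add: ev_single ev_single_mult del: free_alg_simps(1)) simp
  next
    case (add f h)
    then show ?case
      using assms(2) by (simp add: distrib_right ev_add l_distr del: free_alg_simps(1))
  qed (use assms in simp)
  then show ?thesis ..
qed

lemma ev_diff:
  assumes "f \<in> FC" "g \<in> FC"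
  shows "ev (f - g) = ev f \<ominus> ev g"
proof -
  have "f - g \<in> FC"
    using assms by (rule free_alg_closed)
  then show ?thesis
    using ev_add[of "f - g" g] ev_closed assms by (simp add: diff_add_cancel del: free_alg_simps(1))
qed

lemma ev_smult:
  assumes "f \<in> FC"
  shows "ev (Poly_Mapping.single 0 c * f) = c \<odot> ev f"
proof -
  have "ev (Poly_Mapping.single 0 c * f) =
      finsum A (\<lambda>w. Poly_Mapping.lookup (Poly_Mapping.single 0 c * f) w \<odot> wval (letters w)) (Poly_Mapping.keys f)"
    by (rule ev_superset) (use assms keys_smult[of c f] in auto)
  also have "\<dots> = finsum A (\<lambda>w. c \<odot> (Poly_Mapping.lookup f w \<odot> wval (letters w))) (Poly_Mapping.keys f)"
    by (rule finsum_cong')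
      (use assms in \<open>auto simp: mult_map_scale_conv_mult[symmetric] Poly_Mapping.map.rep_eq when_def
        smult_assoc wval_closed\<close>)
  also have "\<dots> = c \<odot> ev f"
    unfolding ev_def by (rule smult_finsum[symmetric]) (use assms in \<open>auto intro!: wval_closed\<close>)
  finally show ?thesis .
qed

lemma ev_sum:
  assumes "\<And>i. i \<in> I \<Longrightarrow> f i \<in> FC"
  shows "ev (\<Sum>i\<in>I. f i) = finsum A (\<lambda>i. ev (f i)) I"
  using assms
proof (induction I rule: infinite_finite_induct)
  case (insert i I)
  then show ?case
    by (subst finsum_insert)
      (auto simp: ev_add ev_closed free_alg_sum simp del: free_alg_simps(1))
qed auto

lemma ev_wmon [simp]: "good w \<Longrightarrow> ev (wmon w) = wval w"
  by (simp add: ev_single wval_closed)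

lemma ev_relation:
  fixes R :: "'r itself"
  assumes "x \<in> lpa_relations R E"
  shows "ev x = \<zero>"
proof -
  interpret lpa E R by unfold_locales
  note [simp] = free_alg_closed wmon_carrier free_alg_sum ev_diff ev_mult ev_sum minus_eq_zero_iff
    V_idem V_orth V_P P_V V_G G_V G_P G_P_neq
  note [simp del] = free_alg_simps(1)
  have sum_relation: "ev (wmon [Vtx v] - (\<Sum>e\<in>out_arcs E v. wmon [Edg e] * wmon [Gst e])) = \<zero>"
    if "v \<in> verts E" "finite (out_arcs E v)" "out_arcs E v \<noteq> {}" for v
  proof -
    have "V v = (\<Oplus>e\<in>out_arcs E v. ev (wmon [Edg e] * wmon [Gst e]))"
      unfolding V_sum[OF that] by (rule finsum_cong') auto
    also have "\<dots> = ev (\<Sum>e\<in>out_arcs E v. wmon [Edg e] * wmon [Gst e])"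
      by (rule ev_sum[symmetric]) auto
    finally have "V v = \<dots>" .
    moreover have "(\<Sum>e\<in>out_arcs E v. wmon [Edg e] * wmon [Gst e]) \<in> FC"
      by (rule free_alg_sum) auto
    ultimately show ?thesis
      using that(1) by (simp add: ev_closed del: ev_sum)
  qed
  have "x \<in> lpa_relations R E \<Longrightarrow> ev x = \<zero>"
    unfolding lpa_relations_def
    by (elim UnE CollectE exE conjE; hypsubst; ((rule sum_relation; assumption) | simp))
  then show ?thesis
    using assms .
qed

text \<open>\<open>ev\<close> kills all scalar multiples of the relations, and the elements it kills
  form an ideal. So it vanishes on \<open>K\<close> and factors through the quotient map.\<close>

theorem leavitt_universal:
  fixes R :: "'r itself"
  shows "\<exists>h\<in>alg_hom (leavitt R E) A. (\<forall>v\<in>verts E. h (lvtx R E v) = V v) \<and>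
    (\<forall>e\<in>arcs E. h (ledg R E e) = P e) \<and> (\<forall>e\<in>arcs E. h (lgst R E e) = G e)"
proof -
  interpret lpa E R by unfold_locales
  let ?J = "{f \<in> FC. ev f = \<zero>}"
  note [simp] = free_alg_closed free_alg_smult_closed free_alg_a_inv
  note [simp del] = free_alg_simps(1)
  have "rng_ideal ?J FA"
  proof (rule FA.rng_idealI)
    fix x assume x: "x \<in> ?J"
    have "- x = 0 - x" "0 \<in> FC"
      by (simp_all add: free_alg_simps(1))
    then have "- x \<in> FC" "ev (- x) = \<zero>"
      using x free_alg_closed(2)[of 0 gens x] ev_diff[of 0 x] by (auto simp: minus_eq_zero_iff)
    then show "\<ominus>\<^bsub>FA\<^esub> x \<in> ?J"
      using x by auto
  qed (use FA.zero_closed in \<open>auto simp: ev_add ev_mult ev_closed\<close>)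
  moreover have "{c \<odot>\<^bsub>FA\<^esub> x |c x. x \<in> lpa_relations R E} \<subseteq> ?J"
    using relations_carrier by (auto simp: ev_smult ev_relation subset_iff)
  ultimately have K: "K \<subseteq> ?J"
    unfolding lpa_relideal_def by (rule FA.rng_genideal_least)
  \<comment> \<open>A class is evaluated on a chosen representative. By \<open>hq\<close> the choice
    does not matter, since two representatives differ by an element of \<open>K\<close>.\<close>
  define h where "h X = ev (SOME f. f \<in> FC \<and> q f = X)" for X
  have hq: "h (q f) = ev f" if f: "f \<in> FC" for f
  proof -
    have "\<exists>g. g \<in> FC \<and> q g = q f"
      using f by auto
    then have g: "(SOME g. g \<in> FC \<and> q g = q f) \<in> FC \<and> q (SOME g. g \<in> FC \<and> q g = q f) = q f"
      by (rule someI_ex)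
    have "(SOME g. g \<in> FC \<and> q g = q f) - f \<in> K"
      using g f by (intro q_eq_iff[THEN iffD1]) simp_all
    then show ?thesis
      unfolding h_def using K g f by (auto simp: ev_diff minus_eq_zero_iff ev_closed)
  qed
  show ?thesis
  proof (intro bexI[of _ h] conjI ballI)
    show "h \<in> alg_hom L A"
      unfolding alg_hom_def carrier_L
      by (intro CollectI conjI ballI allI funcsetI; elim imageE;
          simp add: hq ev_closed q_simps[symmetric] q_smult[symmetric] ev_add ev_mult ev_smult)
    show "h (lvtx R E v) = V v" if "v \<in> verts E" for v
      using that by (simp add: q_lword hq wmon_carrier)
    show "h (ledg R E v) = P v" if "v \<in> arcs E" for v
      using that by (simp add: q_lword hq wmon_carrier)
    show "h (lgst R E v) = G v" if "v \<in> arcs E" for v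
      using that by (simp add: q_lword hq wmon_carrier)
  qed
qed

end

section \<open>Path monomials\<close>

context lfam
begin

text \<open>The product ends in the vertex where the path ends. This makes the path of length zero
  an ordinary base case; on longer paths the extra vertex is absorbed by the last edge.\<close>

primrec pp :: "'v \<Rightarrow> 'e list \<Rightarrow> 'a" where
  "pp u [] = V u"
| "pp u (e # p) = P e \<otimes> pp (head E e) p"

primrec sp :: "'v \<Rightarrow> 'e list \<Rightarrow> 'a" where
  "sp u [] = V u"
| "sp u (e # p) = sp (head E e) p \<otimes> G e"

lemma awalk_verts_ends: "awalk u p w \<Longrightarrow> u \<in> verts E \<and> w \<in> verts E"
  using awalk_hd_in_verts awalk_last_in_verts by blast

lemma pp_closed [simp]: "awalk u p w \<Longrightarrow> pp u p \<in> carrier A"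
  by (induction p arbitrary: u) (auto simp: awalk_Cons_iff awalk_Nil_iff)

lemma sp_closed [simp]: "awalk u p w \<Longrightarrow> sp u p \<in> carrier A"
  by (induction p arbitrary: u) (auto simp: awalk_Cons_iff awalk_Nil_iff)

lemma V_pp: "awalk u p w \<Longrightarrow> V u \<otimes> pp u p = pp u p"
  by (cases p) (auto simp: awalk_Cons_iff awalk_Nil_iff V_idem V_P m_assoc[symmetric])

lemma sp_V: "awalk u p w \<Longrightarrow> sp u p \<otimes> V u = sp u p"
  by (cases p) (auto simp: awalk_Cons_iff awalk_Nil_iff V_idem G_V m_assoc)

lemma pp_V:
  assumes "awalk u p w"
  shows "pp u p \<otimes> V w = pp u p"
proof -
  have "w \<in> verts E"
    using assms by (rule awalk_last_in_verts)
  with assms show ?thesis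
    by (induction p arbitrary: u) (auto simp: awalk_Cons_iff awalk_Nil_iff V_idem m_assoc)
qed

lemma V_sp:
  assumes "awalk u p w"
  shows "V w \<otimes> sp u p = sp u p"
proof -
  have "w \<in> verts E"
    using assms by (rule awalk_last_in_verts)
  with assms show ?thesis
    by (induction p arbitrary: u) (auto simp: awalk_Cons_iff awalk_Nil_iff V_idem m_assoc[symmetric])
qed

text \<open>Inserting \<open>V u\<close> in front of \<open>x\<close> leaves only the orthogonality
  of vertices to be used. The rules with a case distinction on the ends of an edge all come from
  this.\<close>

lemma V_absorb_l: "x \<in> carrier A \<Longrightarrow> V u \<otimes> x = x \<Longrightarrow> u \<in> verts E \<Longrightarrow> v \<in> verts E \<Longrightarrow>
    V v \<otimes> x = (if v = u then x else \<zero>)"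
  using m_assoc[of "V v" "V u" x] by (auto simp: V_orth)

lemma V_absorb_r: "x \<in> carrier A \<Longrightarrow> x \<otimes> V u = x \<Longrightarrow> u \<in> verts E \<Longrightarrow> v \<in> verts E \<Longrightarrow>
    x \<otimes> V v = (if v = u then x else \<zero>)"
  using m_assoc[of x "V u" "V v"] by (auto simp: V_orth)

lemma V_P_if: "e \<in> arcs E \<Longrightarrow> v \<in> verts E \<Longrightarrow> V v \<otimes> P e = (if v = tail E e then P e else \<zero>)"
  by (rule V_absorb_l) (auto simp: V_P)

lemma G_V_if: "e \<in> arcs E \<Longrightarrow> v \<in> verts E \<Longrightarrow> G e \<otimes> V v = (if v = tail E e then G e else \<zero>)"
  by (rule V_absorb_r) (auto simp: G_V)

lemma P_V_if: "e \<in> arcs E \<Longrightarrow> v \<in> verts E \<Longrightarrow> P e \<otimes> V v = (if v = head E e then P e else \<zero>)"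
  by (rule V_absorb_r) (auto simp: P_V)

lemma V_G_if: "e \<in> arcs E \<Longrightarrow> v \<in> verts E \<Longrightarrow> V v \<otimes> G e = (if v = head E e then G e else \<zero>)"
  by (rule V_absorb_l) (auto simp: V_G)

lemma G_P_if: "e \<in> arcs E \<Longrightarrow> f \<in> arcs E \<Longrightarrow> G e \<otimes> P f = (if e = f then V (head E e) else \<zero>)"
  by (simp add: G_P G_P_neq)

text \<open>The innermost pair \<open>G e \<otimes> P e\<close> collapses to the head of
  \<open>e\<close>, which the rest of the path absorbs; repeating this leaves the final
  vertex.\<close>

lemma sp_pp: "awalk u p w \<Longrightarrow> sp u p \<otimes> pp u p = V w"
proof (induction p arbitrary: u)
  case (Cons e p)
  then have e: "e \<in> arcs E" "u = tail E e" "awalk (head E e) p w"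
    by (auto simp: awalk_Cons_iff)
  have "sp u (e # p) \<otimes> pp u (e # p) = sp (head E e) p \<otimes> (G e \<otimes> P e \<otimes> pp (head E e) p)"
    using e by (simp add: m_assoc)
  also have "\<dots> = V w"
    using e Cons.IH by (simp add: G_P V_pp)
  finally show ?case .
qed (simp add: awalk_Nil_iff V_idem)

lemma P_pp: "e \<in> arcs E \<Longrightarrow> awalk u p w \<Longrightarrow> P e \<otimes> pp u p = (if u = head E e then pp (tail E e) (e # p) else \<zero>)"
  using m_assoc[of "P e" "V u" "pp u p"] by (auto simp: V_pp P_V_if awalk_verts_ends)

lemma G_pp_Cons: "e \<in> arcs E \<Longrightarrow> awalk u (f # p) w \<Longrightarrow> G e \<otimes> pp u (f # p) = (if e = f then pp (head E f) p else \<zero>)"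
  by (auto simp: awalk_Cons_iff m_assoc[symmetric] G_P_if V_pp)

lemma pp_snoc: "awalk u p (tail E e) \<Longrightarrow> e \<in> arcs E \<Longrightarrow> pp u (p @ [e]) = pp u p \<otimes> P e"
  by (induction p arbitrary: u) (auto simp: awalk_Cons_iff awalk_Nil_iff P_V V_P m_assoc)

lemma sp_snoc: "awalk u p (tail E e) \<Longrightarrow> e \<in> arcs E \<Longrightarrow> sp u (p @ [e]) = G e \<otimes> sp u p"
  by (induction p arbitrary: u) (auto simp: awalk_Cons_iff awalk_Nil_iff V_G G_V m_assoc)

lemma pp_append: "awalk u p v \<Longrightarrow> awalk v q w \<Longrightarrow> pp u (p @ q) = pp u p \<otimes> pp v q"
  by (induction p arbitrary: u) (auto simp: awalk_Cons_iff awalk_Nil_iff V_pp m_assoc)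

lemma sp_append: "awalk u p v \<Longrightarrow> awalk v q w \<Longrightarrow> sp u (p @ q) = sp v q \<otimes> sp u p"
  by (induction p arbitrary: u) (auto simp: awalk_Cons_iff awalk_Nil_iff sp_V m_assoc)

text \<open>The bound \<open>n\<close> on the length of the ghost part is the induction parameter of
  \<open>homogeneous_reduction\<close>: multiplication by an edge on the right lowers it, see
  \<open>Mon_P\<close>.\<close>

definition Mon :: "nat \<Rightarrow> int \<Rightarrow> 'a set"
  where "Mon n k = {pp u p \<otimes> sp v q | u p v q w. awalk u p w \<and> awalk v q w \<and>
    length q \<le> n \<and> int (length p) - int (length q) = k}"

definition Hom :: "int \<Rightarrow> 'a set"
  where "Hom k = lspan (\<Union>n. Mon n k)"

lemma Mon_carrier: "Mon n k \<subseteq> carrier A"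
  by (auto simp: Mon_def)

lemma MonI: "awalk u p w \<Longrightarrow> awalk v q w \<Longrightarrow> length q \<le> n \<Longrightarrow> k = int (length p) - int (length q) \<Longrightarrow>
    pp u p \<otimes> sp v q \<in> Mon n k"
  unfolding Mon_def by blast

lemma Mon_mono:
  assumes "m \<le> n"
  shows "Mon m k \<subseteq> Mon n k"
proof
  fix x assume "x \<in> Mon m k"
  then obtain u p v q w where x: "x = pp u p \<otimes> sp v q" "awalk u p w" "awalk v q w" "length q \<le> m"
    "int (length p) - int (length q) = k"
    unfolding Mon_def by blast
  show "x \<in> Mon n k"
    unfolding x(1) by (rule MonI[OF x(2,3)]) (use x assms in auto)
qed

lemma Mon_Hom: "awalk u p w \<Longrightarrow> awalk v q w \<Longrightarrow> k = int (length p) - int (length q) \<Longrightarrow>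
    pp u p \<otimes> sp v q \<in> Hom k"
  unfolding Hom_def
  by (rule lspan_incl[OF UN_least[OF Mon_carrier]], rule UN_I[OF UNIV_I, of _ _ "length q"], rule MonI) auto

lemma Hom_carrier: "Hom k \<subseteq> carrier A"
  unfolding Hom_def by (rule lspan_subset[OF UN_least[OF Mon_carrier]])

lemma Hom_in_carrier: "x \<in> Hom k \<Longrightarrow> x \<in> carrier A"
  using Hom_carrier by blast

lemma Hom_add: "x \<in> Hom k \<Longrightarrow> y \<in> Hom k \<Longrightarrow> x \<oplus> y \<in> Hom k"
  unfolding Hom_def by (rule lspan_add)

lemma Hom_zero [simp]: "\<zero> \<in> Hom k"
  unfolding Hom_def by simp

lemma Hom_smult: "x \<in> Hom k \<Longrightarrow> c \<odot> x \<in> Hom k"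
  unfolding Hom_def by (rule lspan_smult[OF UN_least[OF Mon_carrier]])

lemma Hom_subgroup: "additive_subgroup (Hom k) A"
  unfolding Hom_def by (rule lspan_subgroup[OF UN_least[OF Mon_carrier]])

lemma Hom_a_inv: "x \<in> Hom k \<Longrightarrow> \<ominus> x \<in> Hom k"
  using Hom_subgroup by (rule additive_subgroup.a_inv_closed)

lemma Hom_diff: "x \<in> Hom k \<Longrightarrow> y \<in> Hom k \<Longrightarrow> x \<ominus> y \<in> Hom k"
  unfolding a_minus_def by (intro Hom_add Hom_a_inv)

lemma Hom_induct [consumes 1, case_names zero mon add]:
  assumes "x \<in> Hom k" "Q \<zero>"
    and "\<And>c u p v q w. awalk u p w \<Longrightarrow> awalk v q w \<Longrightarrow> int (length p) - int (length q) = k \<Longrightarrow> Q (c \<odot> (pp u p \<otimes> sp v q))"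
    and "\<And>x y. x \<in> Hom k \<Longrightarrow> y \<in> Hom k \<Longrightarrow> Q x \<Longrightarrow> Q y \<Longrightarrow> Q (x \<oplus> y)"
  shows "Q x"
  using assms(1)[unfolded Hom_def] UN_least[OF Mon_carrier]
proof (induction rule: lspan_induct)
  case (add x y)
  then show ?case
    using assms(4)[folded Hom_def] Hom_def by auto
next
  case (base c m)
  then show ?case
    using assms(3) by (auto simp: Mon_def)
qed (rule assms(2))

text \<open>An element is a finite combination of monomials, so the lengths of its ghost parts are
  bounded.\<close>

lemma Hom_in_lspan_Mon: "x \<in> Hom k \<Longrightarrow> \<exists>n. x \<in> lspan (Mon n k)"
proof (induction rule: Hom_induct)
  case (mon c u p v q w)
  then show ?case
    using lspan_base[OF Mon_carrier MonI[of u p w v q "length q" k]] by auto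
next
  case (add x y)
  then obtain m n where mn: "x \<in> lspan (Mon m k)" "y \<in> lspan (Mon n k)" by auto
  have "Mon m k \<subseteq> Mon (max m n) k" "Mon n k \<subseteq> Mon (max m n) k"
    by (rule Mon_mono, simp)+
  then have "x \<in> lspan (Mon (max m n) k)" "y \<in> lspan (Mon (max m n) k)"
    using lspan_mono[THEN subsetD] mn by auto
  then have "x \<oplus> y \<in> lspan (Mon (max m n) k)"
    by (rule lspan_add)
  then show ?case ..
qed auto

lemma Hom_l_mult_V:
  assumes "x \<in> Hom k" "u \<in> verts E"
  shows "V u \<otimes> x \<in> Hom k"
  using assms(1)
proof (induction rule: Hom_induct)
  case (mon c u' p v q w)
  then have "V u \<otimes> (c \<odot> (pp u' p \<otimes> sp v q)) = c \<odot> (V u \<otimes> pp u' p \<otimes> sp v q)"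
    using assms by (simp add: smult_mult_r m_assoc)
  also have "V u \<otimes> pp u' p = (if u = u' then pp u' p else \<zero>)"
    using mon assms by (intro V_absorb_l) (auto simp: V_pp awalk_verts_ends)
  finally show ?case
    using mon by (auto intro: Hom_smult Mon_Hom)
next
  case (add x y)
  then show ?case
    using assms by (subst r_distr) (auto intro: Hom_add Hom_in_carrier)
qed (use assms in simp)

lemma Hom_l_mult_P:
  assumes "x \<in> Hom k" "e \<in> arcs E"
  shows "P e \<otimes> x \<in> Hom (1 + k)"
  using assms(1)
proof (induction rule: Hom_induct)
  case (mon c u' p v q w)
  then have "P e \<otimes> (c \<odot> (pp u' p \<otimes> sp v q)) = c \<odot> (P e \<otimes> pp u' p \<otimes> sp v q)"
    using assms by (simp add: smult_mult_r m_assoc)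
  also have "P e \<otimes> pp u' p = (if u' = head E e then pp (tail E e) (e # p) else \<zero>)"
    using mon assms by (intro P_pp) auto
  finally show ?case
    using mon assms Mon_Hom[of "tail E e" "e # p" w v q "1 + k"]
    by (auto intro: Hom_smult simp: awalk_Cons_iff)
next
  case (add x y)
  then show ?case
    using assms by (subst r_distr) (auto intro: Hom_add Hom_in_carrier)
qed (use assms in simp)

text \<open>Unless the product is zero, the ghost edge cancels the first edge of \<open>p\<close>
  or, for empty \<open>p\<close>, is appended to the ghost path \<open>q\<close>. Either way the
  degree drops by one.\<close>

lemma Hom_l_mult_G:
  assumes "x \<in> Hom k" "e \<in> arcs E"
  shows "G e \<otimes> x \<in> Hom (- 1 + k)"
  using assms(1)
proof (induction rule: Hom_induct)
  case (mon c u' p v q w)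
  then have eq: "G e \<otimes> (c \<odot> (pp u' p \<otimes> sp v q)) = c \<odot> (G e \<otimes> pp u' p \<otimes> sp v q)"
    using assms by (simp add: smult_mult_r m_assoc)
  have "G e \<otimes> pp u' p \<otimes> sp v q \<in> Hom (- 1 + k)"
  proof (cases p)
    case Nil
    then have u': "u' = w" "u' \<in> verts E"
      using mon by (auto simp: awalk_Nil_iff)
    show ?thesis
    proof (cases "u' = tail E e")
      case True
      have walk: "awalk v (q @ [e]) (head E e)"
        using mon True assms u' by (auto simp: awalk_append_iff awalk_Cons_iff awalk_Nil_iff)
      have "G e \<otimes> pp u' p \<otimes> sp v q = sp v (q @ [e])"
        using True Nil mon u' assms by (simp add: sp_snoc G_V)
      also have "\<dots> = pp (head E e) [] \<otimes> sp v (q @ [e])"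
        using V_sp[OF walk] by simp
      also have "\<dots> \<in> Hom (- 1 + k)"
        by (rule Mon_Hom[OF _ walk]) (use mon assms Nil in \<open>auto simp: awalk_Nil_iff\<close>)
      finally show ?thesis .
    next
      case False
      then show ?thesis
        using Nil mon u' assms by (simp add: G_V_if)
    qed
  next
    case (Cons f p')
    then have "G e \<otimes> pp u' p = (if e = f then pp (head E f) p' else \<zero>)"
      using mon assms G_pp_Cons by blast
    then show ?thesis
      using Cons mon assms Mon_Hom[of "head E f" p' w v q "- 1 + k"] by (auto simp: awalk_Cons_iff)
  qed
  then show ?case
    unfolding eq by (rule Hom_smult)
next
  case (add x y)
  then show ?case
    using assms by (subst r_distr) (auto intro: Hom_add Hom_in_carrier)
qed (use assms in simp)

lemma Hom_l_mult_pp: "awalk u p w \<Longrightarrow> x \<in> Hom k \<Longrightarrow> pp u p \<otimes> x \<in> Hom (int (length p) + k)"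
proof (induction p arbitrary: u)
  case (Cons e p)
  then have "pp u (e # p) \<otimes> x = P e \<otimes> (pp (head E e) p \<otimes> x)"
    using Hom_in_carrier[of x k] by (subst m_assoc[symmetric]) (auto simp: awalk_Cons_iff)
  then show ?case
    using Cons Hom_l_mult_P[of "pp (head E e) p \<otimes> x" "int (length p) + k" e]
    by (auto simp: awalk_Cons_iff add.assoc)
qed (simp add: Hom_l_mult_V awalk_Nil_iff)

lemma Hom_l_mult_sp: "awalk u p w \<Longrightarrow> x \<in> Hom k \<Longrightarrow> sp u p \<otimes> x \<in> Hom (- int (length p) + k)"
proof (induction p arbitrary: u x k)
  case (Cons e p)
  then have "sp u (e # p) \<otimes> x = sp (head E e) p \<otimes> (G e \<otimes> x)"
    using Hom_in_carrier[of x k] by (subst m_assoc[symmetric]) (auto simp: awalk_Cons_iff)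
  then show ?case
    using Cons.IH[of "head E e" "G e \<otimes> x" "- 1 + k"] Cons.prems Hom_l_mult_G[of x k e]
    by (auto simp: awalk_Cons_iff algebra_simps)
qed (simp add: Hom_l_mult_V awalk_Nil_iff)

text \<open>The product of two monomials need not be computed. Left multiplication by a vertex, an
  edge or a ghost edge shifts the degree by 0, 1 or -1, and a monomial is a product of
  these.\<close>

lemma Hom_mult:
  assumes "x \<in> Hom k" "y \<in> Hom l"
  shows "x \<otimes> y \<in> Hom (k + l)"
  using assms(1)
proof (induction rule: Hom_induct)
  case zero
  then show ?case
    using Hom_in_carrier[OF assms(2)] by simp
next
  case (mon c u p v q w)
  have "c \<odot> (pp u p \<otimes> sp v q) \<otimes> y = c \<odot> (pp u p \<otimes> (sp v q \<otimes> y))"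
    using mon Hom_in_carrier[OF assms(2)] by (subst smult_mult_l) (auto simp: m_assoc)
  then show ?case
    using Hom_l_mult_pp[OF mon(1) Hom_l_mult_sp[OF mon(2) assms(2)]] mon(3)
    by (auto intro: Hom_smult simp: algebra_simps)
next
  case (add x x')
  then show ?case
    using Hom_in_carrier[OF assms(2)] by (subst l_distr) (auto intro: Hom_add Hom_in_carrier)
qed

lemma V_Hom: "v \<in> verts E \<Longrightarrow> V v \<in> Hom 0"
  using Mon_Hom[of v "[]" v v "[]" 0] by (simp add: awalk_Nil_iff V_idem)

lemma P_Hom: "e \<in> arcs E \<Longrightarrow> P e \<in> Hom 1"
  using Hom_l_mult_P[OF V_Hom, of "head E e" e] by (simp add: P_V)

lemma G_Hom: "e \<in> arcs E \<Longrightarrow> G e \<in> Hom (- 1)"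
  using Hom_l_mult_G[OF V_Hom, of "tail E e" e] by (simp add: G_V)

end

section \<open>Reduction of homogeneous elements\<close>

lemma (in abelian_group) add_diff_diff_cancel:
  assumes "x \<in> carrier G" "y \<in> carrier G" "z \<in> carrier G"
  shows "(x \<oplus> y) \<ominus> (x \<ominus> z) = y \<oplus> z"
proof -
  have "(x \<oplus> y) \<ominus> (x \<ominus> z) = (y \<oplus> x) \<oplus> (\<ominus> x \<oplus> z)"
    using assms by (simp add: a_minus_def minus_add a_comm[of x y])
  also have "\<dots> = y \<oplus> z"
    using assms by (simp add: a_assoc r_neg2)
  finally show ?thesis .
qed

text \<open>Without an identity there is no decomposition of 1 to multiply by. In all uses the maps
  \<open>\<pi> i\<close> are multiplications by orthogonal idempotents, of which only finitely many
  see \<open>x\<close> even if \<open>J\<close> is infinite.\<close>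

definition (in ralg) fin_decomp :: "('i \<Rightarrow> 'a \<Rightarrow> 'a) \<Rightarrow> 'i set \<Rightarrow> 'a \<Rightarrow> bool"
  where "fin_decomp \<pi> J x \<longleftrightarrow> (\<exists>F. finite F \<and> F \<subseteq> J \<and> (\<forall>i\<in>J - F. \<pi> i x = \<zero>) \<and> x = finsum A (\<lambda>i. \<pi> i x) F)"

text \<open>It suffices that each spanning element is fixed by one of the maps and killed by the
  others; for a sum the union of the two finite index sets serves.\<close>

lemma (in ralg) fin_decomp_lspan:
  assumes "M \<subseteq> carrier A"
    and closed: "\<And>i x. i \<in> J \<Longrightarrow> x \<in> carrier A \<Longrightarrow> \<pi> i x \<in> carrier A"
    and add: "\<And>i x y. i \<in> J \<Longrightarrow> x \<in> carrier A \<Longrightarrow> y \<in> carrier A \<Longrightarrow> \<pi> i (x \<oplus> y) = \<pi> i x \<oplus> \<pi> i y"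
    and smult: "\<And>i c x. i \<in> J \<Longrightarrow> x \<in> carrier A \<Longrightarrow> \<pi> i (c \<odot> x) = c \<odot> \<pi> i x"
    and M: "\<And>m. m \<in> M \<Longrightarrow> \<exists>i\<in>J. \<pi> i m = m \<and> (\<forall>j\<in>J. j \<noteq> i \<longrightarrow> \<pi> j m = \<zero>)"
    and "x \<in> lspan M"
  shows "fin_decomp \<pi> J x"
  using assms(6,1)
proof (induction x rule: lspan_induct)
  case zero
  have "\<pi> i \<zero> = \<zero>" if "i \<in> J" for i
    using smult[OF that zero_closed, of 0] closed[OF that zero_closed] by simp
  then show ?case
    unfolding fin_decomp_def by (intro exI[of _ "{}"]) auto
next
  case (base c m)
  then obtain i where i: "i \<in> J" "\<pi> i m = m" "\<And>j. j \<in> J \<Longrightarrow> j \<noteq> i \<Longrightarrow> \<pi> j m = \<zero>" and m: "m \<in> carrier A"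
    using M assms(1) by blast
  then show ?case
    unfolding fin_decomp_def by (intro exI[of _ "{i}"]) (auto simp: smult Pi_def)
next
  case (add x y)
  have xy: "x \<in> carrier A" "y \<in> carrier A"
    using add(1,2) lspan_subset[OF assms(1)] by auto
  obtain F where F: "finite F" "F \<subseteq> J" "\<And>i. i \<in> J - F \<Longrightarrow> \<pi> i x = \<zero>" "x = finsum A (\<lambda>i. \<pi> i x) F"
    using add(3) unfolding fin_decomp_def by blast
  obtain G where G: "finite G" "G \<subseteq> J" "\<And>i. i \<in> J - G \<Longrightarrow> \<pi> i y = \<zero>" "y = finsum A (\<lambda>i. \<pi> i y) G"
    using add(4) unfolding fin_decomp_def by blast
  have cl: "(\<lambda>i. \<pi> i x) \<in> F \<union> G \<rightarrow> carrier A" "(\<lambda>i. \<pi> i y) \<in> F \<union> G \<rightarrow> carrier A"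
    using F(2) G(2) xy closed by auto
  have "x = finsum A (\<lambda>i. \<pi> i x) (F \<union> G)"
    using F G cl by (subst finsum_mono_neutral[of "F \<union> G" F]) auto
  moreover have "y = finsum A (\<lambda>i. \<pi> i y) (F \<union> G)"
    using F G cl by (subst finsum_mono_neutral[of "F \<union> G" G]) auto
  ultimately have "x \<oplus> y = finsum A (\<lambda>i. \<pi> i x) (F \<union> G) \<oplus> finsum A (\<lambda>i. \<pi> i y) (F \<union> G)"
    by simp
  also have "\<dots> = finsum A (\<lambda>i. \<pi> i x \<oplus> \<pi> i y) (F \<union> G)"
    using cl by (simp add: finsum_addf)
  also have "\<dots> = finsum A (\<lambda>i. \<pi> i (x \<oplus> y)) (F \<union> G)"
    using F(2) G(2) xy by (intro finsum_cong') (auto simp: assms(3) subset_iff intro!: closed)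
  finally have sum: "x \<oplus> y = finsum A (\<lambda>i. \<pi> i (x \<oplus> y)) (F \<union> G)" .
  show ?case
    unfolding fin_decomp_def
  proof (intro exI[of _ "F \<union> G"] conjI ballI)
    fix i assume "i \<in> J - (F \<union> G)"
    then show "\<pi> i (x \<oplus> y) = \<zero>"
      using F(3)[of i] G(3)[of i] xy assms(3) by auto
  qed (use sum F G in auto)
qed

section \<open>Real and ghost parts of a homogeneous element\<close>

context lfam
begin

text \<open>Multiplied by \<open>V v\<close> on the right, a homogeneous element splits into paths
  without ghost part and monomials that end in a ghost edge. \<open>Real\<close> and
  \<open>Ghost\<close> span these two summands, see \<open>Mon_split\<close>.\<close>

definition Real :: "nat \<Rightarrow> 'v \<Rightarrow> 'a set"
  where "Real k v = {pp u p | u p. awalk u p v \<and> length p = k}"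

definition Ghost :: "'v \<Rightarrow> 'a set"
  where "Ghost v = {pp u p \<otimes> sp v q | u p q w. awalk u p w \<and> awalk v q w \<and> q \<noteq> []}"

definition gap :: "'v \<Rightarrow> 'e set \<Rightarrow> 'a"
  where "gap v F = V v \<ominus> finsum A (\<lambda>e. P e \<otimes> G e) F"

lemma gap_closed: "v \<in> verts E \<Longrightarrow> F \<subseteq> arcs E \<Longrightarrow> gap v F \<in> carrier A"
  unfolding gap_def by (intro minus_closed finsum_closed) auto

lemma Real_carrier: "Real k v \<subseteq> carrier A"
  by (auto simp: Real_def)

lemma Ghost_carrier: "Ghost v \<subseteq> carrier A"
  by (auto simp: Ghost_def)

lemma lspan_fix_r:
  assumes "M \<subseteq> carrier A" "u \<in> carrier A" "\<And>m. m \<in> M \<Longrightarrow> m \<otimes> u = m" "x \<in> lspan M"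
  shows "x \<otimes> u = x"
  using assms(4,1)
proof (induction rule: lspan_induct)
  case (base c m)
  then show ?case
    using assms(1-3) by (auto simp: smult_mult_l)
next
  case (add x y)
  then show ?case
    using assms(2) lspan_subset[OF assms(1)] by (subst l_distr) auto
qed (use assms in simp)

lemma Real_V: "y \<in> lspan (Real k v) \<Longrightarrow> v \<in> verts E \<Longrightarrow> y \<otimes> V v = y"
  by (rule lspan_fix_r[OF Real_carrier]) (auto simp: Real_def pp_V)

text \<open>A monomial in \<open>Ghost v\<close> ends in the ghost edge of the first edge
  \<open>f\<close> of \<open>q\<close>, so \<open>P e \<otimes> G e\<close> on its right fixes it
  for \<open>e = f\<close> and kills it otherwise.\<close>

lemma Ghost_decomp:
  assumes "z \<in> lspan (Ghost v)"
  shows "fin_decomp (\<lambda>e z. z \<otimes> P e \<otimes> G e) (arcs E) z"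
proof (rule fin_decomp_lspan[OF Ghost_carrier _ _ _ _ assms])
  fix m assume "m \<in> Ghost v"
  then obtain u p q w where m: "m = pp u p \<otimes> sp v q" "awalk u p w" "awalk v q w" "q \<noteq> []"
    by (auto simp: Ghost_def)
  then obtain f q' where q: "q = f # q'" by (cases q) auto
  then have f: "f \<in> arcs E" "v = tail E f" "awalk (head E f) q' w"
    using m by (auto simp: awalk_Cons_iff)
  have "m \<otimes> P e \<otimes> G e = (if e = f then m else \<zero>)" if e: "e \<in> arcs E" for e
  proof -
    have "m \<otimes> P e \<otimes> G e = pp u p \<otimes> (sp (head E f) q' \<otimes> (G f \<otimes> P e \<otimes> G e))"
      using m q f e by (simp add: m_assoc)
    also have "\<dots> = (if e = f then m else \<zero>)"
      using m q f e by (simp add: G_P_if V_G)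
    finally show ?thesis .
  qed
  then show "\<exists>i\<in>arcs E. m \<otimes> P i \<otimes> G i = m \<and> (\<forall>j\<in>arcs E. j \<noteq> i \<longrightarrow> m \<otimes> P j \<otimes> G j = \<zero>)"
    using f by (intro bexI[of _ f]) auto
qed (auto simp: l_distr smult_mult_l)

text \<open>The counterpart of \<open>Ghost_decomp\<close> on the left:
  \<open>P e \<otimes> G e\<close> fixes the paths that begin with \<open>e\<close> and kills the
  others. A first edge exists because the length is positive.\<close>

lemma Real_decomp:
  assumes "y \<in> lspan (Real (Suc k) v)"
  shows "fin_decomp (\<lambda>e y. P e \<otimes> (G e \<otimes> y)) (arcs E) y"
proof (rule fin_decomp_lspan[OF Real_carrier _ _ _ _ assms])
  fix m assume "m \<in> Real (Suc k) v"
  then obtain u f p where m: "m = pp u (f # p)" "awalk u (f # p) v"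
    by (auto simp: Real_def length_Suc_conv)
  then have f: "f \<in> arcs E" "u = tail E f" "awalk (head E f) p v"
    by (auto simp: awalk_Cons_iff)
  have "P e \<otimes> (G e \<otimes> m) = (if e = f then m else \<zero>)" if e: "e \<in> arcs E" for e
    using G_pp_Cons[OF e m(2)] m f e by auto
  then show "\<exists>i\<in>arcs E. P i \<otimes> (G i \<otimes> m) = m \<and> (\<forall>j\<in>arcs E. j \<noteq> i \<longrightarrow> P j \<otimes> (G j \<otimes> m) = \<zero>)"
    using f by (intro bexI[of _ f]) auto
qed (auto simp: r_distr smult_mult_r)

lemma Hom_decomp:
  assumes "x \<in> Hom k"
  shows "fin_decomp (\<lambda>v x. x \<otimes> V v) (verts E) x"
proof (rule fin_decomp_lspan[OF UN_least[OF Mon_carrier] _ _ _ _ assms[unfolded Hom_def]])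
  fix m assume "m \<in> (\<Union>n. Mon n k)"
  then obtain u p v q w where m: "m = pp u p \<otimes> sp v q" "awalk u p w" "awalk v q w"
    by (auto simp: Mon_def)
  then have "m \<otimes> V j = (if j = v then m else \<zero>)" if "j \<in> verts E" for j
    using that by (intro V_absorb_r) (auto simp: m_assoc sp_V awalk_verts_ends)
  then show "\<exists>i\<in>verts E. m \<otimes> V i = m \<and> (\<forall>j\<in>verts E. j \<noteq> i \<longrightarrow> m \<otimes> V j = \<zero>)"
    using m awalk_verts_ends by (intro bexI[of _ v]) auto
qed (auto simp: l_distr smult_mult_l)

lemma lspan_map:
  assumes "M \<subseteq> carrier A" "N \<subseteq> carrier A" "x \<in> lspan M"
    and "\<And>x. x \<in> carrier A \<Longrightarrow> f x \<in> carrier A"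
    and "\<And>x y. x \<in> carrier A \<Longrightarrow> y \<in> carrier A \<Longrightarrow> f (x \<oplus> y) = f x \<oplus> f y"
    and "\<And>c x. x \<in> carrier A \<Longrightarrow> f (c \<odot> x) = c \<odot> f x"
    and "\<And>m. m \<in> M \<Longrightarrow> f m \<in> lspan N"
  shows "f x \<in> lspan N"
  using assms(3,1)
proof (induction rule: lspan_induct)
  case zero
  have "f \<zero> = \<zero>"
    using assms(6)[of \<zero> 0] assms(4)[of \<zero>] by simp
  then show ?case by simp
next
  case (base c m)
  then have "f (c \<odot> m) = c \<odot> f m"
    using assms(1,6) by auto
  then show ?case
    using assms(7)[OF base] lspan_smult[OF assms(2)] by simp
next
  case (add x y)
  then have "f (x \<oplus> y) = f x \<oplus> f y"
    using lspan_subset[OF assms(1)] assms(5) by auto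
  then show ?case
    using add lspan_add by simp
qed

lemma pp_Real: "awalk u p v \<Longrightarrow> pp u p \<in> lspan (Real (length p) v)"
  by (rule lspan_incl[OF Real_carrier]) (auto simp: Real_def)

lemma G_Real:
  assumes "y \<in> lspan (Real (Suc k) v)" "e \<in> arcs E"
  shows "G e \<otimes> y \<in> lspan (Real k v)"
proof (rule lspan_map[OF Real_carrier Real_carrier assms(1)])
  fix m assume "m \<in> Real (Suc k) v"
  then obtain u f p where m: "m = pp u (f # p)" "awalk u (f # p) v" "length p = k"
    by (auto simp: Real_def length_Suc_conv)
  then have "awalk (head E f) p v"
    by (auto simp: awalk_Cons_iff)
  then have "pp (head E f) p \<in> lspan (Real k v)"
    using m(3) by (intro lspan_incl[OF Real_carrier]) (auto simp: Real_def)
  then show "G e \<otimes> m \<in> lspan (Real k v)"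
    unfolding m(1) G_pp_Cons[OF assms(2) m(2)] by simp
qed (use assms in \<open>auto simp: r_distr smult_mult_r\<close>)

text \<open>By \<open>Real_decomp\<close>, \<open>y\<close> is the sum of finitely many
  \<open>P e \<otimes> (G e \<otimes> y)\<close>, so some \<open>G e \<otimes> y\<close> is outside
  I as well, and its paths are shorter. At length zero only a multiple of \<open>V v\<close> is
  left, with nonzero coefficient because zero lies in I.\<close>

lemma Real_reduce:
  assumes "rng_ideal I A" "y \<in> lspan (Real k v)" "y \<notin> I" "v \<in> verts E"
  shows "\<exists>a\<in>carrier A. \<exists>c. c \<noteq> 0 \<and> a \<otimes> y = c \<odot> V v"
  using assms(2,3)
proof (induction k arbitrary: y)
  case 0
  interpret I: rng_ideal I A by fact
  have "Real 0 v = {V v}"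
    using assms(4) by (auto simp: Real_def awalk_Nil_iff)
  then have "y \<in> lspan {V v}"
    using 0 by simp
  moreover have "{V v} \<subseteq> carrier A"
    using assms(4) by simp
  ultimately have "\<exists>c. y = c \<odot> V v"
  proof (induction rule: lspan_induct)
    case zero
    show ?case
      using assms(4) by (intro exI[of _ 0]) simp
  next
    case (add x y)
    then obtain c d where "x = c \<odot> V v" "y = d \<odot> V v" by auto
    then show ?case
      using assms(4) by (intro exI[of _ "c + d"]) (simp add: smult_l_distr)
  qed (use assms(4) in auto)
  then obtain c where c: "y = c \<odot> V v" by auto
  then have "c \<noteq> 0"
    using 0(2) assms(4) by auto
  \<comment> \<open>There is no identity to take for \<open>a\<close>; the vertex itself
    serves.\<close>
  moreover have "V v \<otimes> y = c \<odot> V v"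
    using c assms(4) by (simp add: smult_mult_r V_idem)
  ultimately show ?case
    using assms(4) V_closed by blast
next
  case (Suc k)
  interpret I: rng_ideal I A by fact
  obtain F where F: "finite F" "F \<subseteq> arcs E" "y = finsum A (\<lambda>e. P e \<otimes> (G e \<otimes> y)) F"
    using Real_decomp[OF Suc.prems(1)] unfolding fin_decomp_def by blast
  have y: "y \<in> carrier A"
    using Suc.prems lspan_subset[OF Real_carrier] by blast
  have "\<exists>e\<in>F. G e \<otimes> y \<notin> I"
  proof (rule ccontr)
    assume "\<not> (\<exists>e\<in>F. G e \<otimes> y \<notin> I)"
    then have "P e \<otimes> (G e \<otimes> y) \<in> I" if "e \<in> F" for e
      using that F(2) by (auto intro!: I.I_l_closed[of "G e \<otimes> y"])
    then have "finsum A (\<lambda>e. P e \<otimes> (G e \<otimes> y)) F \<in> I"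
      by (rule finsum_in_subgroup[OF I.is_additive_subgroup])
    then show False
      using F(3) Suc.prems by simp
  qed
  then obtain e where e: "e \<in> arcs E" "G e \<otimes> y \<notin> I"
    using F(2) by auto
  from Suc.IH[OF G_Real[OF Suc.prems(1) e(1)] e(2)] obtain a c where
    "a \<in> carrier A" "c \<noteq> 0" "a \<otimes> (G e \<otimes> y) = c \<odot> V v" by blast
  then show ?case
    using e y by (intro bexI[of _ "a \<otimes> G e"] exI[of _ c]) (auto simp: m_assoc)
qed

text \<open>Unless the product is zero, an edge on the right cancels the first edge of a nonempty
  ghost path or extends \<open>p\<close> if the ghost path is empty. In both cases the ghost part
  has length at most \<open>n\<close> afterwards.\<close>

lemma Mon_P:
  assumes "x \<in> lspan (Mon (Suc n) k)" "e \<in> arcs E"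
  shows "x \<otimes> P e \<in> lspan (Mon n (k + 1))"
proof (rule lspan_map[OF Mon_carrier Mon_carrier assms(1)])
  fix m assume "m \<in> Mon (Suc n) k"
  then obtain u p v q w where m: "m = pp u p \<otimes> sp v q" "awalk u p w" "awalk v q w" "length q \<le> Suc n"
    "int (length p) - int (length q) = k"
    unfolding Mon_def by blast
  show "m \<otimes> P e \<in> lspan (Mon n (k + 1))"
  proof (cases q)
    case Nil
    then have w: "v = w" "w \<in> verts E"
      using m by (auto simp: awalk_Nil_iff)
    have eq: "m \<otimes> P e = pp u p \<otimes> (V w \<otimes> P e)"
      using m w Nil assms by (simp add: m_assoc V_P_if)
    show ?thesis
    proof (cases "w = tail E e")
      case True
      have walk: "awalk u (p @ [e]) (head E e)" "awalk (head E e) [] (head E e)"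
        using m True assms by (auto simp: awalk_append_iff awalk_Cons_iff awalk_Nil_iff)
      have "m \<otimes> P e = pp u (p @ [e]) \<otimes> sp (head E e) []"
        unfolding eq using True m assms pp_V[OF walk(1)] by (simp add: V_P pp_snoc)
      also have "\<dots> \<in> lspan (Mon n (k + 1))"
        by (rule lspan_incl[OF Mon_carrier MonI[OF walk]]) (use m Nil in auto)
      finally show ?thesis .
    next
      case False
      then show ?thesis
        unfolding eq using w m assms by (simp add: V_P_if)
    qed
  next
    case (Cons f q')
    then have f: "f \<in> arcs E" "awalk (head E f) q' w"
      using m by (auto simp: awalk_Cons_iff)
    have "m \<otimes> P e = pp u p \<otimes> (sp (head E f) q' \<otimes> (G f \<otimes> P e))"
      using m Cons f assms by (simp add: m_assoc)
    also have "\<dots> = (if f = e then pp u p \<otimes> sp (head E f) q' else \<zero>)"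
      using m f assms sp_V[OF f(2)] by (cases "f = e") (simp_all add: G_P_if)
    also have "\<dots> \<in> lspan (Mon n (k + 1))"
      using m Cons f by (auto intro!: lspan_incl[OF Mon_carrier] MonI)
    finally show ?thesis .
  qed
qed (use assms in \<open>auto simp: l_distr smult_mult_l\<close>)

text \<open>Without ghost edges the degree is the length of a path, so \<open>nat k\<close> loses
  nothing: for negative \<open>k\<close> there are no such monomials.\<close>

lemma Mon_zero_V:
  assumes "x \<in> lspan (Mon 0 k)" "v \<in> verts E"
  shows "x \<otimes> V v \<in> lspan (Real (nat k) v)"
proof (rule lspan_map[OF Mon_carrier Real_carrier assms(1)])
  fix m assume "m \<in> Mon 0 k"
  then obtain u p w where m: "m = pp u p \<otimes> V w" "awalk u p w" "w \<in> verts E" "int (length p) = k"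
    by (auto simp: Mon_def awalk_Nil_iff)
  then have "m \<otimes> V v = (if v = w then pp u p else \<zero>)"
    using assms by (simp add: V_absorb_r pp_V)
  then show "m \<otimes> V v \<in> lspan (Real (nat k) v)"
    using m pp_Real by auto
qed (use assms in \<open>auto simp: l_distr smult_mult_l\<close>)

lemma Mon_split:
  assumes "x \<in> lspan (Mon n k)" "v \<in> verts E"
  shows "\<exists>y z. y \<in> lspan (Real (nat k) v) \<and> z \<in> lspan (Ghost v) \<and> x \<otimes> V v = y \<oplus> z"
  using assms(1) Mon_carrier
proof (induction rule: lspan_induct)
  case zero
  show ?case
    using assms by (intro exI[of _ \<zero>]) auto
next
  case (base c m)
  then obtain u p v' q w where m: "m = pp u p \<otimes> sp v' q" "awalk u p w" "awalk v' q w"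
    "int (length p) - int (length q) = k"
    unfolding Mon_def by blast
  have mv: "m \<otimes> V v = (if v = v' then m else \<zero>)"
    using m assms by (intro V_absorb_r) (auto simp: m_assoc sp_V awalk_verts_ends)
  have cm: "c \<odot> m \<otimes> V v = c \<odot> (m \<otimes> V v)"
    using m assms by (intro smult_mult_l) auto
  show ?case
  proof (cases "v = v' \<and> q \<noteq> []")
    case True
    then have "m \<in> Ghost v"
      using m by (auto simp: Ghost_def)
    then have "c \<odot> m \<in> lspan (Ghost v)"
      by (rule lspan_base[OF Ghost_carrier])
    then show ?thesis
      using cm mv True m by (intro exI[of _ \<zero>] exI[of _ "c \<odot> m"]) auto
  next
    case False
    have "m \<otimes> V v \<in> lspan (Real (nat k) v)"
    proof (cases "v = v'")
      case True
      then have "v = w" "q = []"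
        using False m by (auto simp: awalk_Nil_iff)
      then have "m = pp u p"
        using m True pp_V[OF m(2)] by simp
      then show ?thesis
        using mv m(2,4) \<open>v = w\<close> \<open>q = []\<close> True pp_Real by auto
    qed (simp add: mv)
    then have "c \<odot> m \<otimes> V v \<in> lspan (Real (nat k) v)"
      unfolding cm by (rule lspan_smult[OF Real_carrier])
    then show ?thesis
      using lspan_subset[OF Real_carrier]
      by (intro exI[of _ "c \<odot> m \<otimes> V v"] exI[of _ \<zero>]) (auto simp: subset_iff)
  qed
next
  case (add x x')
  then obtain y z y' z' where yz: "y \<in> lspan (Real (nat k) v)" "z \<in> lspan (Ghost v)" "x \<otimes> V v = y \<oplus> z"
    "y' \<in> lspan (Real (nat k) v)" "z' \<in> lspan (Ghost v)" "x' \<otimes> V v = y' \<oplus> z'"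
    by blast
  then have "y \<in> carrier A" "y' \<in> carrier A" "z \<in> carrier A" "z' \<in> carrier A"
    using lspan_subset[OF Real_carrier] lspan_subset[OF Ghost_carrier] by blast+
  moreover have "(x \<oplus> x') \<otimes> V v = x \<otimes> V v \<oplus> x' \<otimes> V v"
    using add(1,2) lspan_subset[OF Mon_carrier] assms(2) by (intro l_distr) auto
  ultimately have "(x \<oplus> x') \<otimes> V v = (y \<oplus> y') \<oplus> (z \<oplus> z')"
    using yz by (simp add: a_ac)
  then show ?case
    using yz lspan_add by blast
qed

lemma gap_P_Real:
  assumes "y \<in> carrier A" "y \<otimes> V v = y" "v \<in> verts E" "finite F" "F \<subseteq> arcs E"
  shows "y \<otimes> gap v F = y \<ominus> finsum A (\<lambda>e. y \<otimes> P e \<otimes> G e) F"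
proof -
  have "y \<otimes> gap v F = y \<ominus> y \<otimes> finsum A (\<lambda>e. P e \<otimes> G e) F"
    unfolding gap_def using assms by (subst r_diff_distr) (auto intro!: finsum_closed)
  also have "y \<otimes> finsum A (\<lambda>e. P e \<otimes> G e) F = finsum A (\<lambda>e. y \<otimes> (P e \<otimes> G e)) F"
    using assms by (intro finsum_r_distr) auto
  also have "\<dots> = finsum A (\<lambda>e. y \<otimes> P e \<otimes> G e) F"
    using assms by (intro finsum_cong') (auto simp: m_assoc subset_iff)
  finally show ?thesis .
qed

text \<open>Induction on the ghost bound \<open>n\<close>. If some \<open>x \<otimes> P e\<close> is
  outside I, it has smaller ghost parts and the induction hypothesis applies. Otherwise
  \<open>x\<close> kills all edges modulo I. Then either an exit of a vertex \<open>v\<close> yields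
  a multiple of its head, or \<open>x \<otimes> V v\<close> agrees modulo I with \<open>y\<close>
  times the gap at \<open>v\<close>, where \<open>y\<close> is a combination of paths.
  \<open>Real_reduce\<close> strips \<open>y\<close> off, and only a coefficient stays.\<close>

theorem homogeneous_reduction:
  assumes "rng_ideal I A" "rng_ideal J A" "I \<subseteq> J"
    and H: "\<And>v. v \<in> H \<Longrightarrow> V v \<in> I"
    and S: "\<And>v. v \<in> S \<Longrightarrow> gap v {e \<in> out_arcs E v. head E e \<notin> H} \<in> I"
    and x: "x \<in> Hom k" "x \<in> J" "x \<notin> I"
  shows "\<exists>c. c \<noteq> 0 \<and> ((\<exists>v\<in>verts E - H. c \<odot> V v \<in> J) \<or>
    (\<exists>v\<in>breaking E H - S. c \<odot> gap v {e \<in> out_arcs E v. head E e \<notin> H} \<in> J))"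
    (is ?goal)
proof -
  interpret I: rng_ideal I A by fact
  interpret J: rng_ideal J A by fact
  \<comment> \<open>Of the finitely many nonzero components \<open>x \<otimes> V v\<close>, those
    with \<open>v\<close> in H lie in I, so a vertex outside H must contribute.\<close>
  have pick_vertex: "\<exists>v\<in>verts E - H. x \<otimes> V v \<notin> I" if x: "x \<in> Hom k" "x \<notin> I" for x k
  proof (rule ccontr)
    assume neg: "\<not> (\<exists>v\<in>verts E - H. x \<otimes> V v \<notin> I)"
    obtain F where F: "F \<subseteq> verts E" "x = finsum A (\<lambda>v. x \<otimes> V v) F"
      using Hom_decomp[OF x(1)] unfolding fin_decomp_def by blast
    have "x \<otimes> V v \<in> I" if "v \<in> F" for v
      using that neg F(1) H I.I_l_closed Hom_in_carrier[OF x(1)] by (cases "v \<in> H") auto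
    then have "finsum A (\<lambda>v. x \<otimes> V v) F \<in> I"
      by (intro finsum_in_subgroup[OF I.is_additive_subgroup])
    then show False
      using F(2) x(2) by simp
  qed
  obtain n where "x \<in> lspan (Mon n k)"
    using Hom_in_lspan_Mon[OF x(1)] by blast
  then show ?goal
    using x
  proof (induction n arbitrary: x k)
    case 0
    obtain v where v: "v \<in> verts E" "v \<notin> H" "x \<otimes> V v \<notin> I"
      using pick_vertex 0 by blast
    obtain a c where ac: "a \<in> carrier A" "c \<noteq> 0" "a \<otimes> (x \<otimes> V v) = c \<odot> V v"
      using Real_reduce[OF assms(1) Mon_zero_V[OF 0(1) v(1)] v(3,1)] by blast
    have "a \<otimes> (x \<otimes> V v) \<in> J"
      using ac(1) 0 v by (intro J.I_l_closed J.I_r_closed) auto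
    then show ?case
      using ac v by auto
  next
    case (Suc n)
    show ?case
    proof (cases "\<exists>e\<in>arcs E. x \<otimes> P e \<notin> I")
      case True
      then obtain e where e: "e \<in> arcs E" "x \<otimes> P e \<notin> I" by blast
      have m: "x \<otimes> P e \<in> lspan (Mon n (k + 1))"
        using Mon_P[OF Suc.prems(1) e(1)] .
      show ?thesis
        by (rule Suc.IH[OF m])
          (use Suc.prems e Hom_mult[OF Suc.prems(2) P_Hom[OF e(1)]] J.I_r_closed in auto)
    next
      case False
      obtain v where v: "v \<in> verts E" "v \<notin> H" "x \<otimes> V v \<notin> I"
        using pick_vertex Suc.prems by blast
      have cx: "x \<in> carrier A"
        using Hom_in_carrier Suc.prems by blast
      define x' where "x' = x \<otimes> V v"
      have x': "x' \<in> carrier A" "x' \<notin> I" "x' \<in> J" "x' \<otimes> V v = x'"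
        using cx v Suc.prems J.I_r_closed by (auto simp: x'_def m_assoc V_idem)
      have xP: "x' \<otimes> P e \<in> I" if e: "e \<in> arcs E" for e
        using False e cx v by (auto simp: x'_def m_assoc V_P_if)
      obtain y z where yz: "y \<in> lspan (Real (nat k) v)" "z \<in> lspan (Ghost v)" "x' = y \<oplus> z"
        using Mon_split[OF Suc.prems(1) v(1)] unfolding x'_def by blast
      then have c: "y \<in> carrier A" "z \<in> carrier A"
        using subsetD[OF lspan_subset[OF Real_carrier]] subsetD[OF lspan_subset[OF Ghost_carrier]] by auto
      have yV: "y \<otimes> V v = y"
        using Real_V yz v by blast
      obtain F where F: "finite F" "F \<subseteq> arcs E" "\<And>e. e \<in> arcs E - F \<Longrightarrow> z \<otimes> P e \<otimes> G e = \<zero>"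
        "z = finsum A (\<lambda>e. z \<otimes> P e \<otimes> G e) F"
        using Ghost_decomp[OF yz(2)] unfolding fin_decomp_def by blast
      \<comment> \<open>\<open>z\<close> is the sum of its components \<open>z P e G e\<close> over
        F; adding the corresponding terms of \<open>y\<close> turns them into
        \<open>x' P e G e\<close>, which lie in I.\<close>
      have z_mod: "z \<oplus> finsum A (\<lambda>e. y \<otimes> P e \<otimes> G e) F \<in> I"
      proof -
        have "z \<oplus> finsum A (\<lambda>e. y \<otimes> P e \<otimes> G e) F = finsum A (\<lambda>e. z \<otimes> P e \<otimes> G e \<oplus> y \<otimes> P e \<otimes> G e) F"
          using c F(2) by (subst (1) F(4), subst finsum_addf) auto
        also have "\<dots> = finsum A (\<lambda>e. x' \<otimes> P e \<otimes> G e) F"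
          using F(2) c by (intro finsum_cong') (auto simp: yz(3) l_distr a_ac subset_iff)
        also have "\<dots> \<in> I"
          using F(2) by (intro finsum_in_subgroup[OF I.is_additive_subgroup] I.I_r_closed xP) auto
        finally show ?thesis .
      qed
      have sum_F: "finsum A (\<lambda>e. y \<otimes> P e \<otimes> G e) F \<in> carrier A"
        using F(2) c by (intro finsum_closed) auto
      have yI: "y \<notin> I"
      proof
        assume y: "y \<in> I"
        then have "finsum A (\<lambda>e. y \<otimes> P e \<otimes> G e) F \<in> I"
          using F(2) by (intro finsum_in_subgroup[OF I.is_additive_subgroup] I.I_r_closed) auto
        then have "z \<in> I"
          using z_mod c(2) I.ideal_add_iff by blast
        then show False
          using yz(3) y x' by auto
      qed
      obtain a d where ad: "a \<in> carrier A" "d \<noteq> 0" "a \<otimes> y = d \<odot> V v"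
        using Real_reduce[OF assms(1) yz(1) yI v(1)] by blast
      let ?F0 = "{e \<in> out_arcs E v. head E e \<notin> H}"
      show ?thesis
      proof (cases "?F0 \<subseteq> F")
        \<comment> \<open>An exit \<open>f\<close> outside F is invisible to the ghost part:
          \<open>z P f = 0\<close>. Hence \<open>y P f = x' P f\<close> lies in I, and multiplying
          it on the left by \<open>a\<close> and then by \<open>G f\<close> leaves \<open>d\<close>
          times the head of \<open>f\<close>.\<close>
        case False
        then obtain f where f: "f \<in> arcs E" "tail E f = v" "head E f \<notin> H" "f \<notin> F"
          by auto
        have "z \<otimes> P f = z \<otimes> P f \<otimes> G f \<otimes> P f"
          using c f by (simp add: m_assoc G_P P_V)
        also have "\<dots> = \<zero>"
          using F(3)[of f] f by simp
        finally have "x' \<otimes> P f = y \<otimes> P f"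
          using c f by (simp add: yz(3) l_distr)
        then have "y \<otimes> P f \<in> J"
          using xP[OF f(1)] assms(3) by auto
        then have "G f \<otimes> (a \<otimes> (y \<otimes> P f)) \<in> J"
          using f ad by (intro J.I_l_closed[OF J.I_l_closed]) auto
        also have "G f \<otimes> (a \<otimes> (y \<otimes> P f)) = G f \<otimes> ((a \<otimes> y) \<otimes> P f)"
          using ad(1) c f by (simp add: m_assoc)
        also have "\<dots> = d \<odot> V (head E f)"
          unfolding ad(3) using v f by (simp add: smult_mult_l smult_mult_r V_P_if G_P)
        finally show ?thesis
          using ad(2) f by (intro exI[of _ d] conjI disjI1 bexI[of _ "head E f"]) auto
      next
        \<comment> \<open>F may contain more than the exits of \<open>v\<close>. Edges from
          \<open>v\<close> into H contribute elements of I, and edges that do not leave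
          \<open>v\<close> are killed by \<open>y = y V v\<close>, so modulo I the sum over F is the
          sum over the exits.\<close>
        case True
        then have fin: "finite ?F0" "?F0 \<subseteq> arcs E"
          using F by (auto intro: finite_subset)
        have "x' \<ominus> y \<otimes> gap v ?F0 = z \<oplus> finsum A (\<lambda>e. y \<otimes> P e \<otimes> G e) ?F0"
        proof -
          have s: "finsum A (\<lambda>e. y \<otimes> P e \<otimes> G e) ?F0 \<in> carrier A"
            using c by (intro finsum_closed) auto
          show ?thesis
            unfolding gap_P_Real[OF c(1) yV v(1) fin] yz(3)
            using c s by (rule add_diff_diff_cancel)
        qed
        also have "finsum A (\<lambda>e. y \<otimes> P e \<otimes> G e) ?F0 =
            finsum A (\<lambda>e. if e \<in> ?F0 then y \<otimes> P e \<otimes> G e else \<zero>) F"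
        proof (rule sym, subst finsum_mono_neutral[of F ?F0])
          show "finsum A (\<lambda>e. if e \<in> ?F0 then y \<otimes> P e \<otimes> G e else \<zero>) ?F0 = finsum A (\<lambda>e. y \<otimes> P e \<otimes> G e) ?F0"
            using c by (intro finsum_cong') auto
        qed (use True F c in auto)
        also have "z \<oplus> \<dots> = (z \<oplus> finsum A (\<lambda>e. y \<otimes> P e \<otimes> G e) F) \<ominus>
            finsum A (\<lambda>e. if e \<in> ?F0 then \<zero> else y \<otimes> P e \<otimes> G e) F"
        proof -
          have "finsum A (\<lambda>e. y \<otimes> P e \<otimes> G e) F =
              finsum A (\<lambda>e. (if e \<in> ?F0 then y \<otimes> P e \<otimes> G e else \<zero>) \<oplus> (if e \<in> ?F0 then \<zero> else y \<otimes> P e \<otimes> G e)) F"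
            using F c by (intro finsum_cong') auto
          also have "\<dots> = finsum A (\<lambda>e. if e \<in> ?F0 then y \<otimes> P e \<otimes> G e else \<zero>) F \<oplus>
              finsum A (\<lambda>e. if e \<in> ?F0 then \<zero> else y \<otimes> P e \<otimes> G e) F"
            using F c by (intro finsum_addf) auto
          finally have eq: "finsum A (\<lambda>e. y \<otimes> P e \<otimes> G e) F = \<dots>" .
          have "finsum A (\<lambda>e. if e \<in> ?F0 then y \<otimes> P e \<otimes> G e else \<zero>) F \<in> carrier A"
            "finsum A (\<lambda>e. if e \<in> ?F0 then \<zero> else y \<otimes> P e \<otimes> G e) F \<in> carrier A"
            using F c by (auto intro!: finsum_closed)
          then show ?thesis
            unfolding eq using c by (simp add: a_assoc[symmetric] diff_add_cancel)
        qed
        also have "\<dots> \<in> I"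
        proof (rule I.ideal_diff[OF z_mod], rule finsum_in_subgroup[OF I.is_additive_subgroup])
          fix e assume e: "e \<in> F"
          show "(if e \<in> ?F0 then \<zero> else y \<otimes> P e \<otimes> G e) \<in> I"
          proof (cases "tail E e = v \<and> head E e \<in> H")
            case True
            then have "y \<otimes> P e \<otimes> V (head E e) \<otimes> G e \<in> I"
              using e F c H by (intro I.I_r_closed I.I_l_closed) auto
            then show ?thesis
              using e F c by (auto simp: m_assoc P_V V_G)
          next
            case False
            have eA: "e \<in> arcs E"
              using e F by auto
            have "y \<otimes> P e = y \<otimes> (V v \<otimes> P e)"
              using c v eA by (simp add: m_assoc[symmetric] yV)
            then show ?thesis
              using False c v eA by (auto simp: V_P_if)
          qed
        qed
        finally have diff: "x' \<ominus> y \<otimes> gap v ?F0 \<in> I" .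
        have cg: "y \<otimes> gap v ?F0 \<in> carrier A"
          using c gap_closed[OF v(1) fin(2)] by simp
        have eq: "y \<otimes> gap v ?F0 = x' \<ominus> (x' \<ominus> y \<otimes> gap v ?F0)"
          using x'(1) cg by (simp add: a_minus_def minus_add r_neg2)
        have yJ: "y \<otimes> gap v ?F0 \<in> J"
          by (subst eq, rule J.ideal_diff) (use diff assms(3) x' in auto)
        have yI: "y \<otimes> gap v ?F0 \<notin> I"
          using diff x' cg I.a_closed[of "x' \<ominus> y \<otimes> gap v ?F0" "y \<otimes> gap v ?F0"]
          by (auto simp: add_diff_cancel)
        have "a \<otimes> (y \<otimes> gap v ?F0) \<in> J"
          by (rule J.I_l_closed[OF yJ ad(1)])
        also have "a \<otimes> (y \<otimes> gap v ?F0) = d \<odot> (V v \<otimes> gap v ?F0)"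
          using ad(1) c gap_closed[OF v(1) fin(2)] v
          by (simp add: m_assoc[symmetric] ad(3) smult_mult_l)
        also have "V v \<otimes> gap v ?F0 = gap v ?F0"
        proof -
          have "V v \<otimes> finsum A (\<lambda>e. P e \<otimes> G e) ?F0 = finsum A (\<lambda>e. P e \<otimes> G e) ?F0"
            using fin v by (subst finsum_r_distr) (auto simp: m_assoc[symmetric] V_P intro!: finsum_cong')
          then show ?thesis
            unfolding gap_def using v by (subst r_diff_distr) (auto simp: V_idem intro!: finsum_closed)
        qed
        finally have dJ: "d \<odot> gap v ?F0 \<in> J" .
        show ?thesis
        proof (cases "?F0 = {}")
          \<comment> \<open>Without exits the gap is the vertex \<open>v\<close> itself, which is
            outside H.\<close>
          case True
          have "gap v {} = V v"
            using v by (simp add: gap_def)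
          then have "d \<odot> V v \<in> J"
            using dJ unfolding True by simp
          then show ?thesis
            using ad v by (intro exI[of _ d] conjI disjI1 bexI[of _ v]) auto
        next
          case nonempty: False
          \<comment> \<open>At a vertex with finitely many edges the sum relation would write
            \<open>x'\<close> as the sum of the \<open>x' P e G e\<close>, all of which lie in
            I.\<close>
          have "infinite (out_arcs E v)"
          proof
            assume finv: "finite (out_arcs E v)"
            have "out_arcs E v \<noteq> {}"
              using nonempty by blast
            then have "x' = x' \<otimes> finsum A (\<lambda>e. P e \<otimes> G e) (out_arcs E v)"
              using V_sum[OF v(1) finv] x'(4) by simp
            also have "\<dots> = finsum A (\<lambda>e. x' \<otimes> P e \<otimes> G e) (out_arcs E v)"
              using finv x' by (subst finsum_r_distr) (auto simp: m_assoc intro!: finsum_cong')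
            also have "\<dots> \<in> I"
              by (intro finsum_in_subgroup[OF I.is_additive_subgroup] I.I_r_closed xP) auto
            finally show False
              using x'(2) by simp
          qed
          then have "v \<in> breaking E H"
            using fin v nonempty by (auto simp: breaking_def)
          \<comment> \<open>For \<open>v\<close> in S the gap lies in I, and then so does
            \<open>y\<close> times the gap, which agrees with \<open>x'\<close> modulo I.\<close>
          moreover have "v \<notin> S"
            using S[of v] yI c I.I_l_closed by auto
          ultimately show ?thesis
            using dJ ad by blast
        qed
      qed
    qed
  qed
qed

end

section \<open>Homomorphisms and gradings\<close>

locale alg_morphism = dom: ralg A + cod: ralg B
  for A :: "('r::comm_ring_1, 'a) module" and B :: "('r, 'b) module" +
  fixes h
  assumes hom: "h \<in> alg_hom A B"
begin

lemma h_closed [simp]: "x \<in> carrier A \<Longrightarrow> h x \<in> carrier B"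
  using hom by (auto simp: alg_hom_def)

lemma h_add: "x \<in> carrier A \<Longrightarrow> y \<in> carrier A \<Longrightarrow> h (x \<oplus>\<^bsub>A\<^esub> y) = h x \<oplus>\<^bsub>B\<^esub> h y"
  using hom by (simp add: alg_hom_def)

lemma h_mult: "x \<in> carrier A \<Longrightarrow> y \<in> carrier A \<Longrightarrow> h (x \<otimes>\<^bsub>A\<^esub> y) = h x \<otimes>\<^bsub>B\<^esub> h y"
  using hom by (simp add: alg_hom_def)

lemma h_smult: "x \<in> carrier A \<Longrightarrow> h (c \<odot>\<^bsub>A\<^esub> x) = c \<odot>\<^bsub>B\<^esub> h x"
  using hom by (simp add: alg_hom_def)

lemma h_zero [simp]: "h \<zero>\<^bsub>A\<^esub> = \<zero>\<^bsub>B\<^esub>"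
  using h_smult[of "\<zero>\<^bsub>A\<^esub>" 0] by simp

lemma h_a_inv: "x \<in> carrier A \<Longrightarrow> h (\<ominus>\<^bsub>A\<^esub> x) = \<ominus>\<^bsub>B\<^esub> h x"
  by (simp add: dom.a_inv_smult cod.a_inv_smult h_smult)

lemma h_diff: "x \<in> carrier A \<Longrightarrow> y \<in> carrier A \<Longrightarrow> h (x \<ominus>\<^bsub>A\<^esub> y) = h x \<ominus>\<^bsub>B\<^esub> h y"
  by (simp add: a_minus_def h_add h_a_inv)

lemma h_finsum: "f \<in> F \<rightarrow> carrier A \<Longrightarrow> h (finsum A f F) = finsum B (\<lambda>i. h (f i)) F"
proof (induction F rule: infinite_finite_induct)
  case (insert i F)
  then have "(\<lambda>i. h (f i)) \<in> F \<rightarrow> carrier B" "h (f i) \<in> carrier B"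
    by (auto simp: Pi_def)
  with insert show ?case
    by (simp add: h_add)
qed auto

definition ker :: "'a set"
  where "ker = {x \<in> carrier A. h x = \<zero>\<^bsub>B\<^esub>}"

lemma ker_ideal: "rng_ideal ker A"
  by (rule dom.rng_idealI) (auto simp: ker_def h_add h_mult h_a_inv)

lemma inj_on_iff_ker: "inj_on h (carrier A) \<longleftrightarrow> ker \<subseteq> {\<zero>\<^bsub>A\<^esub>}"
proof
  assume inj: "inj_on h (carrier A)"
  show "ker \<subseteq> {\<zero>\<^bsub>A\<^esub>}"
  proof
    fix x assume "x \<in> ker"
    then show "x \<in> {\<zero>\<^bsub>A\<^esub>}"
      using inj_onD[OF inj, of x "\<zero>\<^bsub>A\<^esub>"] by (simp add: ker_def)
  qed
next
  assume ker: "ker \<subseteq> {\<zero>\<^bsub>A\<^esub>}"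
  show "inj_on h (carrier A)"
  proof (rule inj_onI)
    fix x y assume xy: "x \<in> carrier A" "y \<in> carrier A" "h x = h y"
    then have "x \<ominus>\<^bsub>A\<^esub> y \<in> ker"
      by (simp add: ker_def h_diff cod.minus_eq_zero_iff)
    then show "x = y"
      using ker xy dom.minus_eq_zero_iff by auto
  qed
qed

end

lemmas alg_morphismI = alg_morphism.intro[OF _ _ alg_morphism_axioms.intro]

text \<open>\<open>D\<close> only has to be closed under the operations in the way degrees are. It
  may be the grading of another Leavitt path algebra or the operators of a given degree.\<close>

lemma (in lfam) hom_graded:
  assumes "alg_morphism A B h"
    and D: "\<And>k. \<zero>\<^bsub>B\<^esub> \<in> D k" "\<And>k x y. x \<in> D k \<Longrightarrow> y \<in> D k \<Longrightarrow> x \<oplus>\<^bsub>B\<^esub> y \<in> D k"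
      "\<And>k c x. x \<in> D k \<Longrightarrow> c \<odot>\<^bsub>B\<^esub> x \<in> D k"
      "\<And>k l x y. x \<in> D k \<Longrightarrow> y \<in> D l \<Longrightarrow> x \<otimes>\<^bsub>B\<^esub> y \<in> D (k + l)"
    and "\<And>v. v \<in> verts E \<Longrightarrow> h (V v) \<in> D 0"
    and "\<And>e. e \<in> arcs E \<Longrightarrow> h (P e) \<in> D 1" "\<And>e. e \<in> arcs E \<Longrightarrow> h (G e) \<in> D (- 1)"
    and "x \<in> Hom k"
  shows "h x \<in> D (k :: int)"
proof -
  interpret h: alg_morphism A B h by fact
  have pp: "h (pp u p) \<in> D (int (length p))" if "awalk u p w" for u p w
    using that
  proof (induction p arbitrary: u)
    case (Cons e p)
    then show ?case
      using D(4)[OF assms(7)[of e] Cons.IH[of "head E e"]] by (auto simp: awalk_Cons_iff h.h_mult)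
  qed (simp add: awalk_Nil_iff assms(6))
  have sp: "h (sp u p) \<in> D (- int (length p))" if "awalk u p w" for u p w
    using that
  proof (induction p arbitrary: u)
    case (Cons e p)
    then show ?case
      using D(4)[OF Cons.IH[of "head E e"] assms(8)[of e]] by (auto simp: awalk_Cons_iff h.h_mult algebra_simps)
  qed (simp add: awalk_Nil_iff assms(6))
  show ?thesis
    using assms(9)
  proof (induction rule: Hom_induct)
    case (mon c u p v q w)
    have "h (c \<odot> (pp u p \<otimes> sp v q)) = c \<odot>\<^bsub>B\<^esub> (h (pp u p) \<otimes>\<^bsub>B\<^esub> h (sp v q))"
      using mon by (simp add: h.h_smult h.h_mult)
    also have "\<dots> \<in> D (int (length p) + (- int (length q)))"
      using mon by (intro D(3,4) pp sp)
    finally show ?case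
      using mon(3) by simp
  next
    case (add x y)
    then show ?case
      using Hom_in_carrier[of _ k] D(2) by (simp add: h.h_add)
  qed (simp add: D(1))
qed

section \<open>A representation by operators on functions\<close>

text \<open>These are all linear endomorphisms of the R-module of functions on \<open>'x\<close>,
  with no condition on supports. Values in R make a scalar \<open>c\<close> visible on the constant
  function 1.\<close>

definition op_alg :: "('r::comm_ring_1, ('x \<Rightarrow> 'r) \<Rightarrow> 'x \<Rightarrow> 'r) module"
  where "op_alg = \<lparr>carrier = {T. (\<forall>g g'. T (\<lambda>x. g x + g' x) = (\<lambda>x. T g x + T g' x)) \<and>
      (\<forall>c g. T (\<lambda>x. c * g x) = (\<lambda>x. c * T g x))},
    mult = (\<circ>), one = id, zero = (\<lambda>g x. 0), add = (\<lambda>T T' g x. T g x + T' g x),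
    smult = (\<lambda>c T g x. c * T g x)\<rparr>"

lemma op_alg_ralg: "ralg op_alg"
proof -
  have "abelian_group op_alg"
  proof (rule abelian_groupI)
    fix T :: "('x \<Rightarrow> 'r::comm_ring_1) \<Rightarrow> 'x \<Rightarrow> 'r"
    assume "T \<in> carrier op_alg"
    then show "\<exists>T'\<in>carrier op_alg. T' \<oplus>\<^bsub>op_alg\<^esub> T = \<zero>\<^bsub>op_alg\<^esub>"
      by (intro bexI[of _ "\<lambda>g x. - T g x"]) (auto simp: op_alg_def fun_eq_iff)
  qed (auto simp: op_alg_def fun_eq_iff algebra_simps)
  moreover have "T \<otimes>\<^bsub>op_alg\<^esub> T' \<in> carrier op_alg"
    if "T \<in> carrier op_alg" "T' \<in> carrier op_alg" for T T' :: "('x \<Rightarrow> 'r::comm_ring_1) \<Rightarrow> 'x \<Rightarrow> 'r"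
    using that by (simp add: op_alg_def)
  moreover have "c \<odot>\<^bsub>op_alg\<^esub> T \<in> carrier op_alg" if "T \<in> carrier op_alg"
    for c and T :: "('x \<Rightarrow> 'r::comm_ring_1) \<Rightarrow> 'x \<Rightarrow> 'r"
    using that by (auto simp: op_alg_def algebra_simps)
  ultimately show ?thesis
    by (intro ralg.intro rng.intro rng_axioms.intro ralg_axioms.intro)
      (simp_all, simp_all add: op_alg_def fun_eq_iff algebra_simps)
qed

lemma op_alg_finsum:
  assumes "f \<in> F \<rightarrow> carrier op_alg"
  shows "finsum op_alg f F g x = (\<Sum>i\<in>F. f i g x)"
proof -
  interpret ralg op_alg by (rule op_alg_ralg)
  show ?thesis
    using assms
  proof (induction F rule: infinite_finite_induct)
    case (insert i F)
    then have "finsum op_alg f (insert i F) = f i \<oplus>\<^bsub>op_alg\<^esub> finsum op_alg f F"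
      by (subst finsum_insert) auto
    then show ?case
      using insert by (simp add: op_alg_def)
  qed (simp_all, simp_all add: op_alg_def)
qed

text \<open>
  The last component of an index records a degree: an operator of degree \<open>k\<close> intertwines the
  projections onto the functions supported in a single degree.
\<close>

definition deg_proj :: "int \<Rightarrow> ('v \<times> nat \<times> int \<Rightarrow> 'r::zero) \<Rightarrow> 'v \<times> nat \<times> int \<Rightarrow> 'r"
  where "deg_proj i g = (\<lambda>(w, n, j). if j = i then g (w, n, j) else 0)"

definition deg_ops :: "int \<Rightarrow> (('v \<times> nat \<times> int \<Rightarrow> 'r::comm_ring_1) \<Rightarrow> 'v \<times> nat \<times> int \<Rightarrow> 'r) set"
  where "deg_ops k = {T \<in> carrier op_alg. \<forall>i g. deg_proj i (T g) = T (deg_proj (i - k) g)}"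

lemma deg_proj_linear:
  "deg_proj i (\<lambda>x. g x + g' x) = (\<lambda>x. deg_proj i g x + deg_proj i g' x :: 'r::comm_ring_1)"
  "deg_proj i (\<lambda>x. c * g x) = (\<lambda>x. c * deg_proj i g x)"
  by (auto simp: deg_proj_def fun_eq_iff)

lemma deg_ops_closed:
  "\<zero>\<^bsub>op_alg\<^esub> \<in> deg_ops k" "T \<in> deg_ops k \<Longrightarrow> T' \<in> deg_ops k \<Longrightarrow> T \<oplus>\<^bsub>op_alg\<^esub> T' \<in> deg_ops k"
  "T \<in> deg_ops k \<Longrightarrow> c \<odot>\<^bsub>op_alg\<^esub> T \<in> deg_ops k"
  "T \<in> deg_ops k \<Longrightarrow> T'' \<in> deg_ops l \<Longrightarrow> T \<otimes>\<^bsub>op_alg\<^esub> T'' \<in> deg_ops (k + l)"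
proof -
  interpret ralg op_alg by (rule op_alg_ralg)
  show "\<zero>\<^bsub>op_alg\<^esub> \<in> deg_ops k"
    unfolding deg_ops_def using zero_closed by (auto simp: op_alg_def deg_proj_def fun_eq_iff)
  show "T \<oplus>\<^bsub>op_alg\<^esub> T' \<in> deg_ops k" if "T \<in> deg_ops k" "T' \<in> deg_ops k"
    using that a_closed[of T T'] unfolding deg_ops_def
    by (simp add: op_alg_def deg_proj_linear)
  show "c \<odot>\<^bsub>op_alg\<^esub> T \<in> deg_ops k" if "T \<in> deg_ops k"
    using that smult_closed[of T c] unfolding deg_ops_def
    by (simp add: op_alg_def deg_proj_linear)
  show "T \<otimes>\<^bsub>op_alg\<^esub> T'' \<in> deg_ops (k + l)" if "T \<in> deg_ops k" "T'' \<in> deg_ops l"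
    using that m_closed[of T T''] unfolding deg_ops_def by (auto simp: op_alg_def algebra_simps)
qed

text \<open>On a function living in degree \<open>i - l\<close> the operator \<open>T k\<close>
  takes values in degree \<open>i - l + k\<close>. Reading off the sum in degree \<open>i\<close>
  therefore isolates \<open>T l\<close>.\<close>

lemma deg_ops_independent:
  fixes T :: "int \<Rightarrow> ('v \<times> nat \<times> int \<Rightarrow> 'r::comm_ring_1) \<Rightarrow> 'v \<times> nat \<times> int \<Rightarrow> 'r"
  assumes "finite K" "\<And>k. k \<in> K \<Longrightarrow> T k \<in> deg_ops k" "finsum op_alg T K = \<zero>\<^bsub>op_alg\<^esub>" "l \<in> K"
  shows "T l = \<zero>\<^bsub>op_alg\<^esub>"
proof -
  have zero: "T k (\<lambda>x. 0) = (\<lambda>x. 0)" if "k \<in> K" for k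
  proof -
    have "\<forall>c g. T k (\<lambda>x. c * g x) = (\<lambda>x. c * T k g x)"
      using assms(2)[OF that] by (simp add: deg_ops_def op_alg_def)
    from this[rule_format, of 0] show ?thesis by simp
  qed
  have "T l g (w, n, i) = 0" for g w n i
  proof -
    have *: "T k (deg_proj (i - l) g) (w, n, i) = (if k = l then T l g (w, n, i) else 0)" if k: "k \<in> K" for k
    proof -
      have "T k (deg_proj (i - l) g) (w, n, i) = deg_proj i (T k (deg_proj (i - l) g)) (w, n, i)"
        by (simp add: deg_proj_def)
      also have "\<dots> = T k (deg_proj (i - k) (deg_proj (i - l) g)) (w, n, i)"
        using assms(2)[OF k] by (simp add: deg_ops_def)
      also have "deg_proj (i - k) (deg_proj (i - l) g) = (if k = l then deg_proj (i - k) g else (\<lambda>x. 0))"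
        by (auto simp: deg_proj_def)
      also have "T k (if k = l then deg_proj (i - k) g else (\<lambda>x. 0)) (w, n, i) =
          (if k = l then deg_proj i (T k g) (w, n, i) else 0)"
        using assms(2)[OF k] zero[OF k] by (cases "k = l") (simp_all add: deg_ops_def)
      finally show ?thesis
        by (auto simp: deg_proj_def)
    qed
    have "0 = finsum op_alg T K (deg_proj (i - l) g) (w, n, i)"
      using assms(3) by (simp add: op_alg_def)
    also have "\<dots> = (\<Sum>k\<in>K. T k (deg_proj (i - l) g) (w, n, i))"
      by (rule op_alg_finsum) (use assms(2) in \<open>auto simp: deg_ops_def\<close>)
    also have "\<dots> = T l g (w, n, i)"
      using assms(1,4) by (simp add: *)
    finally show ?thesis by simp
  qed
  then show ?thesis
    by (simp add: op_alg_def fun_eq_iff)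
qed

text \<open>
  The ranges of the \<open>\<phi> e\<close> partition \<open>\<nat>\<close> as \<open>e\<close> runs over the edges leaving a vertex, so the functions
  on \<open>\<nat>\<close> at the heads of these edges embed disjointly into those at the tail.
\<close>

lemma (in wf_digraph) branching_maps:
  assumes "countable (arcs G)"
  shows "\<exists>\<phi> :: 'b \<Rightarrow> nat \<Rightarrow> nat. (\<forall>e\<in>arcs G. inj (\<phi> e)) \<and>
    (\<forall>e\<in>arcs G. \<forall>f\<in>arcs G. \<forall>m n. tail G e = tail G f \<longrightarrow> \<phi> e m = \<phi> f n \<longrightarrow> e = f) \<and>
    (\<forall>v m. out_arcs G v \<noteq> {} \<longrightarrow> (\<exists>e\<in>out_arcs G v. m \<in> range (\<phi> e)))"
proof -
  \<comment> \<open>One copy of \<nat> for each edge leaving \<open>v\<close> gives a countably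
    infinite set, which is matched with \<nat>. The map \<open>\<phi> e\<close> will be this
    bijection on the copy that belongs to \<open>e\<close>.\<close>
  have "\<exists>f :: nat \<times> 'b \<Rightarrow> nat. out_arcs G v \<noteq> {} \<longrightarrow> bij_betw f (UNIV \<times> out_arcs G v) UNIV" for v
  proof (cases "out_arcs G v = {}")
    case False
    have "out_arcs G v \<subseteq> arcs G"
      by auto
    then have "countable ((UNIV :: nat set) \<times> out_arcs G v)"
      using assms by (intro countable_SIGMA) (auto intro: countable_subset)
    moreover have "infinite ((UNIV :: nat set) \<times> out_arcs G v)"
      using False by (simp add: finite_cartesian_product_iff)
    ultimately obtain f :: "nat \<times> 'b \<Rightarrow> nat" where "bij_betw f (UNIV \<times> out_arcs G v) UNIV"
      by (rule countableE_infinite)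
    then show ?thesis by blast
  qed simp
  then obtain F :: "'a \<Rightarrow> nat \<times> 'b \<Rightarrow> nat" where
    F: "\<And>v. out_arcs G v \<noteq> {} \<Longrightarrow> bij_betw (F v) (UNIV \<times> out_arcs G v) UNIV"
    by metis
  have inj: "m = n \<and> e = f"
    if "e \<in> arcs G" "f \<in> arcs G" "tail G e = tail G f" "F (tail G e) (m, e) = F (tail G f) (n, f)" for e f m n
  proof -
    have "bij_betw (F (tail G e)) (UNIV \<times> out_arcs G (tail G e)) UNIV"
      using that(1) by (intro F) auto
    from inj_onD[OF bij_betw_imp_inj_on[OF this], of "(m, e)" "(n, f)"] show ?thesis
      using that by auto
  qed
  show ?thesis
  proof (intro exI[of _ "\<lambda>e n. F (tail G e) (n, e)"] conjI ballI allI impI)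
    fix v m assume ne: "out_arcs G v \<noteq> {}"
    have "m \<in> F v ` (UNIV \<times> out_arcs G v)"
      using bij_betw_imp_surj_on[OF F[OF ne]] by simp
    then show "\<exists>e\<in>out_arcs G v. m \<in> range (\<lambda>n. F (tail G e) (n, e))"
      by auto
  next
    show "inj (\<lambda>n. F (tail G e) (n, e))" if "e \<in> arcs G" for e
      by (rule injI, drule inj[OF that that refl], simp)
    show "e = f" if "e \<in> arcs G" "f \<in> arcs G" "tail G e = tail G f"
      "F (tail G e) (m, e) = F (tail G f) (n, f)" for e f m n
      using inj[OF that] ..
  qed
qed

section \<open>Local units and homogeneous components of the Leavitt path algebra\<close>

context lpa
begin

sublocale F: lfam L E "lvtx R E" "ledg R E" "lgst R E"
  by (rule leavitt_lfam)

abbreviation U :: "'v set \<Rightarrow> ('r, 'v, 'e) lpa"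
  where "U W \<equiv> finsum L (lvtx R E) W"

lemma awalk_gens: "awalk u p w \<Longrightarrow> Edg ` set p \<subseteq> gens" "awalk u p w \<Longrightarrow> Gst ` set p \<subseteq> gens"
  by (auto simp: awalk_def)

lemma lpath_eq: "awalk u p w \<Longrightarrow> lpath R E u p = F.pp u p"
proof (induction p arbitrary: u)
  case (Cons e p)
  then have e: "e \<in> arcs E" "awalk (head E e) p w"
    by (auto simp: awalk_Cons_iff)
  show ?case
  proof (cases "p = []")
    case True
    then show ?thesis
      using e by (simp add: lpath_def F.P_V)
  next
    case False
    then have "lword R E (Edg e # map Edg p) = ledg R E e \<otimes>\<^bsub>L\<^esub> lword R E (map Edg p)"
      using e awalk_gens[OF e(2)] by (intro lword_Cons) auto
    then show ?thesis
      using Cons.IH[OF e(2)] False by (simp add: lpath_def)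
  qed
qed (simp add: lpath_def)

lemma lpath_star_eq: "awalk u p w \<Longrightarrow> lpath_star R E u p = F.sp u p"
proof (induction p arbitrary: u)
  case (Cons e p)
  then have e: "e \<in> arcs E" "awalk (head E e) p w"
    by (auto simp: awalk_Cons_iff)
  show ?case
  proof (cases "p = []")
    case True
    then show ?thesis
      using e by (simp add: lpath_star_def F.V_G)
  next
    case False
    then have "lword R E (map Gst (rev p) @ [Gst e]) = lword R E (map Gst (rev p)) \<otimes>\<^bsub>L\<^esub> lgst R E e"
      using e awalk_gens[OF e(2)] by (intro lword_append) auto
    then show ?thesis
      using Cons.IH[OF e(2)] False by (simp add: lpath_star_def)
  qed
qed (simp add: lpath_star_def)

lemma homogeneous_eq: "homogeneous R E k = F.Hom k"
proof -
  have "{c \<odot>\<^bsub>L\<^esub> (lpath R E u p \<otimes>\<^bsub>L\<^esub> lpath_star R E v q) | c u p v q w.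
        awalk u p w \<and> awalk v q w \<and> int (length p) - int (length q) = k} =
      {c \<odot>\<^bsub>L\<^esub> m | c m. m \<in> (\<Union>n. F.Mon n k)}" (is "?X = ?Y")
  proof (intro equalityI subsetI)
    fix x assume "x \<in> ?X"
    then obtain c u p v q w where x: "x = c \<odot>\<^bsub>L\<^esub> (lpath R E u p \<otimes>\<^bsub>L\<^esub> lpath_star R E v q)"
      and walks: "awalk u p w" "awalk v q w" "int (length p) - int (length q) = k"
      by blast
    have "x = c \<odot>\<^bsub>L\<^esub> (F.pp u p \<otimes>\<^bsub>L\<^esub> F.sp v q)" "F.pp u p \<otimes>\<^bsub>L\<^esub> F.sp v q \<in> F.Mon (length q) k"
      using walks x by (auto simp: lpath_eq lpath_star_eq intro: F.MonI)
    then show "x \<in> ?Y"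
      by blast
  next
    fix x assume "x \<in> ?Y"
    then obtain c u p v q w where x: "x = c \<odot>\<^bsub>L\<^esub> (F.pp u p \<otimes>\<^bsub>L\<^esub> F.sp v q)"
      and walks: "awalk u p w" "awalk v q w" "int (length p) - int (length q) = k"
      unfolding F.Mon_def by blast
    then have "x = c \<odot>\<^bsub>L\<^esub> (lpath R E u p \<otimes>\<^bsub>L\<^esub> lpath_star R E v q)"
      by (simp add: lpath_eq lpath_star_eq)
    then show "x \<in> ?X"
      using walks by blast
  qed
  then show ?thesis
    unfolding homogeneous_def F.Hom_def L.lspan_def by simp
qed

text \<open>The claim is made for all finite \<open>W'\<close> above \<open>W\<close>, so that the
  units of two elements can be merged into one for their sum and their product.\<close>

lemma vertex_units_exist:
  assumes "x \<in> carrier L"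
  shows "\<exists>W. finite W \<and> W \<subseteq> verts E \<and>
    (\<forall>W'. finite W' \<and> W \<subseteq> W' \<and> W' \<subseteq> verts E \<longrightarrow> U W' \<otimes>\<^bsub>L\<^esub> x = x \<and> x \<otimes>\<^bsub>L\<^esub> U W' = x)"
    (is "\<exists>W. ?unit W x")
proof -
  have vertex_l: "U W' \<otimes>\<^bsub>L\<^esub> x = x"
    if x: "x \<in> carrier L" "lvtx R E v \<otimes>\<^bsub>L\<^esub> x = x" and W': "finite W'" "v \<in> W'" "W' \<subseteq> verts E" for x v W'
  proof -
    have "U W' \<otimes>\<^bsub>L\<^esub> x = finsum L (\<lambda>w. lvtx R E w \<otimes>\<^bsub>L\<^esub> x) W'"
      using x W' by (intro L.finsum_l_distr) auto
    also have "\<dots> = lvtx R E v \<otimes>\<^bsub>L\<^esub> x"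
      using x W' by (intro L.finsum_singleton_support) (auto simp: F.V_absorb_l subset_iff)
    finally show ?thesis
      using x by simp
  qed
  have vertex_r: "x \<otimes>\<^bsub>L\<^esub> U W' = x"
    if x: "x \<in> carrier L" "x \<otimes>\<^bsub>L\<^esub> lvtx R E v = x" and W': "finite W'" "v \<in> W'" "W' \<subseteq> verts E" for x v W'
  proof -
    have "x \<otimes>\<^bsub>L\<^esub> U W' = finsum L (\<lambda>w. x \<otimes>\<^bsub>L\<^esub> lvtx R E w) W'"
      using x W' by (intro L.finsum_r_distr) auto
    also have "\<dots> = x \<otimes>\<^bsub>L\<^esub> lvtx R E v"
      using x W' by (intro L.finsum_singleton_support) (auto simp: F.V_absorb_r subset_iff)
    finally show ?thesis
      using x by simp
  qed
  have UC: "U W \<in> carrier L" if "W \<subseteq> verts E" for W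
    using that by (intro L.finsum_closed) auto
  let ?C = "{x \<in> carrier L. \<exists>W. ?unit W x}"
  have "carrier L \<subseteq> ?C"
  proof (rule leavitt_generated)
    fix v assume v: "v \<in> verts E"
    have "?unit {v} (lvtx R E v)"
      using v by (intro conjI allI impI vertex_l[OF _ F.V_idem] vertex_r[OF _ F.V_idem]) simp_all
    then show "lvtx R E v \<in> ?C"
      using v by (intro CollectI conjI exI[of _ "{v}"]) simp_all
  next
    fix e assume e: "e \<in> arcs E"
    have "?unit {tail E e, head E e} (ledg R E e)"
      using e by (intro conjI allI impI vertex_l[OF _ F.V_P] vertex_r[OF _ F.P_V]) simp_all
    then show "ledg R E e \<in> ?C"
      using e by (intro CollectI conjI exI[of _ "{tail E e, head E e}"]) simp_all
    have "?unit {tail E e, head E e} (lgst R E e)"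
      using e by (intro conjI allI impI vertex_l[OF _ F.V_G] vertex_r[OF _ F.G_V]) simp_all
    then show "lgst R E e \<in> ?C"
      using e by (intro CollectI conjI exI[of _ "{tail E e, head E e}"]) simp_all
  next
    show "\<zero>\<^bsub>L\<^esub> \<in> ?C"
      using UC by (intro CollectI conjI exI[of _ "{}"]) simp_all
  next
    fix c x assume "x \<in> ?C"
    then obtain W where x: "x \<in> carrier L" and W: "?unit W x" by blast
    have "?unit W (c \<odot>\<^bsub>L\<^esub> x)"
      using W x UC by (simp add: L.smult_mult_l L.smult_mult_r)
    then show "c \<odot>\<^bsub>L\<^esub> x \<in> ?C"
      using x by (intro CollectI conjI exI[of _ W]) simp_all
  next
    fix x y assume xy: "x \<in> ?C" "y \<in> ?C"
    then have c: "x \<in> carrier L" "y \<in> carrier L" by simp_all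
    obtain W where W: "?unit W x" using xy(1) by blast
    obtain W' where W': "?unit W' y" using xy(2) by blast
    have u: "U Z \<otimes>\<^bsub>L\<^esub> x = x" "x \<otimes>\<^bsub>L\<^esub> U Z = x" "U Z \<otimes>\<^bsub>L\<^esub> y = y" "y \<otimes>\<^bsub>L\<^esub> U Z = y" "U Z \<in> carrier L"
      if "finite Z \<and> W \<union> W' \<subseteq> Z \<and> Z \<subseteq> verts E" for Z
      using W W' that UC by simp_all
    have "?unit (W \<union> W') (x \<oplus>\<^bsub>L\<^esub> y)"
      using W W' c u by (simp add: L.l_distr L.r_distr)
    then show "x \<oplus>\<^bsub>L\<^esub> y \<in> ?C"
      using c by (intro CollectI conjI exI[of _ "W \<union> W'"]) simp_all
    have "U Z \<otimes>\<^bsub>L\<^esub> (x \<otimes>\<^bsub>L\<^esub> y) = x \<otimes>\<^bsub>L\<^esub> y \<and> x \<otimes>\<^bsub>L\<^esub> y \<otimes>\<^bsub>L\<^esub> U Z = x \<otimes>\<^bsub>L\<^esub> y"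
      if Z: "finite Z \<and> W \<union> W' \<subseteq> Z \<and> Z \<subseteq> verts E" for Z
      using u[OF Z] c L.m_assoc[of "U Z" x y] L.m_assoc[of x y "U Z"] by simp
    then have "?unit (W \<union> W') (x \<otimes>\<^bsub>L\<^esub> y)"
      using W W' by simp
    then show "x \<otimes>\<^bsub>L\<^esub> y \<in> ?C"
      using c by (intro CollectI conjI exI[of _ "W \<union> W'"]) simp_all
  qed
  then show ?thesis
    using assms by blast
qed

lemma U_closed: "W \<subseteq> verts E \<Longrightarrow> U W \<in> carrier L"
  by (intro L.finsum_closed) auto

lemma vertex_unit:
  assumes "finite X" "X \<subseteq> carrier L"
  shows "\<exists>W. finite W \<and> W \<subseteq> verts E \<and> (\<forall>x\<in>X. U W \<otimes>\<^bsub>L\<^esub> x = x \<and> x \<otimes>\<^bsub>L\<^esub> U W = x)"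
proof -
  have "\<exists>w. \<forall>x\<in>X. finite (w x) \<and> w x \<subseteq> verts E \<and>
    (\<forall>W'. finite W' \<and> w x \<subseteq> W' \<and> W' \<subseteq> verts E \<longrightarrow> U W' \<otimes>\<^bsub>L\<^esub> x = x \<and> x \<otimes>\<^bsub>L\<^esub> U W' = x)"
    using vertex_units_exist assms(2) by (intro bchoice) blast
  then obtain w where w: "\<forall>x\<in>X. finite (w x) \<and> w x \<subseteq> verts E \<and>
    (\<forall>W'. finite W' \<and> w x \<subseteq> W' \<and> W' \<subseteq> verts E \<longrightarrow> U W' \<otimes>\<^bsub>L\<^esub> x = x \<and> x \<otimes>\<^bsub>L\<^esub> U W' = x)"
    by (elim exE)
  let ?W = "\<Union>(w ` X)"
  have W: "finite ?W" "?W \<subseteq> verts E"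
    using w assms(1) by (simp, blast)
  moreover have "U ?W \<otimes>\<^bsub>L\<^esub> x = x \<and> x \<otimes>\<^bsub>L\<^esub> U ?W = x" if x: "x \<in> X" for x
  proof -
    have "w x \<subseteq> ?W"
      using x by blast
    then show ?thesis
      using bspec[OF w x, THEN conjunct2, THEN conjunct2, THEN spec[of _ ?W]] W by simp
  qed
  ultimately show ?thesis
    by (intro exI[of _ ?W]) simp
qed

lemma U_idem:
  assumes "finite W" "W \<subseteq> verts E"
  shows "U W \<otimes>\<^bsub>L\<^esub> U W = U W"
proof -
  have "U W \<otimes>\<^bsub>L\<^esub> U W = finsum L (\<lambda>v. U W \<otimes>\<^bsub>L\<^esub> lvtx R E v) W"
    using assms U_closed by (intro L.finsum_r_distr) auto
  also have "\<dots> = U W"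
  proof (rule L.finsum_cong')
    fix v assume v: "v \<in> W"
    have "U W \<otimes>\<^bsub>L\<^esub> lvtx R E v = finsum L (\<lambda>w. lvtx R E w \<otimes>\<^bsub>L\<^esub> lvtx R E v) W"
      using assms v by (intro L.finsum_l_distr) auto
    also have "\<dots> = lvtx R E v \<otimes>\<^bsub>L\<^esub> lvtx R E v"
      using assms v by (intro L.finsum_singleton_support) (auto simp: F.V_orth subset_iff)
    finally show "U W \<otimes>\<^bsub>L\<^esub> lvtx R E v = lvtx R E v"
      using assms v by (auto simp: F.V_idem)
  qed (use assms in auto)
  finally show ?thesis .
qed

lemma leavitt_local_units: "has_local_units L"
  unfolding has_local_units_def
proof (intro allI impI)
  fix X assume X: "finite X \<and> X \<subseteq> carrier L"
  obtain W where W: "finite W \<and> W \<subseteq> verts E \<and> (\<forall>x\<in>X. U W \<otimes>\<^bsub>L\<^esub> x = x \<and> x \<otimes>\<^bsub>L\<^esub> U W = x)"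
    using vertex_unit[OF conjunct1[OF X] conjunct2[OF X]] by (elim exE)
  then show "\<exists>u\<in>carrier L. u \<otimes>\<^bsub>L\<^esub> u = u \<and> (\<forall>x\<in>X. u \<otimes>\<^bsub>L\<^esub> x = x \<and> x \<otimes>\<^bsub>L\<^esub> u = x)"
    by (intro bexI[of _ "U W"] conjI U_idem U_closed) simp_all
qed

text \<open>The generators are homogeneous, hence so are words. The family is zero outside its
  finite index set, so that families with different index sets can be added.\<close>

lemma finite_homogeneous_sum:
  assumes "x \<in> carrier L"
  shows "\<exists>K f. finite K \<and> (\<forall>k. f k \<in> F.Hom k) \<and> (\<forall>k. k \<notin> K \<longrightarrow> f k = \<zero>\<^bsub>L\<^esub>) \<and> x = finsum L f K"
    (is "?sum x")
proof -
  have single: "?sum x" if "x \<in> F.Hom k" for x k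
    using that F.Hom_in_carrier[OF that]
    by (intro exI[of _ "{k}"] exI[of _ "\<lambda>l. if l = k then x else \<zero>\<^bsub>L\<^esub>"]) (simp add: Pi_def)
  have sum_closed: "?sum (x \<oplus>\<^bsub>L\<^esub> y)" if sums: "?sum x" "?sum y" for x y
  proof -
    obtain f K where f: "finite K" "\<forall>k. f k \<in> F.Hom k" "\<forall>k. k \<notin> K \<longrightarrow> f k = \<zero>\<^bsub>L\<^esub>" "x = finsum L f K"
      using sums(1) by (elim exE conjE)
    obtain g K' where g: "finite K'" "\<forall>k. g k \<in> F.Hom k" "\<forall>k. k \<notin> K' \<longrightarrow> g k = \<zero>\<^bsub>L\<^esub>" "y = finsum L g K'"
      using sums(2) by (elim exE conjE)
    have c: "f \<in> K \<union> K' \<rightarrow> carrier L" "g \<in> K \<union> K' \<rightarrow> carrier L"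
      using f(2) g(2) F.Hom_in_carrier by (simp_all add: Pi_def) blast+
    have "x = finsum L f (K \<union> K')" "y = finsum L g (K \<union> K')"
      unfolding f(4) g(4) using f g c
      by (subst L.finsum_mono_neutral[of "K \<union> K'" K], simp_all) (subst L.finsum_mono_neutral[of "K \<union> K'" K'], simp_all)
    then have "x \<oplus>\<^bsub>L\<^esub> y = finsum L (\<lambda>k. f k \<oplus>\<^bsub>L\<^esub> g k) (K \<union> K')"
      using c by (simp add: L.finsum_addf)
    then show ?thesis
      using f g by (intro exI[of _ "K \<union> K'"] exI[of _ "\<lambda>k. f k \<oplus>\<^bsub>L\<^esub> g k"]) (simp add: F.Hom_add)
  qed
  have mon: "?sum (c \<odot>\<^bsub>L\<^esub> lword R E w)" if w: "w \<noteq> []" "set w \<subseteq> gens" for c w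
  proof -
    have "lword R E w \<in> (\<Union>k. F.Hom k)"
    proof (rule lword_in_subset[OF _ _ w])
      show "lword R E [g] \<in> (\<Union>k. F.Hom k)" if "g \<in> gens" for g
        using that F.V_Hom F.P_Hom F.G_Hom by (cases g) auto
      show "x \<otimes>\<^bsub>L\<^esub> y \<in> (\<Union>k. F.Hom k)" if "x \<in> (\<Union>k. F.Hom k)" "y \<in> (\<Union>k. F.Hom k)" for x y
        using that F.Hom_mult by blast
    qed
    then show ?thesis
      using single F.Hom_smult by blast
  qed
  show ?thesis
    using assms
  proof (induction rule: leavitt_induct)
    case zero
    show ?case
      by (rule single[OF F.Hom_zero])
  next
    case (word c w)
    then show ?case
      by (rule mon)
  next
    case (add x y)
    show ?case
      by (rule sum_closed) fact+
  qed
qed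

end

section \<open>Consequences of the operator representation\<close>

locale clpa = lpa E R for E :: "('v, 'e) pre_digraph" and R :: "'r::comm_ring_1 itself" +
  assumes countable_arcs: "countable (arcs E)"
begin

text \<open>Read a function as a family of functions on \<nat> \<times> \<int>, one at each vertex.
  \<open>P e\<close> places the one at the head of \<open>e\<close> into the part
  \<open>range (\<phi> e)\<close> at its tail, one degree higher, and \<open>G e\<close> reads it
  back. The sum relation holds because these parts cover \<nat>, and different edges are orthogonal
  because the parts are disjoint.\<close>

lemma operator_representation:
  "\<exists>h\<in>alg_hom L op_alg. (\<forall>k. \<forall>x\<in>F.Hom k. h x \<in> deg_ops k) \<and>
    (\<forall>v\<in>verts E. \<forall>g x. h (lvtx R E v) g (v, x) = g (v, x))"
proof -
  obtain \<phi> :: "'e \<Rightarrow> nat \<Rightarrow> nat" where \<phi>_props: "\<forall>e\<in>arcs E. inj (\<phi> e)"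
    "\<forall>e\<in>arcs E. \<forall>f\<in>arcs E. \<forall>m n. tail E e = tail E f \<longrightarrow> \<phi> e m = \<phi> f n \<longrightarrow> e = f"
    "\<forall>v m. out_arcs E v \<noteq> {} \<longrightarrow> (\<exists>e\<in>out_arcs E v. m \<in> range (\<phi> e))"
    using branching_maps[OF countable_arcs] by (elim exE conjE)
  note \<phi> = \<phi>_props[rule_format]
  define V :: "'v \<Rightarrow> ('v \<times> nat \<times> int \<Rightarrow> 'r) \<Rightarrow> 'v \<times> nat \<times> int \<Rightarrow> 'r"
    where "V v = (\<lambda>g (w, m, i). if w = v then g (w, m, i) else 0)" for v
  define P :: "'e \<Rightarrow> ('v \<times> nat \<times> int \<Rightarrow> 'r) \<Rightarrow> 'v \<times> nat \<times> int \<Rightarrow> 'r"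
    where "P e = (\<lambda>g (w, m, i). if w = tail E e \<and> m \<in> range (\<phi> e) then g (head E e, inv_into UNIV (\<phi> e) m, i - 1) else 0)" for e
  define G :: "'e \<Rightarrow> ('v \<times> nat \<times> int \<Rightarrow> 'r) \<Rightarrow> 'v \<times> nat \<times> int \<Rightarrow> 'r"
    where "G e = (\<lambda>g (w, m, i). if w = head E e then g (tail E e, \<phi> e m, i + 1) else 0)" for e
  note defs = V_def P_def G_def
  have carrier: "V v \<in> carrier op_alg" "P e \<in> carrier op_alg" "G e \<in> carrier op_alg" for v e
    by (auto simp: op_alg_def defs fun_eq_iff)
  have PG: "P e (G e g) (w, m, i) = (if w = tail E e \<and> m \<in> range (\<phi> e) then g (w, m, i) else 0)" for e g w m i
    by (auto simp: defs f_inv_into_f)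
  have "lfam op_alg E V P G"
  proof (intro lfam.intro op_alg_ralg wf_digraph_axioms lfam_axioms.intro)
    fix v assume v: "v \<in> verts E" "finite (out_arcs E v)" "out_arcs E v \<noteq> {}"
    have "V v g (w, m, i) = (\<Sum>e\<in>out_arcs E v. P e (G e g) (w, m, i))" for g w m i
    proof (cases "w = v")
      case True
      obtain e where e: "e \<in> out_arcs E v" "m \<in> range (\<phi> e)"
        using \<phi>(3)[OF v(3)] by blast
      have "m \<notin> range (\<phi> f)" if "f \<in> out_arcs E v" "f \<noteq> e" for f
        using e that \<phi>(2)[of e f] by auto
      then have "(\<Sum>e\<in>out_arcs E v. P e (G e g) (w, m, i)) = (\<Sum>f\<in>out_arcs E v. if f = e then g (w, m, i) else 0)"
        using e True by (intro sum.cong) (auto simp: PG)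
      then show ?thesis
        using v e True by (simp add: V_def)
    next
      case False
      then show ?thesis
        by (auto simp: PG V_def intro!: sum.neutral[symmetric])
    qed
    then show "V v = (\<Oplus>\<^bsub>op_alg\<^esub>e\<in>out_arcs E v. P e \<otimes>\<^bsub>op_alg\<^esub> G e)"
      using ralg.axioms(1)[OF op_alg_ralg, THEN rng.m_closed] carrier
      by (subst fun_eq_iff, intro allI, subst fun_eq_iff, subst op_alg_finsum) (auto simp: op_alg_def)
  qed (use carrier \<phi>(1,2) in \<open>auto simp: op_alg_def defs fun_eq_iff inv_f_f\<close>)
  then interpret O: lfam op_alg E V P G .
  have deg: "V v \<in> deg_ops 0" "P e \<in> deg_ops 1" "G e \<in> deg_ops (- 1)" for v e
    unfolding deg_ops_def using carrier by (auto simp: defs deg_proj_def fun_eq_iff)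
  obtain h where h: "h \<in> alg_hom L op_alg" "\<forall>v\<in>verts E. h (lvtx R E v) = V v"
    "\<forall>e\<in>arcs E. h (ledg R E e) = P e" "\<forall>e\<in>arcs E. h (lgst R E e) = G e"
    using O.leavitt_universal[of R] by (elim bexE conjE)
  interpret h: alg_morphism L op_alg h
    by unfold_locales (rule h)
  have "h x \<in> deg_ops k" if "x \<in> F.Hom k" for x k
    by (rule F.hom_graded[OF h.alg_morphism_axioms _ _ _ _ _ _ _ that])
      (simp_all add: deg_ops_closed deg h)
  moreover have "V v g (v, x) = g (v, x)" for v g x
    by (cases x) (simp add: V_def)
  ultimately show ?thesis
    using h by (intro bexI[of _ h] conjI allI ballI) simp_all
qed

text \<open>Applied to the constant function 1, the image of \<open>c v\<close> takes the value
  \<open>c\<close> at \<open>(v, 0, 0)\<close>.\<close>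

lemma smult_vertex_nonzero:
  assumes "v \<in> verts E" "c \<noteq> 0"
  shows "c \<odot>\<^bsub>L\<^esub> lvtx R E v \<noteq> \<zero>\<^bsub>L\<^esub>"
proof
  assume zero: "c \<odot>\<^bsub>L\<^esub> lvtx R E v = \<zero>\<^bsub>L\<^esub>"
  obtain h where h: "h \<in> alg_hom L op_alg" "\<forall>k. \<forall>x\<in>F.Hom k. h x \<in> deg_ops k"
    "\<forall>v\<in>verts E. \<forall>g x. h (lvtx R E v) g (v, x) = g (v, x)"
    using operator_representation by (elim bexE conjE)
  interpret h: alg_morphism L op_alg h
    using L.ralg_axioms op_alg_ralg h(1) by (rule alg_morphismI)
  have "c \<odot>\<^bsub>op_alg\<^esub> h (lvtx R E v) = \<zero>\<^bsub>op_alg\<^esub>"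
    using h.h_smult[of "lvtx R E v" c] assms zero by simp
  from fun_cong[OF fun_cong[OF this, of "\<lambda>x. 1"], of "(v, 0, 0)"] show False
    using assms h(3) by (simp add: op_alg_def)
qed

text \<open>Degrees separate in \<open>op_alg\<close>, so \<open>h (f l)\<close> is zero, but
  \<open>h\<close> is not known to be injective. By \<open>homogeneous_reduction\<close> with the
  zero ideal, a nonzero homogeneous element of the kernel would produce some \<open>c v\<close> in
  it with \<open>c \<noteq> 0\<close>, and the representation excludes this.\<close>

lemma homogeneous_independent:
  assumes "finite N" "\<And>k. k \<in> N \<Longrightarrow> f k \<in> F.Hom k" "finsum L f N = \<zero>\<^bsub>L\<^esub>" "l \<in> N"
  shows "f l = \<zero>\<^bsub>L\<^esub>"
proof (rule ccontr)
  assume nz: "f l \<noteq> \<zero>\<^bsub>L\<^esub>"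
  obtain h where h: "h \<in> alg_hom L op_alg" "\<forall>k. \<forall>x\<in>F.Hom k. h x \<in> deg_ops k"
    "\<forall>v\<in>verts E. \<forall>g x. h (lvtx R E v) g (v, x) = g (v, x)"
    using operator_representation by (elim bexE conjE)
  interpret h: alg_morphism L op_alg h
    using L.ralg_axioms op_alg_ralg h(1) by (rule alg_morphismI)
  have "finsum op_alg (\<lambda>k. h (f k)) N = h (finsum L f N)"
    using assms(2) F.Hom_in_carrier by (subst h.h_finsum) (auto simp: Pi_def)
  then have "h (f l) = \<zero>\<^bsub>op_alg\<^esub>"
    using assms by (intro deg_ops_independent[of N "\<lambda>k. h (f k)"]) (simp_all add: h(2))
  then have ker: "f l \<in> h.ker"
    using F.Hom_in_carrier assms(2,4) by (auto simp: h.ker_def)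
  have zero: "rng_ideal {\<zero>\<^bsub>L\<^esub>} L"
    by (rule L.rng_idealI) auto
  have "\<exists>c. c \<noteq> 0 \<and> ((\<exists>v\<in>verts E - {}. c \<odot>\<^bsub>L\<^esub> lvtx R E v \<in> h.ker) \<or>
    (\<exists>v\<in>breaking E {} - {}. c \<odot>\<^bsub>L\<^esub> F.gap v {e \<in> out_arcs E v. head E e \<notin> {}} \<in> h.ker))"
    by (rule F.homogeneous_reduction[OF zero h.ker_ideal _ _ _ assms(2)[OF assms(4)] ker])
      (use nz in \<open>auto simp: h.ker_def\<close>)
  \<comment> \<open>With H empty every edge is an exit, and the edges leaving \<open>v\<close>
    cannot be both finite and infinite in number.\<close>
  moreover have "breaking E {} = {}"
    by (auto simp: breaking_def out_arcs_def)
  ultimately obtain c v where c: "c \<noteq> 0" "v \<in> verts E" "c \<odot>\<^bsub>L\<^esub> lvtx R E v \<in> h.ker"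
    by auto
  then have "c \<odot>\<^bsub>op_alg\<^esub> h (lvtx R E v) = \<zero>\<^bsub>op_alg\<^esub>"
    using h.h_smult[of "lvtx R E v" c] by (simp add: h.ker_def)
  from fun_cong[OF fun_cong[OF this, of "\<lambda>x. 1"], of "(v, 0, 0)"] show False
    using c(1,2) h(3) by (simp add: op_alg_def)
qed

end

section \<open>Quotients by ideals of admissible pairs\<close>

lemma (in alg_morphism) ker_alg_ideal: "alg_ideal A ker"
  by (intro alg_ideal.intro dom.ralg_axioms ker_ideal alg_ideal_axioms.intro)
    (simp add: ker_def h_smult)

lemma (in alg_morphism) ker_diff_iff:
  assumes "x \<in> carrier A" "x' \<in> carrier A"
  shows "x \<ominus>\<^bsub>A\<^esub> x' \<in> ker \<longleftrightarrow> h x = h x'"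
  unfolding ker_def mem_Collect_eq h_diff[OF assms]
  by (simp add: assms cod.minus_eq_zero_iff)

text \<open>The canonical map of (3) goes into the quotient, so the isomorphism theorem is needed
  for the inverse map, which sends \<open>h x\<close> to the class of \<open>x\<close>.\<close>

lemma (in alg_morphism) quotient_inverse:
  assumes "h ` carrier A = carrier B"
  shows "\<exists>\<theta>\<in>alg_hom B (alg_quot A ker). bij_betw \<theta> (carrier B) (carrier (alg_quot A ker)) \<and>
    (\<forall>x\<in>carrier A. \<theta> (h x) = ker +>\<^bsub>A\<^esub> x)"
proof -
  interpret K: alg_ideal A ker
    by (rule ker_alg_ideal)
  define \<theta> where "\<theta> y = ker +>\<^bsub>A\<^esub> (SOME x. x \<in> carrier A \<and> h x = y)" for y
  have coset_eq: "ker +>\<^bsub>A\<^esub> x = ker +>\<^bsub>A\<^esub> x' \<longleftrightarrow> h x = h x'" if "x \<in> carrier A" "x' \<in> carrier A" for x x'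
    using K.coset_eq_iff[OF that] ker_diff_iff[OF that] by (rule trans)
  have \<theta>_h: "\<theta> (h x) = ker +>\<^bsub>A\<^esub> x" if x: "x \<in> carrier A" for x
  proof -
    have "(SOME z. z \<in> carrier A \<and> h z = h x) \<in> carrier A \<and> h (SOME z. z \<in> carrier A \<and> h z = h x) = h x"
      by (rule someI[of "\<lambda>z. z \<in> carrier A \<and> h z = h x" x]) (simp add: x)
    then show ?thesis
      unfolding \<theta>_def using x by (intro coset_eq[THEN iffD2]) simp_all
  qed
  have "\<theta> \<in> alg_hom B (alg_quot A ker)"
    unfolding alg_hom_def assms[symmetric]
    by (intro CollectI conjI ballI allI funcsetI; elim imageE;
        simp add: \<theta>_h K.quot_carrier K.quot_add K.quot_mult K.quot_smult
          h_add[symmetric] h_mult[symmetric] h_smult[symmetric])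
  moreover have "bij_betw \<theta> (carrier B) (carrier (alg_quot A ker))"
    unfolding bij_betw_def
  proof
    show "inj_on \<theta> (carrier B)"
      unfolding assms[symmetric] by (rule inj_onI, elim imageE) (simp add: \<theta>_h coset_eq)
    show "\<theta> ` carrier B = carrier (alg_quot A ker)"
      unfolding assms[symmetric] K.quot_carrier image_image by (rule image_cong) (simp_all add: \<theta>_h)
  qed
  ultimately show ?thesis
    using \<theta>_h by (intro bexI[of _ \<theta>]) simp_all
qed

lemma (in lpa) lgap_eq: "lgap R E v W = F.gap v W"
  by (simp add: lgap_def F.gap_def)

lemma (in lfam) V_V_if: "v \<in> verts E \<Longrightarrow> w \<in> verts E \<Longrightarrow> V v \<otimes> V w = (if v = w then V v else \<zero>)"
  by (simp add: V_idem V_orth)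

section \<open>The homomorphism onto the algebra of the quotient graph\<close>

locale adm_pair = clpa E R for E :: "('v, 'e) pre_digraph" and R :: "'r::comm_ring_1 itself" +
  fixes H S :: "'v set"
  assumes admissible: "admissible_pair E H S"
begin

abbreviation "EQ \<equiv> quotient_graph E H S"
abbreviation "B \<equiv> breaking E H - S"
abbreviation "LQ \<equiv> leavitt R EQ"
abbreviation "I \<equiv> pair_ideal R E H S"
abbreviation "exits v \<equiv> {e \<in> out_arcs E v. head E e \<notin> H}"

lemma H_verts: "v \<in> H \<Longrightarrow> v \<in> verts E"
  using admissible by (auto simp: admissible_pair_def hereditary_def)

lemma H_hereditary: "e \<in> arcs E \<Longrightarrow> tail E e \<in> H \<Longrightarrow> head E e \<in> H"
  using admissible by (auto simp: admissible_pair_def hereditary_def)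

lemma H_saturated:
  "v \<in> verts E \<Longrightarrow> v \<notin> H \<Longrightarrow> finite (out_arcs E v) \<Longrightarrow> out_arcs E v \<noteq> {} \<Longrightarrow> exits v \<noteq> {}"
  using admissible by (auto simp: admissible_pair_def saturated_def image_subset_iff)

lemma S_breaking: "v \<in> S \<Longrightarrow> v \<in> breaking E H"
  using admissible by (auto simp: admissible_pair_def)

lemma breaking_props: "v \<in> breaking E H \<Longrightarrow> v \<in> verts E" "v \<in> breaking E H \<Longrightarrow> v \<notin> H"
  "v \<in> breaking E H \<Longrightarrow> finite (exits v)" "v \<in> breaking E H \<Longrightarrow> exits v \<noteq> {}"
  "v \<in> breaking E H \<Longrightarrow> infinite (out_arcs E v)"
  unfolding breaking_def by simp_all

lemma EQ_verts [simp]: "Old v \<in> verts EQ \<longleftrightarrow> v \<in> verts E \<and> v \<notin> H" "Prime v \<in> verts EQ \<longleftrightarrow> v \<in> B"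
  by (auto simp: quotient_graph_def)

lemma EQ_arcs [simp]: "Old e \<in> arcs EQ \<longleftrightarrow> e \<in> arcs E \<and> head E e \<notin> H"
  "Prime e \<in> arcs EQ \<longleftrightarrow> e \<in> arcs E \<and> head E e \<in> B"
  by (auto simp: quotient_graph_def)

lemma EQ_ends [simp]: "tail EQ (Old e) = Old (tail E e)" "tail EQ (Prime e) = Old (tail E e)"
  "head EQ (Old e) = Old (head E e)" "head EQ (Prime e) = Prime (head E e)"
  by (simp_all add: quotient_graph_def)

lemma head_B: "e \<in> arcs E \<Longrightarrow> head E e \<in> breaking E H \<Longrightarrow> head E e \<notin> H"
  by (simp add: breaking_props)

lemma tail_notin_H: "e \<in> arcs E \<Longrightarrow> head E e \<notin> H \<Longrightarrow> tail E e \<notin> H"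
  using H_hereditary by blast

sublocale Q: clpa EQ R
proof
  fix e assume "e \<in> arcs EQ"
  then show "tail EQ e \<in> verts EQ" "head EQ e \<in> verts EQ"
    by (cases e; simp add: tail_notin_H head_B)+
next
  have "countable (Old ` {e \<in> arcs E. head E e \<in> verts E - H} \<union> Prime ` {e \<in> arcs E. head E e \<in> B})"
    using countable_arcs by (intro countable_Un countable_image) (auto intro: countable_subset)
  then show "countable (arcs EQ)"
    by (simp add: quotient_graph_def)
qed

text \<open>
  A generator of \<open>L\<close> will be mapped to the sum of its unprimed and its primed copy, a copy that does
  not exist in the quotient graph counting as zero.
\<close>

definition oV where "oV v = (if v \<in> verts E \<and> v \<notin> H then lvtx R EQ (Old v) else \<zero>\<^bsub>LQ\<^esub>)"
definition pV where "pV v = (if v \<in> B then lvtx R EQ (Prime v) else \<zero>\<^bsub>LQ\<^esub>)"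
definition oP where "oP e = (if head E e \<notin> H then ledg R EQ (Old e) else \<zero>\<^bsub>LQ\<^esub>)"
definition pP where "pP e = (if head E e \<in> B then ledg R EQ (Prime e) else \<zero>\<^bsub>LQ\<^esub>)"
definition oG where "oG e = (if head E e \<notin> H then lgst R EQ (Old e) else \<zero>\<^bsub>LQ\<^esub>)"
definition pG where "pG e = (if head E e \<in> B then lgst R EQ (Prime e) else \<zero>\<^bsub>LQ\<^esub>)"

lemmas op_defs = oV_def pV_def oP_def pP_def oG_def pG_def

lemma op_closed [simp]: "oV v \<in> carrier LQ" "pV v \<in> carrier LQ"
  "e \<in> arcs E \<Longrightarrow> oP e \<in> carrier LQ" "e \<in> arcs E \<Longrightarrow> pP e \<in> carrier LQ"
  "e \<in> arcs E \<Longrightarrow> oG e \<in> carrier LQ" "e \<in> arcs E \<Longrightarrow> pG e \<in> carrier LQ"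
  by (auto simp: op_defs)

text \<open>Primed vertices are sinks of the quotient graph, so \<open>pV v\<close> kills every edge
  from the left and every ghost edge from the right. The other products are relations of
  \<open>leavitt R EQ\<close>, an absent copy counting as zero.\<close>

lemma op_mult:
  "oV v \<otimes>\<^bsub>LQ\<^esub> oV w = (if v = w then oV v else \<zero>\<^bsub>LQ\<^esub>)" "oV v \<otimes>\<^bsub>LQ\<^esub> pV w = \<zero>\<^bsub>LQ\<^esub>"
  "pV v \<otimes>\<^bsub>LQ\<^esub> oV w = \<zero>\<^bsub>LQ\<^esub>" "pV v \<otimes>\<^bsub>LQ\<^esub> pV w = (if v = w then pV v else \<zero>\<^bsub>LQ\<^esub>)"
  "e \<in> arcs E \<Longrightarrow> oV v \<otimes>\<^bsub>LQ\<^esub> oP e = (if v = tail E e then oP e else \<zero>\<^bsub>LQ\<^esub>)"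
  "e \<in> arcs E \<Longrightarrow> oV v \<otimes>\<^bsub>LQ\<^esub> pP e = (if v = tail E e then pP e else \<zero>\<^bsub>LQ\<^esub>)"
  "e \<in> arcs E \<Longrightarrow> pV v \<otimes>\<^bsub>LQ\<^esub> oP e = \<zero>\<^bsub>LQ\<^esub>" "e \<in> arcs E \<Longrightarrow> pV v \<otimes>\<^bsub>LQ\<^esub> pP e = \<zero>\<^bsub>LQ\<^esub>"
  "e \<in> arcs E \<Longrightarrow> oP e \<otimes>\<^bsub>LQ\<^esub> oV v = (if v = head E e then oP e else \<zero>\<^bsub>LQ\<^esub>)"
  "e \<in> arcs E \<Longrightarrow> oP e \<otimes>\<^bsub>LQ\<^esub> pV v = \<zero>\<^bsub>LQ\<^esub>" "e \<in> arcs E \<Longrightarrow> pP e \<otimes>\<^bsub>LQ\<^esub> oV v = \<zero>\<^bsub>LQ\<^esub>"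
  "e \<in> arcs E \<Longrightarrow> pP e \<otimes>\<^bsub>LQ\<^esub> pV v = (if v = head E e then pP e else \<zero>\<^bsub>LQ\<^esub>)"
  "e \<in> arcs E \<Longrightarrow> oG e \<otimes>\<^bsub>LQ\<^esub> oV v = (if v = tail E e then oG e else \<zero>\<^bsub>LQ\<^esub>)"
  "e \<in> arcs E \<Longrightarrow> pG e \<otimes>\<^bsub>LQ\<^esub> oV v = (if v = tail E e then pG e else \<zero>\<^bsub>LQ\<^esub>)"
  "e \<in> arcs E \<Longrightarrow> oG e \<otimes>\<^bsub>LQ\<^esub> pV v = \<zero>\<^bsub>LQ\<^esub>" "e \<in> arcs E \<Longrightarrow> pG e \<otimes>\<^bsub>LQ\<^esub> pV v = \<zero>\<^bsub>LQ\<^esub>"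
  "e \<in> arcs E \<Longrightarrow> oV v \<otimes>\<^bsub>LQ\<^esub> oG e = (if v = head E e then oG e else \<zero>\<^bsub>LQ\<^esub>)"
  "e \<in> arcs E \<Longrightarrow> pV v \<otimes>\<^bsub>LQ\<^esub> oG e = \<zero>\<^bsub>LQ\<^esub>" "e \<in> arcs E \<Longrightarrow> oV v \<otimes>\<^bsub>LQ\<^esub> pG e = \<zero>\<^bsub>LQ\<^esub>"
  "e \<in> arcs E \<Longrightarrow> pV v \<otimes>\<^bsub>LQ\<^esub> pG e = (if v = head E e then pG e else \<zero>\<^bsub>LQ\<^esub>)"
  "e \<in> arcs E \<Longrightarrow> f \<in> arcs E \<Longrightarrow> oG e \<otimes>\<^bsub>LQ\<^esub> oP f = (if e = f then oV (head E e) else \<zero>\<^bsub>LQ\<^esub>)"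
  "e \<in> arcs E \<Longrightarrow> f \<in> arcs E \<Longrightarrow> oG e \<otimes>\<^bsub>LQ\<^esub> pP f = \<zero>\<^bsub>LQ\<^esub>"
  "e \<in> arcs E \<Longrightarrow> f \<in> arcs E \<Longrightarrow> pG e \<otimes>\<^bsub>LQ\<^esub> oP f = \<zero>\<^bsub>LQ\<^esub>"
  "e \<in> arcs E \<Longrightarrow> f \<in> arcs E \<Longrightarrow> pG e \<otimes>\<^bsub>LQ\<^esub> pP f = (if e = f then pV (head E e) else \<zero>\<^bsub>LQ\<^esub>)"
  by (auto simp: op_defs Q.F.V_V_if Q.F.V_P_if Q.F.P_V_if Q.F.G_V_if Q.F.V_G_if Q.F.G_P_if
      tail_notin_H head_B breaking_props)

text \<open>The two copies of \<open>e\<close> have different heads, and different vertices are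
  orthogonal.\<close>

lemma oP_pG: "e \<in> arcs E \<Longrightarrow> oP e \<otimes>\<^bsub>LQ\<^esub> pG e = \<zero>\<^bsub>LQ\<^esub>"
  using Q.L.m_assoc[of "oP e" "oV (head E e)" "pG e"] by (simp add: op_mult)

lemma pP_oG: "e \<in> arcs E \<Longrightarrow> pP e \<otimes>\<^bsub>LQ\<^esub> oG e = \<zero>\<^bsub>LQ\<^esub>"
  using Q.L.m_assoc[of "pP e" "pV (head E e)" "oG e"] by (simp add: op_mult)

definition qV where "qV v = oV v \<oplus>\<^bsub>LQ\<^esub> pV v"
definition qP where "qP e = oP e \<oplus>\<^bsub>LQ\<^esub> pP e"
definition qG where "qG e = oG e \<oplus>\<^bsub>LQ\<^esub> pG e"

lemma qP_qG: "e \<in> arcs E \<Longrightarrow> qP e \<otimes>\<^bsub>LQ\<^esub> qG e = oP e \<otimes>\<^bsub>LQ\<^esub> oG e \<oplus>\<^bsub>LQ\<^esub> pP e \<otimes>\<^bsub>LQ\<^esub> pG e"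
  by (simp add: qP_def qG_def Q.L.l_distr Q.L.r_distr oP_pG pP_oG)

text \<open>In the quotient graph \<open>Old v\<close> emits the unprimed copies of the exits of
  \<open>v\<close> and the primed copies of those exits that end in \<open>B\<close>. The edges into
  H are gone, so even a breaking vertex, with its infinitely many edges, acquires a sum
  relation.\<close>

lemma oV_sum:
  assumes v: "v \<in> verts E" "v \<notin> H" and fin: "finite (exits v)" "exits v \<noteq> {}"
  shows "oV v = finsum LQ (\<lambda>e. qP e \<otimes>\<^bsub>LQ\<^esub> qG e) (exits v)"
proof -
  let ?B = "{e \<in> out_arcs E v. head E e \<in> B}"
  have sub: "?B \<subseteq> exits v"
    using breaking_props by auto
  have out: "out_arcs EQ (Old v) = Old ` exits v \<union> Prime ` ?B"
    by (auto simp: quotient_graph_def out_arcs_def)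
  have fB: "finite ?B"
    using sub fin(1) by (rule finite_subset)
  let ?t = "\<lambda>e. ledg R EQ e \<otimes>\<^bsub>LQ\<^esub> lgst R EQ e"
  have c: "?t \<in> Old ` exits v \<rightarrow> carrier LQ" "?t \<in> Prime ` ?B \<rightarrow> carrier LQ"
    by auto
  have "oV v = lvtx R EQ (Old v)"
    using v by (simp add: oV_def)
  also have "\<dots> = finsum LQ ?t (out_arcs EQ (Old v))"
    by (rule Q.F.V_sum) (use v fin fB out in auto)
  also have "\<dots> = finsum LQ ?t (Old ` exits v) \<oplus>\<^bsub>LQ\<^esub> finsum LQ ?t (Prime ` ?B)"
    unfolding out using fin(1) fB c by (intro Q.L.finsum_Un_disjoint) auto
  also have "finsum LQ ?t (Old ` exits v) = finsum LQ (\<lambda>e. ?t (Old e)) (exits v)"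
    using c by (intro Q.L.finsum_reindex) (auto simp: inj_on_def)
  also have "\<dots> = finsum LQ (\<lambda>e. oP e \<otimes>\<^bsub>LQ\<^esub> oG e) (exits v)"
    by (rule Q.L.finsum_cong') (auto simp: oP_def oG_def)
  also have "finsum LQ ?t (Prime ` ?B) = finsum LQ (\<lambda>e. ?t (Prime e)) ?B"
    using c by (intro Q.L.finsum_reindex) (auto simp: inj_on_def)
  also have "\<dots> = finsum LQ (\<lambda>e. pP e \<otimes>\<^bsub>LQ\<^esub> pG e) ?B"
    by (rule Q.L.finsum_cong') (auto simp: pP_def pG_def)
  also have "\<dots> = finsum LQ (\<lambda>e. pP e \<otimes>\<^bsub>LQ\<^esub> pG e) (exits v)"
    by (rule Q.L.finsum_mono_neutral[symmetric]) (use fin sub in \<open>auto simp: pP_def pG_def\<close>)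
  also have "finsum LQ (\<lambda>e. oP e \<otimes>\<^bsub>LQ\<^esub> oG e) (exits v) \<oplus>\<^bsub>LQ\<^esub> \<dots> =
      finsum LQ (\<lambda>e. oP e \<otimes>\<^bsub>LQ\<^esub> oG e \<oplus>\<^bsub>LQ\<^esub> pP e \<otimes>\<^bsub>LQ\<^esub> pG e) (exits v)"
    by (rule Q.L.finsum_addf[symmetric]) auto
  also have "\<dots> = finsum LQ (\<lambda>e. qP e \<otimes>\<^bsub>LQ\<^esub> qG e) (exits v)"
    by (rule Q.L.finsum_cong') (auto simp: qP_qG)
  finally show ?thesis .
qed

text \<open>The sum relation is asked for \<open>v\<close> with finitely many edges only. Such a
  \<open>v\<close> is not breaking, so it has no primed copy, and its edges into H go to zero.
  Outside H, saturation provides the exit that \<open>oV_sum\<close> needs; inside H both sides are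
  zero.\<close>

lemma quotient_family: "lfam LQ E qV qP qG"
proof (intro lfam.intro Q.L.ralg_axioms wf_digraph_axioms lfam_axioms.intro)
  fix v assume v: "v \<in> verts E" "finite (out_arcs E v)" "out_arcs E v \<noteq> {}"
  have pV: "pV v = \<zero>\<^bsub>LQ\<^esub>"
    using breaking_props(5) v(2) by (auto simp: pV_def)
  have zero: "qP e \<otimes>\<^bsub>LQ\<^esub> qG e = \<zero>\<^bsub>LQ\<^esub>" if "e \<in> out_arcs E v - exits v" for e
    using that breaking_props(2) by (auto simp: qP_def oP_def pP_def qG_def)
  have "finsum LQ (\<lambda>e. qP e \<otimes>\<^bsub>LQ\<^esub> qG e) (out_arcs E v) = finsum LQ (\<lambda>e. qP e \<otimes>\<^bsub>LQ\<^esub> qG e) (exits v)"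
    by (rule Q.L.finsum_mono_neutral) (use v zero in \<open>auto simp: qP_def qG_def\<close>)
  also have "\<dots> = oV v"
  proof (cases "v \<in> H")
    case True
    then have "exits v = {}"
      using H_hereditary by auto
    then show ?thesis
      using True unfolding \<open>exits v = {}\<close> by (simp add: oV_def)
  next
    case False
    have "finite (exits v)"
      using v(2) by (rule finite_subset[rotated]) auto
    then show ?thesis
      using oV_sum[OF v(1) False] H_saturated[OF v(1) False v(2,3)] by simp
  qed
  finally show "qV v = finsum LQ (\<lambda>e. qP e \<otimes>\<^bsub>LQ\<^esub> qG e) (out_arcs E v)"
    by (simp add: qV_def pV)
qed (simp_all add: qV_def qP_def qG_def Q.L.l_distr Q.L.r_distr op_mult)

text \<open>The homomorphism from the universal property is fixed by choice, so that there is a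
  constant to which a sublocale declaration can refer.\<close>

definition \<eta> where
  "\<eta> = (SOME h. h \<in> alg_hom L LQ \<and> (\<forall>v\<in>verts E. h (lvtx R E v) = qV v) \<and>
    (\<forall>e\<in>arcs E. h (ledg R E e) = qP e) \<and> (\<forall>e\<in>arcs E. h (lgst R E e) = qG e))"

lemma \<eta>_props: "\<eta> \<in> alg_hom L LQ" "v \<in> verts E \<Longrightarrow> \<eta> (lvtx R E v) = qV v"
  "e \<in> arcs E \<Longrightarrow> \<eta> (ledg R E e) = qP e" "e \<in> arcs E \<Longrightarrow> \<eta> (lgst R E e) = qG e"
proof -
  have "\<exists>h. h \<in> alg_hom L LQ \<and> (\<forall>v\<in>verts E. h (lvtx R E v) = qV v) \<and>
    (\<forall>e\<in>arcs E. h (ledg R E e) = qP e) \<and> (\<forall>e\<in>arcs E. h (lgst R E e) = qG e)"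
    using lfam.leavitt_universal[OF quotient_family, of R] by (simp only: Bex_def)
  from someI_ex[OF this, folded \<eta>_def]
  show "\<eta> \<in> alg_hom L LQ" "v \<in> verts E \<Longrightarrow> \<eta> (lvtx R E v) = qV v"
    "e \<in> arcs E \<Longrightarrow> \<eta> (ledg R E e) = qP e" "e \<in> arcs E \<Longrightarrow> \<eta> (lgst R E e) = qG e"
    by simp_all
qed

sublocale \<eta>: alg_morphism L LQ \<eta>
  using L.ralg_axioms Q.L.ralg_axioms \<eta>_props(1) by (rule alg_morphismI)

text \<open>\<open>brk v\<close> is \<open>v\<^sup>H\<close>, and \<open>cut v\<close> below is \<open>v - v\<^sup>H\<close>.\<close>

definition brk where "brk v = F.gap v (exits v)"

lemma brk_closed [simp]: "v \<in> verts E \<Longrightarrow> brk v \<in> carrier L"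
  unfolding brk_def by (rule F.gap_closed) auto

lemma lbreak_eq: "lbreak R E H v = brk v"
  by (simp add: lbreak_def lgap_eq brk_def)

text \<open>The exits add up to \<open>Old v\<close>, so subtracting them from the sum of the two
  copies leaves the primed one. For \<open>v\<close> in S there is no primed copy, and
  \<open>v^H\<close> goes to zero.\<close>

lemma \<eta>_gap:
  assumes "v \<in> breaking E H"
  shows "\<eta> (brk v) = pV v"
proof -
  note v = breaking_props[OF assms]
  have sum: "finsum L (\<lambda>e. ledg R E e \<otimes>\<^bsub>L\<^esub> lgst R E e) (exits v) \<in> carrier L"
    by (rule L.finsum_closed) auto
  have "\<eta> (finsum L (\<lambda>e. ledg R E e \<otimes>\<^bsub>L\<^esub> lgst R E e) (exits v)) =
      finsum LQ (\<lambda>e. \<eta> (ledg R E e \<otimes>\<^bsub>L\<^esub> lgst R E e)) (exits v)"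
    by (rule \<eta>.h_finsum) auto
  also have "\<dots> = finsum LQ (\<lambda>e. qP e \<otimes>\<^bsub>LQ\<^esub> qG e) (exits v)"
    by (rule Q.L.finsum_cong') (auto simp: \<eta>.h_mult \<eta>_props qP_def qG_def)
  also have "\<dots> = oV v"
    by (rule oV_sum[OF v(1-4), symmetric])
  finally have "\<eta> (brk v) = qV v \<ominus>\<^bsub>LQ\<^esub> oV v"
    unfolding brk_def F.gap_def using v(1) sum by (simp add: \<eta>.h_diff \<eta>_props)
  also have "\<dots> = pV v"
    unfolding qV_def by (subst Q.L.a_comm) (simp_all add: Q.L.diff_add_cancel)
  finally show ?thesis .
qed

definition cut where "cut v = lvtx R E v \<ominus>\<^bsub>L\<^esub> brk v"

lemma cut_closed [simp]: "v \<in> verts E \<Longrightarrow> cut v \<in> carrier L"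
  unfolding cut_def by simp

lemma \<eta>_cut:
  assumes "v \<in> breaking E H"
  shows "\<eta> (cut v) = oV v"
  using breaking_props(1)[OF assms] unfolding cut_def
  by (simp add: \<eta>.h_diff \<eta>_props \<eta>_gap[OF assms] qV_def Q.L.diff_add_cancel)

lemma \<eta>_vertex: "v \<in> verts E \<Longrightarrow> v \<notin> B \<Longrightarrow> \<eta> (lvtx R E v) = oV v"
  by (auto simp: \<eta>_props qV_def pV_def)

lemma \<eta>_edges:
  assumes "e \<in> arcs E" "head E e \<in> breaking E H"
  shows "\<eta> (ledg R E e \<otimes>\<^bsub>L\<^esub> cut (head E e)) = oP e"
    "\<eta> (ledg R E e \<otimes>\<^bsub>L\<^esub> brk (head E e)) = pP e"
    "\<eta> (cut (head E e) \<otimes>\<^bsub>L\<^esub> lgst R E e) = oG e"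
    "\<eta> (brk (head E e) \<otimes>\<^bsub>L\<^esub> lgst R E e) = pG e"
  using assms
  by (simp_all add: \<eta>.h_mult \<eta>_cut \<eta>_gap \<eta>_props qP_def qG_def Q.L.l_distr Q.L.r_distr op_mult)

lemma \<eta>_old_edges:
  assumes "e \<in> arcs E" "head E e \<notin> B"
  shows "\<eta> (ledg R E e) = oP e" "\<eta> (lgst R E e) = oG e"
  using assms by (auto simp: \<eta>_props qP_def qG_def pP_def pG_def)

section \<open>The ideal of the pair as a kernel\<close>

lemma I_genideal: "rng_ideal I L" "v \<in> H \<Longrightarrow> lvtx R E v \<in> I" "v \<in> S \<Longrightarrow> brk v \<in> I"
proof -
  have "lvtx R E ` H \<union> lbreak R E H ` S \<subseteq> carrier L"
    using H_verts S_breaking breaking_props(1) by (auto simp: lbreak_eq)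
  then show "rng_ideal I L"
    unfolding pair_ideal_def by (rule L.rng_genideal_ideal)
  show "v \<in> H \<Longrightarrow> lvtx R E v \<in> I" "v \<in> S \<Longrightarrow> brk v \<in> I"
    unfolding pair_ideal_def lbreak_eq by (rule L.rng_genideal_incl, simp)+
qed

sublocale I: rng_ideal I L
  by (rule I_genideal)

lemma I_least:
  assumes "rng_ideal J L" "\<And>v. v \<in> H \<Longrightarrow> lvtx R E v \<in> J" "\<And>v. v \<in> S \<Longrightarrow> brk v \<in> J"
  shows "I \<subseteq> J"
  unfolding pair_ideal_def lbreak_eq by (rule L.rng_genideal_least[OF assms(1)]) (use assms in auto)

lemma I_subset_ker: "I \<subseteq> \<eta>.ker"
proof (rule I_least[OF \<eta>.ker_ideal])
  show "lvtx R E v \<in> \<eta>.ker" if "v \<in> H" for v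
    using that H_verts breaking_props(2)[of v] by (auto simp: \<eta>.ker_def \<eta>_props qV_def oV_def pV_def)
  show "brk v \<in> \<eta>.ker" if "v \<in> S" for v
    using that S_breaking[OF that] breaking_props(1)[of v] by (auto simp: \<eta>.ker_def \<eta>_gap pV_def)
qed

text \<open>Multiplication by \<open>oV v\<close> removes the primed copy, and a nonzero multiple of
  the vertex \<open>Old v\<close> does not vanish.\<close>

lemma \<eta>_smult_vertex:
  assumes "v \<in> verts E" "v \<notin> H" "c \<noteq> 0"
  shows "c \<odot>\<^bsub>L\<^esub> lvtx R E v \<notin> \<eta>.ker"
proof
  assume "c \<odot>\<^bsub>L\<^esub> lvtx R E v \<in> \<eta>.ker"
  then have "c \<odot>\<^bsub>LQ\<^esub> qV v = \<zero>\<^bsub>LQ\<^esub>"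
    using assms by (simp add: \<eta>.ker_def \<eta>.h_smult \<eta>_props)
  then have "(c \<odot>\<^bsub>LQ\<^esub> qV v) \<otimes>\<^bsub>LQ\<^esub> oV v = \<zero>\<^bsub>LQ\<^esub>"
    by simp
  then have "c \<odot>\<^bsub>LQ\<^esub> oV v = \<zero>\<^bsub>LQ\<^esub>"
    by (simp add: Q.L.smult_mult_l qV_def Q.L.l_distr op_mult)
  then show False
    using Q.smult_vertex_nonzero[of "Old v" c] assms by (simp add: oV_def)
qed

lemma \<eta>_smult_gap:
  assumes "v \<in> B" "c \<noteq> 0"
  shows "c \<odot>\<^bsub>L\<^esub> brk v \<notin> \<eta>.ker"
proof
  assume "c \<odot>\<^bsub>L\<^esub> brk v \<in> \<eta>.ker"
  then have "c \<odot>\<^bsub>LQ\<^esub> pV v = \<zero>\<^bsub>LQ\<^esub>"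
    using assms breaking_props(1)[of v] by (simp add: \<eta>.ker_def \<eta>.h_smult \<eta>_gap)
  then show False
    using Q.smult_vertex_nonzero[of "Prime v" c] assms by (simp add: pV_def)
qed

lemma \<eta>_graded: "x \<in> F.Hom k \<Longrightarrow> \<eta> x \<in> Q.F.Hom k"
proof (rule F.hom_graded[OF \<eta>.alg_morphism_axioms])
  show "\<eta> (lvtx R E v) \<in> Q.F.Hom 0" if "v \<in> verts E" for v
    using that by (auto simp: \<eta>_props qV_def oV_def pV_def intro!: Q.F.Hom_add Q.F.V_Hom)
  show "\<eta> (ledg R E e) \<in> Q.F.Hom 1" if "e \<in> arcs E" for e
    using that by (auto simp: \<eta>_props qP_def oP_def pP_def intro!: Q.F.Hom_add Q.F.P_Hom)
  show "\<eta> (lgst R E e) \<in> Q.F.Hom (- 1)" if "e \<in> arcs E" for e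
    using that by (auto simp: \<eta>_props qG_def oG_def pG_def intro!: Q.F.Hom_add Q.F.G_Hom)
qed (auto intro: Q.F.Hom_add Q.F.Hom_smult Q.F.Hom_mult)

text \<open>The reduction in contrapositive form. It is applied to the kernel of
  \<open>\<eta>\<close> and to graded basic ideals, which differ only in the reason why the excluded
  multiples of vertices and gaps are not in J.\<close>

lemma homogeneous_in_I:
  assumes J: "rng_ideal J L" "I \<subseteq> J" "x \<in> F.Hom k" "x \<in> J"
    and V: "\<And>c v. c \<noteq> 0 \<Longrightarrow> v \<in> verts E \<Longrightarrow> v \<notin> H \<Longrightarrow> c \<odot>\<^bsub>L\<^esub> lvtx R E v \<notin> J"
    and G: "\<And>c v. c \<noteq> 0 \<Longrightarrow> v \<in> B \<Longrightarrow> c \<odot>\<^bsub>L\<^esub> brk v \<notin> J"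
  shows "x \<in> I"
proof (rule ccontr)
  assume "x \<notin> I"
  have "\<exists>c. c \<noteq> 0 \<and> ((\<exists>v\<in>verts E - H. c \<odot>\<^bsub>L\<^esub> lvtx R E v \<in> J) \<or> (\<exists>v\<in>B. c \<odot>\<^bsub>L\<^esub> brk v \<in> J))"
    by (rule F.homogeneous_reduction[where H = H and S = S, folded brk_def,
          OF I_genideal(1) J(1,2) _ _ J(3,4) \<open>x \<notin> I\<close>]) (erule I_genideal)+
  then obtain c where "c \<noteq> 0" "(\<exists>v\<in>verts E - H. c \<odot>\<^bsub>L\<^esub> lvtx R E v \<in> J) \<or> (\<exists>v\<in>B. c \<odot>\<^bsub>L\<^esub> brk v \<in> J)"
    by (elim exE conjE)
  then show False
    using V[of c] G[of c] by (elim disjE bexE) simp_all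
qed

text \<open>\<open>\<eta>\<close> preserves degrees, and homogeneous components are independent in
  the algebra of the quotient graph.\<close>

lemma components_in_ker:
  assumes "finite N" "\<And>k. f k \<in> F.Hom k" "finsum L f N \<in> \<eta>.ker" "l \<in> N"
  shows "f l \<in> \<eta>.ker"
proof -
  have c: "f \<in> N \<rightarrow> carrier L"
    using assms(2) F.Hom_in_carrier by (auto simp: Pi_def)
  have "finsum LQ (\<lambda>k. \<eta> (f k)) N = \<zero>\<^bsub>LQ\<^esub>"
    using assms(3) c by (simp add: \<eta>.ker_def \<eta>.h_finsum[symmetric])
  then have "\<eta> (f l) = \<zero>\<^bsub>LQ\<^esub>"
    by (rule Q.homogeneous_independent[OF assms(1) \<eta>_graded[OF assms(2)] _ assms(4)])
  then show ?thesis
    using F.Hom_in_carrier[OF assms(2)] by (simp add: \<eta>.ker_def)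
qed

lemma I_eq_ker: "I = \<eta>.ker"
proof
  show "\<eta>.ker \<subseteq> I"
  proof
    fix x assume x: "x \<in> \<eta>.ker"
    then have "x \<in> carrier L"
      by (simp add: \<eta>.ker_def)
    from finite_homogeneous_sum[OF this] obtain N f where
      f: "finite N" "\<forall>k. f k \<in> F.Hom k" "\<forall>k. k \<notin> N \<longrightarrow> f k = \<zero>\<^bsub>L\<^esub>" "x = finsum L f N"
      by (elim exE conjE)
    have "f k \<in> I" if k: "k \<in> N" for k
      by (rule homogeneous_in_I[OF \<eta>.ker_ideal I_subset_ker])
        (use f x k \<eta>_smult_vertex \<eta>_smult_gap in \<open>auto intro: components_in_ker\<close>)
    then show "x \<in> I"
      unfolding f(4) by (rule L.finsum_in_subgroup[OF I.is_additive_subgroup])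
  qed
qed (rule I_subset_ker)

text \<open>The preimages of the generators are the elements that define the canonical map; at a
  vertex of \<open>B\<close> the unprimed and the primed copy come from \<open>cut\<close> and
  \<open>brk\<close>.\<close>

lemma \<eta>_surj: "\<eta> ` carrier L = carrier LQ"
proof
  show "carrier LQ \<subseteq> \<eta> ` carrier L"
  proof (rule Q.leavitt_generated)
    fix v assume v: "v \<in> verts EQ"
    show "lvtx R EQ v \<in> \<eta> ` carrier L"
    proof (cases v)
      case (Old w)
      then have w: "w \<in> verts E" "w \<notin> H" "oV w = lvtx R EQ v"
        using v by (auto simp: oV_def)
      show ?thesis
      proof (cases "w \<in> B")
        case True
        then show ?thesis
          using w \<eta>_cut[of w] by (intro image_eqI[of _ _ "cut w"]) simp_all
      next
        case False
        then show ?thesis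
          using w \<eta>_vertex[of w] by (intro image_eqI[of _ _ "lvtx R E w"]) simp_all
      qed
    next
      case (Prime w)
      then show ?thesis
        using v \<eta>_gap[of w] breaking_props(1)[of w]
        by (intro image_eqI[of _ _ "brk w"]) (simp_all add: pV_def)
    qed
  next
    fix e assume e: "e \<in> arcs EQ"
    have "\<exists>x y. x \<in> carrier L \<and> y \<in> carrier L \<and> \<eta> x = ledg R EQ e \<and> \<eta> y = lgst R EQ e"
    proof (cases e)
      case (Old f)
      then have f: "f \<in> arcs E" "oP f = ledg R EQ e" "oG f = lgst R EQ e"
        using e by (auto simp: oP_def oG_def)
      show ?thesis
      proof (cases "head E f \<in> B")
        case True
        then show ?thesis
          using f \<eta>_edges[of f] by (intro exI[of _ "ledg R E f \<otimes>\<^bsub>L\<^esub> cut (head E f)"]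
              exI[of _ "cut (head E f) \<otimes>\<^bsub>L\<^esub> lgst R E f"]) simp
      next
        case False
        then show ?thesis
          using f \<eta>_old_edges[of f] by (intro exI[of _ "ledg R E f"] exI[of _ "lgst R E f"]) simp
      qed
    next
      case (Prime f)
      then have "f \<in> arcs E" "head E f \<in> B" "pP f = ledg R EQ e" "pG f = lgst R EQ e"
        using e by (auto simp: pP_def pG_def)
      then show ?thesis
        using \<eta>_edges[of f]
        by (intro exI[of _ "ledg R E f \<otimes>\<^bsub>L\<^esub> brk (head E f)"]
            exI[of _ "brk (head E f) \<otimes>\<^bsub>L\<^esub> lgst R E f"]) simp
    qed
    then obtain x y where xy: "x \<in> carrier L" "y \<in> carrier L" "\<eta> x = ledg R EQ e" "\<eta> y = lgst R EQ e"
      by (elim exE conjE)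
    show "ledg R EQ e \<in> \<eta> ` carrier L"
      using xy(1,3) by (metis image_eqI)
    show "lgst R EQ e \<in> \<eta> ` carrier L"
      using xy(2,4) by (metis image_eqI)
  next
    show "\<zero>\<^bsub>LQ\<^esub> \<in> \<eta> ` carrier L"
      by (rule image_eqI[of _ _ "\<zero>\<^bsub>L\<^esub>"]) simp_all
  next
    fix x y assume "x \<in> \<eta> ` carrier L" "y \<in> \<eta> ` carrier L"
    then show "x \<otimes>\<^bsub>LQ\<^esub> y \<in> \<eta> ` carrier L" "x \<oplus>\<^bsub>LQ\<^esub> y \<in> \<eta> ` carrier L"
      by (elim imageE; simp add: \<eta>.h_mult[symmetric] \<eta>.h_add[symmetric])+
  next
    fix c x assume "x \<in> \<eta> ` carrier L"
    then show "c \<odot>\<^bsub>LQ\<^esub> x \<in> \<eta> ` carrier L"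
      by (elim imageE; simp add: \<eta>.h_smult[symmetric])
  qed
qed auto

theorem quotient_isomorphism:
  "\<exists>\<theta>\<in>alg_hom LQ (alg_quot L I). canonical_on_generators R E H S \<theta> \<and>
    bij_betw \<theta> (carrier LQ) (carrier (alg_quot L I))"
proof -
  obtain \<theta> where \<theta>: "\<theta> \<in> alg_hom LQ (alg_quot L I)" "bij_betw \<theta> (carrier LQ) (carrier (alg_quot L I))"
    "\<forall>x\<in>carrier L. \<theta> (\<eta> x) = I +>\<^bsub>L\<^esub> x"
    using \<eta>.quotient_inverse[OF \<eta>_surj] unfolding I_eq_ker by (elim bexE conjE)
  \<comment> \<open>Each prescribed value, the class of \<open>x\<close> at \<open>y\<close>, thus
    reduces to \<open>\<eta> x = y\<close>.\<close>
  have \<theta>_eq: "\<theta> y = I +>\<^bsub>L\<^esub> x" if "x \<in> carrier L" "\<eta> x = y" for x y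
    using \<theta>(3) that by blast
  have "canonical_on_generators R E H S \<theta>"
    unfolding canonical_on_generators_def Let_def lbreak_eq cut_def[symmetric]
  proof (intro conjI ballI impI; (rule \<theta>_eq)?)
  qed (simp_all add: \<eta>_cut \<eta>_gap \<eta>_vertex \<eta>_edges \<eta>_old_edges op_defs breaking_props)
  then show ?thesis
    using \<theta> by (intro bexI[of _ \<theta>] conjI)
qed

end

section \<open>Graded basic ideals\<close>

context clpa
begin

text \<open>The decomposition is unique by \<open>homogeneous_independent\<close>, so being graded
  only asks that each element of J be a finite sum of homogeneous elements of J.\<close>

lemma graded_ideal_iff:
  "graded_ideal R E J \<longleftrightarrow> rng_ideal J L \<and> (\<forall>x\<in>J. \<exists>N f. finite N \<and> (\<forall>k. f k \<in> J \<inter> F.Hom k) \<and>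
    (\<forall>k. k \<notin> N \<longrightarrow> f k = \<zero>\<^bsub>L\<^esub>) \<and> x = finsum L f N)"
proof (cases "rng_ideal J L")
  case True
  interpret J: rng_ideal J L by fact
  let ?supp = "\<lambda>f :: int \<Rightarrow> _. {k. f k \<noteq> \<zero>\<^bsub>L\<^esub>}"
  let ?fams = "{f. (\<forall>k. f k \<in> J \<inter> F.Hom k) \<and> finite (?supp f)}"
  have closed: "f k \<in> carrier L" if "f \<in> ?fams" for f k
    using that F.Hom_in_carrier by blast
  have sum_supset: "finsum L f (?supp f) = finsum L f N"
    if "f \<in> ?fams" "finite N" "?supp f \<subseteq> N" for f N
    by (rule L.finsum_mono_neutral[symmetric]) (use that closed[OF that(1)] in auto)
  have sub: "additive_subgroup (J \<inter> F.Hom k) L" for k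
    using F.Hom_subgroup[of k] J.is_additive_subgroup
    by (intro additive_subgroupI L.add.subgroups_Inter_pair) (auto dest: additive_subgroup.a_subgroup)
  have inj: "inj_on (\<lambda>f. finsum L f (?supp f)) ?fams"
  proof (rule inj_onI)
    fix f g assume f: "f \<in> ?fams" and g: "g \<in> ?fams"
      and eq: "finsum L f (?supp f) = finsum L g (?supp g)"
    let ?N = "?supp f \<union> ?supp g"
    have N: "finite ?N"
      using f g by simp
    have fg: "f \<in> ?N \<rightarrow> carrier L" "g \<in> ?N \<rightarrow> carrier L"
      using closed[OF f] closed[OF g] by auto
    have "finsum L (\<lambda>k. f k \<ominus>\<^bsub>L\<^esub> g k) ?N = finsum L f ?N \<ominus>\<^bsub>L\<^esub> finsum L g ?N"
    proof -
      have "finsum L f ?N = finsum L (\<lambda>k. (f k \<ominus>\<^bsub>L\<^esub> g k) \<oplus>\<^bsub>L\<^esub> g k) ?N"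
        using closed[OF f] closed[OF g] by (intro L.finsum_cong') (auto simp: L.add_diff_cancel)
      also have "\<dots> = finsum L (\<lambda>k. f k \<ominus>\<^bsub>L\<^esub> g k) ?N \<oplus>\<^bsub>L\<^esub> finsum L g ?N"
        using closed[OF f] closed[OF g] by (intro L.finsum_addf) auto
      finally have "finsum L f ?N = finsum L (\<lambda>k. f k \<ominus>\<^bsub>L\<^esub> g k) ?N \<oplus>\<^bsub>L\<^esub> finsum L g ?N" .
      moreover have "finsum L (\<lambda>k. f k \<ominus>\<^bsub>L\<^esub> g k) ?N \<in> carrier L" "finsum L g ?N \<in> carrier L"
        using closed[OF f] closed[OF g] by (auto intro!: L.finsum_closed)
      ultimately show ?thesis
        by (simp add: L.diff_add_cancel)
    qed
    also have "\<dots> = \<zero>\<^bsub>L\<^esub>"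
      using eq sum_supset[OF f N] sum_supset[OF g N] fg
      by (subst L.minus_eq_zero_iff) (auto intro!: L.finsum_closed)
    finally have zero: "finsum L (\<lambda>k. f k \<ominus>\<^bsub>L\<^esub> g k) ?N = \<zero>\<^bsub>L\<^esub>" .
    show "f = g"
    proof
      fix k
      show "f k = g k"
      proof (cases "k \<in> ?N")
        case True
        have "f k \<ominus>\<^bsub>L\<^esub> g k = \<zero>\<^bsub>L\<^esub>"
          by (rule homogeneous_independent[OF N _ zero True]) (use f g in \<open>auto intro: F.Hom_diff\<close>)
        then show ?thesis
          using closed[OF f] closed[OF g] by (simp add: L.minus_eq_zero_iff)
      next
        case False
        then show ?thesis
          by simp
      qed
    qed
  qed
  have into: "finsum L f (?supp f) \<in> J" if "f \<in> ?fams" for f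
    using that by (intro L.finsum_in_subgroup[OF J.is_additive_subgroup]) auto
  show ?thesis
    unfolding graded_ideal_def internal_direct_sum_def homogeneous_eq
  proof (intro iffI conjI True allI sub)
    assume "rng_ideal J L \<and> (\<forall>k. additive_subgroup (J \<inter> F.Hom k) L) \<and>
      bij_betw (\<lambda>f. finsum L f (?supp f)) ?fams J"
    then have img: "(\<lambda>f. finsum L f (?supp f)) ` ?fams = J"
      by (simp add: bij_betw_def)
    show "\<forall>x\<in>J. \<exists>N f. finite N \<and> (\<forall>k. f k \<in> J \<inter> F.Hom k) \<and>
      (\<forall>k. k \<notin> N \<longrightarrow> f k = \<zero>\<^bsub>L\<^esub>) \<and> x = finsum L f N"
    proof
      fix x assume "x \<in> J"
      then have "x \<in> (\<lambda>f. finsum L f (?supp f)) ` ?fams"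
        unfolding img .
      then obtain f where "f \<in> ?fams" "x = finsum L f (?supp f)"
        by (elim imageE)
      then show "\<exists>N f. finite N \<and> (\<forall>k. f k \<in> J \<inter> F.Hom k) \<and>
          (\<forall>k. k \<notin> N \<longrightarrow> f k = \<zero>\<^bsub>L\<^esub>) \<and> x = finsum L f N"
        by (intro exI[of _ "?supp f"] exI[of _ f]) simp
    qed
  next
    assume *: "rng_ideal J L \<and> (\<forall>x\<in>J. \<exists>N f. finite N \<and> (\<forall>k. f k \<in> J \<inter> F.Hom k) \<and>
      (\<forall>k. k \<notin> N \<longrightarrow> f k = \<zero>\<^bsub>L\<^esub>) \<and> x = finsum L f N)"
    have "x \<in> (\<lambda>f. finsum L f (?supp f)) ` ?fams" if x: "x \<in> J" for x
    proof -
      obtain N f where f: "finite N" "\<forall>k. f k \<in> J \<inter> F.Hom k" "\<forall>k. k \<notin> N \<longrightarrow> f k = \<zero>\<^bsub>L\<^esub>" "x = finsum L f N"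
        using bspec[OF conjunct2[OF *] x] by (elim exE conjE)
      have s: "?supp f \<subseteq> N"
        using f(3) by auto
      then have "f \<in> ?fams"
        using f by (auto intro: finite_subset)
      then show ?thesis
        using f sum_supset[OF _ f(1) s] by (intro image_eqI[of _ _ f]) simp_all
    qed
    then show "bij_betw (\<lambda>f. finsum L f (?supp f)) ?fams J"
      unfolding bij_betw_def using inj into by (intro conjI subset_antisym image_subsetI subsetI)
  qed
qed (simp add: graded_ideal_def)

end

lemma (in lfam) gap_extend:
  assumes "v \<in> verts E" "finite W'" "W \<subseteq> W'" "W' \<subseteq> arcs E"
  shows "gap v W = gap v W' \<oplus> finsum A (\<lambda>e. P e \<otimes> G e) (W' - W)"
proof -
  let ?t = "\<lambda>e. P e \<otimes> G e"
  have c: "finsum A ?t W \<in> carrier A" "finsum A ?t (W' - W) \<in> carrier A"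
    using assms by (auto intro!: finsum_closed)
  have "finsum A ?t W' = finsum A ?t (W \<union> (W' - W))"
    using assms(3) by (simp add: Un_absorb1)
  also have "\<dots> = finsum A ?t W \<oplus> finsum A ?t (W' - W)"
    using assms by (intro finsum_Un_disjoint) (auto intro: finite_subset)
  finally have eq: "finsum A ?t W' = finsum A ?t W \<oplus> finsum A ?t (W' - W)" .
  show ?thesis
    unfolding gap_def eq using c assms(1) by (simp add: a_minus_def minus_add a_assoc l_neg)
qed

text \<open>\<open>G f\<close> annihilates every \<open>P e \<otimes> G e\<close> with
  \<open>e \<noteq> f\<close>, so only the vertex is left to be compressed by \<open>f\<close>. A
  gap that omits \<open>f\<close> therefore reaches the head of \<open>f\<close>.\<close>

lemma (in lfam) gap_conj:
  assumes "finite W" "W \<subseteq> arcs E" "f \<in> arcs E" "f \<notin> W"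
  shows "G f \<otimes> gap (tail E f) W \<otimes> P f = V (head E f)"
proof -
  have "G f \<otimes> finsum A (\<lambda>e. P e \<otimes> G e) W = finsum A (\<lambda>e. G f \<otimes> (P e \<otimes> G e)) W"
    using assms by (intro finsum_r_distr) auto
  also have "\<dots> = finsum A (\<lambda>e. \<zero>) W"
  proof (rule finsum_cong')
    fix e assume e: "e \<in> W"
    then have "G f \<otimes> (P e \<otimes> G e) = G f \<otimes> P e \<otimes> G e"
      using assms by (subst m_assoc) auto
    moreover have "e \<in> arcs E" "f \<noteq> e"
      using e assms by auto
    ultimately show "G f \<otimes> (P e \<otimes> G e) = \<zero>"
      using assms(3) by (simp add: G_P_neq)
  qed auto
  finally have "G f \<otimes> finsum A (\<lambda>e. P e \<otimes> G e) W = \<zero>"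
    by (simp add: finsum_zero)
  moreover have "finsum A (\<lambda>e. P e \<otimes> G e) W \<in> carrier A"
    using assms by (auto intro!: finsum_closed)
  ultimately show ?thesis
    unfolding gap_def using assms by (simp add: r_diff_distr G_V G_P)
qed

section \<open>Ideals of admissible pairs are graded and basic\<close>

context adm_pair
begin

lemma I_graded: "graded_ideal R E I"
  unfolding graded_ideal_iff
proof (intro conjI I_genideal ballI)
  fix x assume x: "x \<in> I"
  obtain N f where f: "finite N" "\<forall>k. f k \<in> F.Hom k" "\<forall>k. k \<notin> N \<longrightarrow> f k = \<zero>\<^bsub>L\<^esub>" "x = finsum L f N"
    using finite_homogeneous_sum[OF I.ideal_carrier[OF x]] by (elim exE conjE)
  have "f k \<in> I" for k
  proof (cases "k \<in> N")
    case True
    then show ?thesis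
      using components_in_ker[OF f(1) f(2)[rule_format], of k] x f(4) unfolding I_eq_ker by simp
  next
    case False
    then show ?thesis
      using f(3) by simp
  qed
  then show "\<exists>N f. finite N \<and> (\<forall>k. f k \<in> I \<inter> F.Hom k) \<and> (\<forall>k. k \<notin> N \<longrightarrow> f k = \<zero>\<^bsub>L\<^esub>) \<and> x = finsum L f N"
    using f by (intro exI[of _ N] exI[of _ f]) simp
qed

lemma edge_in_I: "e \<in> arcs E \<Longrightarrow> head E e \<in> H \<Longrightarrow> ledg R E e \<otimes>\<^bsub>L\<^esub> lgst R E e \<in> I"
  using I.I_r_closed[OF I.I_l_closed[OF I_genideal(2), of "head E e" "ledg R E e"], of "lgst R E e"]
  by (simp add: F.P_V)

lemma edge_sum_in_I: "W \<subseteq> arcs E \<Longrightarrow> head E ` W \<subseteq> H \<Longrightarrow> finsum L (\<lambda>e. ledg R E e \<otimes>\<^bsub>L\<^esub> lgst R E e) W \<in> I"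
  by (intro L.finsum_in_subgroup[OF I.is_additive_subgroup] edge_in_I) auto

lemma I_smult: "x \<in> I \<Longrightarrow> c \<odot>\<^bsub>L\<^esub> x \<in> I"
  unfolding I_eq_ker by (simp add: \<eta>.ker_def \<eta>.h_smult)

lemma vertex_in_I_iff: "v \<in> verts E \<Longrightarrow> lvtx R E v \<in> I \<longleftrightarrow> v \<in> H"
  using \<eta>_smult_vertex[of v 1] I_genideal(2) by (auto simp: I_eq_ker)

lemma brk_in_I_iff: "v \<in> breaking E H \<Longrightarrow> brk v \<in> I \<longleftrightarrow> v \<in> S"
  using \<eta>_smult_gap[of v 1] I_genideal(3) breaking_props(1)[of v] by (auto simp: I_eq_ker)

text \<open>Let \<open>v\<close> be outside H. If \<open>W\<close> omitted an exit \<open>f\<close>,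
  compressing by \<open>f\<close> would put a nonzero multiple of a vertex outside H into I. So
  \<open>W\<close> contains all exits, and modulo I the gap agrees with \<open>brk v\<close>, since
  the other edges of \<open>W\<close> end in H. The cases for \<open>brk v\<close> are a vertex
  without exits, where it is \<open>v\<close>; one with finitely many edges, where the gap of all
  edges is zero; and a breaking vertex, where \<open>c \<odot> brk v\<close> in I forces
  \<open>v\<close> into S.\<close>

lemma gap_in_I:
  assumes v: "v \<in> verts E" and W: "finite W" "W \<subseteq> out_arcs E v" and c: "c \<noteq> 0"
    and cI: "c \<odot>\<^bsub>L\<^esub> F.gap v W \<in> I"
  shows "F.gap v W \<in> I"
proof (cases "v \<in> H")
  case True
  then have "head E ` W \<subseteq> H"
    using W(2) H_hereditary by auto
  then show ?thesis
    unfolding F.gap_def using True W(2) by (intro I.ideal_diff I_genideal edge_sum_in_I) auto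
next
  case False
  have Warcs: "W \<subseteq> arcs E"
    using W(2) by auto
  have exits: "exits v \<subseteq> W"
  proof (rule ccontr)
    assume "\<not> exits v \<subseteq> W"
    then obtain f where f: "f \<in> arcs E" "tail E f = v" "head E f \<notin> H" "f \<notin> W"
      by auto
    have g: "F.gap v W \<in> carrier L"
      using v Warcs by (rule F.gap_closed)
    have "lgst R E f \<otimes>\<^bsub>L\<^esub> (c \<odot>\<^bsub>L\<^esub> F.gap v W) \<otimes>\<^bsub>L\<^esub> ledg R E f \<in> I"
      using cI f by (intro I.I_r_closed I.I_l_closed) auto
    also have "lgst R E f \<otimes>\<^bsub>L\<^esub> (c \<odot>\<^bsub>L\<^esub> F.gap v W) \<otimes>\<^bsub>L\<^esub> ledg R E f = c \<odot>\<^bsub>L\<^esub> lvtx R E (head E f)"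
      using f g F.gap_conj[OF W(1) Warcs f(1,4)] by (simp add: L.smult_mult_l L.smult_mult_r)
    finally show False
      using \<eta>_smult_vertex[of "head E f" c] f c by (simp add: I_eq_ker)
  qed
  have rest: "finsum L (\<lambda>e. ledg R E e \<otimes>\<^bsub>L\<^esub> lgst R E e) (W' - exits v) \<in> I" if "W' \<subseteq> out_arcs E v" for W'
    using that by (intro edge_sum_in_I) auto
  have mod: "F.gap v W' \<in> I \<longleftrightarrow> brk v \<in> I" if "finite W'" "exits v \<subseteq> W'" "W' \<subseteq> out_arcs E v" for W'
  proof -
    have "brk v = F.gap v W' \<oplus>\<^bsub>L\<^esub> finsum L (\<lambda>e. ledg R E e \<otimes>\<^bsub>L\<^esub> lgst R E e) (W' - exits v)"
      unfolding brk_def using that v by (intro F.gap_extend) auto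
    moreover have "F.gap v W' \<in> carrier L"
      using that(3) v by (intro F.gap_closed) auto
    ultimately show ?thesis
      using I.ideal_add_iff[OF rest[OF that(3)]] by simp
  qed
  have c_brk: "c \<odot>\<^bsub>L\<^esub> brk v \<in> I"
  proof -
    have "brk v = F.gap v W \<oplus>\<^bsub>L\<^esub> finsum L (\<lambda>e. ledg R E e \<otimes>\<^bsub>L\<^esub> lgst R E e) (W - exits v)"
      unfolding brk_def using W v exits by (intro F.gap_extend) auto
    moreover have "F.gap v W \<in> carrier L"
      using v Warcs by (rule F.gap_closed)
    moreover note I.ideal_carrier[OF rest[OF W(2)]]
    ultimately have "c \<odot>\<^bsub>L\<^esub> brk v = c \<odot>\<^bsub>L\<^esub> F.gap v W \<oplus>\<^bsub>L\<^esub>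
        c \<odot>\<^bsub>L\<^esub> finsum L (\<lambda>e. ledg R E e \<otimes>\<^bsub>L\<^esub> lgst R E e) (W - exits v)"
      by (simp add: L.smult_r_distr)
    then show ?thesis
      using cI I_smult[OF rest[OF W(2)]] by simp
  qed
  have "brk v \<in> I"
  proof (cases "exits v = {}")
    case True
    then have "brk v = lvtx R E v"
      unfolding brk_def True using v by (simp add: F.gap_def)
    then show ?thesis
      using c_brk \<eta>_smult_vertex[OF v False c] by (simp add: I_eq_ker)
  next
    case nonempty: False
    show ?thesis
    proof (cases "finite (out_arcs E v)")
      case True
      have "out_arcs E v \<noteq> {}"
        using nonempty by blast
      then have "F.gap v (out_arcs E v) = \<zero>\<^bsub>L\<^esub>"
        unfolding F.gap_def by (simp add: F.V_sum[OF v True, symmetric] v L.minus_eq_zero_iff)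
      then show ?thesis
        using mod[OF True _ order_refl, THEN iffD1] by (auto simp: subset_iff)
    next
      case infinite: False
      have "finite (exits v)"
        using exits W(1) by (rule finite_subset)
      then have "v \<in> breaking E H"
        using nonempty infinite v False unfolding breaking_def by simp
      then show ?thesis
        using c_brk \<eta>_smult_gap[of v c] c by (cases "v \<in> S") (simp_all add: I_genideal, simp add: I_eq_ker)
    qed
  qed
  then show ?thesis
    using mod[OF W(1) exits W(2)] by simp
qed

lemma I_basic: "basic_ideal R E I"
  unfolding basic_ideal_def
proof (intro conjI I_genideal allI impI; elim conjE)
  fix c x
  assume c: "c \<noteq> 0" "c \<odot>\<^bsub>L\<^esub> x \<in> I"
    and x: "(\<exists>v\<in>verts E. x = lvtx R E v) \<or> (\<exists>v\<in>verts E. \<exists>W. finite W \<and> W \<subseteq> out_arcs E v \<and> x = lgap R E v W)"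
  from x show "x \<in> I"
  proof (elim disjE bexE exE conjE)
    fix v assume v: "v \<in> verts E" "x = lvtx R E v"
    then show "x \<in> I"
      using c \<eta>_smult_vertex[of v c] I_genideal(2)[of v] by (cases "v \<in> H") (simp_all add: I_eq_ker)
  next
    fix v W assume "v \<in> verts E" "finite W" "W \<subseteq> out_arcs E v" "x = lgap R E v W"
    then show "x \<in> I"
      using gap_in_I[of v W c] c by (simp add: lgap_eq)
  qed
qed

end

section \<open>The correspondence between pairs and ideals\<close>

context clpa
begin

lemma adm_pairI: "admissible_pair E H S \<Longrightarrow> adm_pair E H S"
  by unfold_locales

text \<open>The ideal determines both sets: H consists of the vertices in it, and S of the breaking
  vertices \<open>v\<close> for which \<open>v^H\<close> is in it.\<close>

lemma pair_ideal_inj: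
  assumes "admissible_pair E H S" "admissible_pair E H' S'" "pair_ideal R E H S = pair_ideal R E H' S'"
  shows "H = H' \<and> S = S'"
proof -
  interpret p: adm_pair E R H S using assms(1) by (rule adm_pairI)
  interpret p': adm_pair E R H' S' using assms(2) by (rule adm_pairI)
  have H: "H = H'"
  proof (rule Set.set_eqI)
    fix v show "v \<in> H \<longleftrightarrow> v \<in> H'"
      using p.H_verts[of v] p'.H_verts[of v] p.vertex_in_I_iff[of v] p'.vertex_in_I_iff[of v] assms(3) by auto
  qed
  have "S = S'"
  proof (rule Set.set_eqI)
    fix v
    have "p.brk v = p'.brk v"
      by (simp only: p.brk_def p'.brk_def H)
    then show "v \<in> S \<longleftrightarrow> v \<in> S'"
      using p.S_breaking[of v] p'.S_breaking[of v] p.brk_in_I_iff[of v] p'.brk_in_I_iff[of v] assms(3) H by auto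
  qed
  with H show ?thesis ..
qed

text \<open>H and S are read off from J in the only way that \<open>pair_ideal_inj\<close> permits.
  For the inclusion of J in the ideal of the pair, gradedness leaves homogeneous elements, and
  basicness removes the coefficient from any multiple of a vertex or gap that the reduction would
  find.\<close>

lemma graded_basic_is_pair_ideal:
  assumes "graded_ideal R E J" "basic_ideal R E J"
  shows "\<exists>H S. admissible_pair E H S \<and> J = pair_ideal R E H S"
proof -
  interpret J: rng_ideal J L
    using assms(1) by (simp add: graded_ideal_def)
  define H where "H = {v \<in> verts E. lvtx R E v \<in> J}"
  define S where "S = {v \<in> breaking E H. lbreak R E H v \<in> J}"
  have "hereditary E H"
    unfolding hereditary_def
  proof (intro conjI ballI impI)
    fix e assume e: "e \<in> arcs E" "tail E e \<in> H"
    then have "lgst R E e \<otimes>\<^bsub>L\<^esub> lvtx R E (tail E e) \<otimes>\<^bsub>L\<^esub> ledg R E e \<in> J"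
      by (intro J.I_r_closed J.I_l_closed) (auto simp: H_def)
    then show "head E e \<in> H"
      using e by (simp add: H_def F.G_V F.G_P)
  qed (auto simp: H_def)
  moreover have "saturated E H"
    unfolding saturated_def
  proof (intro conjI ballI impI; (elim conjE)?)
    fix v assume v: "v \<in> verts E" "finite (out_arcs E v)" "out_arcs E v \<noteq> {}" "head E ` out_arcs E v \<subseteq> H"
    have "ledg R E e \<otimes>\<^bsub>L\<^esub> lgst R E e \<in> J" if e: "e \<in> out_arcs E v" for e
    proof -
      have "lvtx R E (head E e) \<in> J"
        using subsetD[OF v(4) imageI[OF e]] by (simp add: H_def)
      then have "ledg R E e \<otimes>\<^bsub>L\<^esub> lvtx R E (head E e) \<otimes>\<^bsub>L\<^esub> lgst R E e \<in> J"
        using e by (intro J.I_r_closed J.I_l_closed) auto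
      then show ?thesis
        using e by (simp add: F.P_V)
    qed
    then have "lvtx R E v \<in> J"
      unfolding F.V_sum[OF v(1-3)] by (rule L.finsum_in_subgroup[OF J.is_additive_subgroup])
    then show "v \<in> H"
      using v(1) by (simp add: H_def)
  qed (auto simp: H_def)
  ultimately have adm: "admissible_pair E H S"
    by (auto simp: admissible_pair_def S_def)
  interpret p: adm_pair E R H S using adm by (rule adm_pairI)
  have sub: "pair_ideal R E H S \<subseteq> J"
  proof (rule p.I_least[OF J.rng_ideal_axioms])
    show "lvtx R E v \<in> J" if "v \<in> H" for v
      using that by (simp add: H_def)
    show "p.brk v \<in> J" if "v \<in> S" for v
      using that by (simp add: S_def p.lbreak_eq)
  qed
  have hom: "x \<in> pair_ideal R E H S" if x: "x \<in> J" "x \<in> F.Hom k" for x k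
  proof (rule p.homogeneous_in_I[OF J.rng_ideal_axioms sub x(2,1)])
    show "c \<odot>\<^bsub>L\<^esub> lvtx R E v \<notin> J" if "c \<noteq> 0" "v \<in> verts E" "v \<notin> H" for c v
    proof
      assume "c \<odot>\<^bsub>L\<^esub> lvtx R E v \<in> J"
      then have "lvtx R E v \<in> J"
        using assms(2) that unfolding basic_ideal_def by blast
      then show False
        using that by (simp add: H_def)
    qed
    show "c \<odot>\<^bsub>L\<^esub> p.brk v \<notin> J" if "c \<noteq> 0" "v \<in> p.B" for c v
    proof
      assume cJ: "c \<odot>\<^bsub>L\<^esub> p.brk v \<in> J"
      have v: "v \<in> verts E" "finite (p.exits v)" "p.exits v \<subseteq> out_arcs E v"
        using that p.breaking_props[of v] by auto
      have "p.brk v = lgap R E v (p.exits v)"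
        by (simp only: p.brk_def lgap_eq)
      then have "p.brk v \<in> J"
        using assms(2) that(1) cJ v unfolding basic_ideal_def by blast
      then show False
        using that by (simp add: S_def p.lbreak_eq)
    qed
  qed
  have "J \<subseteq> pair_ideal R E H S"
  proof
    fix x assume x: "x \<in> J"
    obtain N f where f: "finite N" "\<forall>k. f k \<in> J \<inter> F.Hom k" "\<forall>k. k \<notin> N \<longrightarrow> f k = \<zero>\<^bsub>L\<^esub>" "x = finsum L f N"
      using bspec[OF conjunct2[OF assms(1)[unfolded graded_ideal_iff]] x] by (elim exE conjE)
    show "x \<in> pair_ideal R E H S"
      unfolding f(4) using f(2) hom by (intro L.finsum_in_subgroup[OF p.I.is_additive_subgroup]) auto
  qed
  with sub adm show ?thesis
    by (intro exI[of _ H] exI[of _ S]) auto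
qed

theorem pair_ideal_correspondence:
  "bij_betw (\<lambda>(H, S). pair_ideal R E H S) {(H, S). admissible_pair E H S}
    {I. graded_ideal R E I \<and> basic_ideal R E I}"
  unfolding bij_betw_def
proof (intro conjI subset_antisym subsetI)
  show "inj_on (\<lambda>(H, S). pair_ideal R E H S) {(H, S). admissible_pair E H S}"
    using pair_ideal_inj by (intro inj_onI) auto
next
  fix J assume "J \<in> (\<lambda>(H, S). pair_ideal R E H S) ` {(H, S). admissible_pair E H S}"
  then obtain H S where adm: "admissible_pair E H S" and J: "J = pair_ideal R E H S"
    by auto
  interpret p: adm_pair E R H S using adm by (rule adm_pairI)
  show "J \<in> {I. graded_ideal R E I \<and> basic_ideal R E I}"
    unfolding J using p.I_graded p.I_basic by simp
next
  fix J assume "J \<in> {I. graded_ideal R E I \<and> basic_ideal R E I}"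
  then obtain H S where "admissible_pair E H S" "J = pair_ideal R E H S"
    using graded_basic_is_pair_ideal by blast
  then show "J \<in> (\<lambda>(H, S). pair_ideal R E H S) ` {(H, S). admissible_pair E H S}"
    by (intro image_eqI[of _ _ "(H, S)"]) auto
qed

end

section \<open>Morita contexts from corners\<close>

context rng
begin

lemma span_rng_ideal:
  assumes "M \<subseteq> carrier A" "\<And>x m. x \<in> carrier A \<Longrightarrow> m \<in> M \<Longrightarrow> x \<otimes> m \<in> M"
    "\<And>x m. x \<in> carrier A \<Longrightarrow> m \<in> M \<Longrightarrow> m \<otimes> x \<in> M"
  shows "rng_ideal (add_span A M) A"
proof -
  interpret s: additive_subgroup "add_span A M" A
    by (rule add_span_subgroup) fact
  have incl: "m \<in> add_span A M" if "m \<in> M" for m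
    using that by (rule generate.incl)
  have l: "x \<otimes> y \<in> add_span A M" if x: "x \<in> carrier A" and y: "y \<in> add_span A M" for x y
  proof -
    have "add_span A M \<subseteq> {y \<in> carrier A. x \<otimes> y \<in> add_span A M}"
      by (rule add_span_least, rule add_subgroupI)
        (use x assms incl in \<open>auto simp: r_distr r_minus\<close>)
    then show ?thesis
      using y by blast
  qed
  have r: "y \<otimes> x \<in> add_span A M" if x: "x \<in> carrier A" and y: "y \<in> add_span A M" for x y
  proof -
    have "add_span A M \<subseteq> {y \<in> carrier A. y \<otimes> x \<in> add_span A M}"
      by (rule add_span_least, rule add_subgroupI)
        (use x assms incl in \<open>auto simp: l_distr l_minus\<close>)
    then show ?thesis
      using y by blast
  qed
  show ?thesis
    by (intro rng_ideal.intro s.additive_subgroup_axioms rng_axioms rng_ideal_axioms.intro l r)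
qed

text \<open>The join of commuting idempotents \<open>u\<close> and \<open>f\<close> is
  \<open>u + f - u f\<close>. That \<open>u\<close> commutes with all of X, and not only with F,
  lets the induction take the next element, and later turns a left unit into a right unit.\<close>

lemma commuting_idempotents_join:
  assumes "X \<subseteq> carrier A" "\<And>e. e \<in> X \<Longrightarrow> e \<otimes> e = e" "\<And>e f. e \<in> X \<Longrightarrow> f \<in> X \<Longrightarrow> e \<otimes> f = f \<otimes> e"
    and I: "rng_ideal I A" "X \<subseteq> I"
    and "finite F" "F \<subseteq> X"
  shows "\<exists>u\<in>I. u \<otimes> u = u \<and> (\<forall>e\<in>X. u \<otimes> e = e \<otimes> u) \<and> (\<forall>e\<in>F. u \<otimes> e = e)"
  using assms(6,7)
proof (induction F rule: finite_induct)
  case empty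
  have "\<zero> \<in> I"
    using I(1) by (intro additive_subgroup.zero_closed rng_ideal.axioms(1))
  then show ?case
    using assms(1) by (intro bexI[of _ \<zero>]) auto
next
  case (insert f F)
  interpret I: rng_ideal I A by fact
  obtain u where u: "u \<in> I" "u \<otimes> u = u" "\<forall>e\<in>X. u \<otimes> e = e \<otimes> u" "\<forall>e\<in>F. u \<otimes> e = e"
    using insert by auto
  have c: "u \<in> carrier A" "f \<in> carrier A" "f \<in> X"
    using u(1) I.ideal_carrier insert assms(1) by auto
  have ff: "f \<otimes> f = f" and uf: "f \<otimes> u = u \<otimes> f"
    using c(3) assms(2) u(3) by auto
  \<comment> \<open>The part of \<open>f\<close> orthogonal to \<open>u\<close>, so that
    \<open>u \<oplus> w\<close> is the join.\<close>
  define w where "w = f \<ominus> u \<otimes> f"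
  have wI: "w \<in> I"
    unfolding w_def using c insert.prems I(2) by (intro I.ideal_diff I.I_l_closed) auto
  have cw: "w \<in> carrier A"
    using wI by (rule I.ideal_carrier)
  have uw: "u \<otimes> w = \<zero>"
    unfolding w_def using c u(2) by (simp add: r_diff_distr m_assoc[symmetric] minus_eq_zero_iff)
  have wu: "w \<otimes> u = \<zero>"
    unfolding w_def using c u(2) uf by (simp add: l_diff_distr m_assoc) (simp add: m_assoc[symmetric] u(2) minus_eq_zero_iff)
  have wf: "w \<otimes> f = w"
    unfolding w_def using c ff by (simp add: l_diff_distr m_assoc)
  have ww: "w \<otimes> w = w"
  proof -
    have "w \<otimes> w = w \<otimes> f \<ominus> w \<otimes> (u \<otimes> f)"
      using c cw by (subst (2) w_def) (simp add: r_diff_distr)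
    also have "w \<otimes> (u \<otimes> f) = \<zero>"
      using c cw wu by (simp add: m_assoc[symmetric])
    finally show ?thesis
      using cw wf by simp
  qed
  have comm: "w \<otimes> e = e \<otimes> w" if e: "e \<in> X" for e
  proof -
    have ce: "e \<in> carrier A" "u \<otimes> e = e \<otimes> u" "f \<otimes> e = e \<otimes> f"
      using e assms(1) u(3) assms(3)[OF c(3) e] by auto
    have "u \<otimes> f \<otimes> e = u \<otimes> (f \<otimes> e)"
      using c ce(1) by (simp add: m_assoc)
    also have "\<dots> = u \<otimes> e \<otimes> f"
      unfolding ce(3) using c ce(1) by (simp add: m_assoc)
    also have "\<dots> = e \<otimes> (u \<otimes> f)"
      unfolding ce(2) using c ce(1) by (simp add: m_assoc)
    finally show ?thesis
      unfolding w_def using c ce by (simp add: l_diff_distr r_diff_distr)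
  qed
  show ?case
  proof (intro bexI[of _ "u \<oplus> w"] conjI ballI)
    show "u \<oplus> w \<in> I"
      using u(1) wI by simp
    show "(u \<oplus> w) \<otimes> (u \<oplus> w) = u \<oplus> w"
      using c cw by (simp add: l_distr r_distr u(2) uw wu ww)
    show "(u \<oplus> w) \<otimes> e = e \<otimes> (u \<oplus> w)" if "e \<in> X" for e
      using that u(3) comm c cw assms(1) by (auto simp: l_distr r_distr)
    show "(u \<oplus> w) \<otimes> e = e" if e: "e \<in> insert f F" for e
    proof (cases "e = f")
      case True
      have "u \<otimes> f \<oplus> (f \<ominus> u \<otimes> f) = f"
        using c by (subst a_comm) (simp_all add: add_diff_cancel)
      then show ?thesis
        using True c cw wf by (simp add: l_distr) (simp add: w_def)
    next
      case False
      then have e: "e \<in> F" "e \<in> X" "e \<in> carrier A"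
        using e insert.prems assms(1) by auto
      have "u \<otimes> f \<otimes> e = u \<otimes> (e \<otimes> f)"
        using c e assms(3)[OF c(3) e(2), symmetric] by (simp add: m_assoc)
      also have "\<dots> = e \<otimes> f"
        using c e u(4) by (simp add: m_assoc[symmetric])
      finally have "w \<otimes> e = \<zero>"
        unfolding w_def using c e assms(3)[OF c(3) e(2)] by (simp add: l_diff_distr minus_eq_zero_iff)
      then show ?thesis
        using c cw e u(4) by (simp add: l_distr)
    qed
  qed
qed

end

lemma (in rng_ideal) restricted_rng: "rng (A\<lparr>carrier := I\<rparr>)"
proof (intro rng.intro rng_axioms.intro abelian_groupI)
  fix x assume x: "x \<in> carrier (A\<lparr>carrier := I\<rparr>)"
  then show "\<exists>y\<in>carrier (A\<lparr>carrier := I\<rparr>). y \<oplus>\<^bsub>A\<lparr>carrier := I\<rparr>\<^esub> x = \<zero>\<^bsub>A\<lparr>carrier := I\<rparr>\<^esub>"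
    by (intro bexI[of _ "\<ominus> x"]) (simp_all add: ideal_carrier l_neg)
qed (simp_all add: ideal_carrier a_ac m_assoc l_distr r_distr I_l_closed)

lemma (in rng_ideal) restricted_add_span:
  "S \<subseteq> I \<Longrightarrow> add_span (A\<lparr>carrier := I\<rparr>) S = add_span A S"
  using add.generate_consistent[OF _ a_subgroup, of S] by simp

text \<open>The condition \<open>D A D \<subseteq> D\<close> on the image D of \<open>\<rho>\<close>
  replaces the corner \<open>e A e\<close> at an idempotent \<open>e\<close>. The bimodules that
  link the generated ideal with B are \<open>A D\<close> and \<open>D A\<close>.\<close>

locale morita_corner = A: rng A + B: rng B
  for A :: "('a, 'x) ring_scheme" (structure) and B :: "('b, 'y) ring_scheme" +
  fixes \<rho> :: "'b \<Rightarrow> 'a"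
  assumes \<rho>_closed: "b \<in> carrier B \<Longrightarrow> \<rho> b \<in> carrier A"
    and \<rho>_add: "b \<in> carrier B \<Longrightarrow> b' \<in> carrier B \<Longrightarrow> \<rho> (b \<oplus>\<^bsub>B\<^esub> b') = \<rho> b \<oplus> \<rho> b'"
    and \<rho>_mult: "b \<in> carrier B \<Longrightarrow> b' \<in> carrier B \<Longrightarrow> \<rho> (b \<otimes>\<^bsub>B\<^esub> b') = \<rho> b \<otimes> \<rho> b'"
    and \<rho>_inj: "inj_on \<rho> (carrier B)"
    and B_units: "has_local_units B"
    and corner: "b \<in> carrier B \<Longrightarrow> x \<in> carrier A \<Longrightarrow> b' \<in> carrier B \<Longrightarrow> \<rho> b \<otimes> x \<otimes> \<rho> b' \<in> \<rho> ` carrier B"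
begin

abbreviation "D \<equiv> \<rho> ` carrier B"
abbreviation "I \<equiv> rng_genideal A D"
abbreviation "AI \<equiv> A\<lparr>carrier := I\<rparr>"

lemma D_carrier: "D \<subseteq> carrier A"
  using \<rho>_closed by auto

sublocale I: rng_ideal I A
  using D_carrier by (rule A.rng_genideal_ideal)

lemma D_I: "d \<in> D \<Longrightarrow> d \<in> I"
  by (rule A.rng_genideal_incl)

lemma D_closed [simp]: "d \<in> D \<Longrightarrow> d \<in> carrier A"
  using D_carrier by blast

lemma D_unit:
  assumes "d \<in> D" "d' \<in> D"
  shows "\<exists>u\<in>D. u \<otimes> d = d \<and> d \<otimes> u = d \<and> u \<otimes> d' = d' \<and> d' \<otimes> u = d'"
proof -
  obtain b b' where b: "b \<in> carrier B" "d = \<rho> b" "b' \<in> carrier B" "d' = \<rho> b'"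
    using assms by auto
  have fin: "finite {b, b'} \<and> {b, b'} \<subseteq> carrier B"
    using b by simp
  obtain u where u: "u \<in> carrier B" "\<forall>x\<in>{b, b'}. u \<otimes>\<^bsub>B\<^esub> x = x \<and> x \<otimes>\<^bsub>B\<^esub> u = x"
    using B_units[unfolded has_local_units_def, rule_format, OF fin] by (elim bexE conjE)
  then show ?thesis
    using b by (intro bexI[of _ "\<rho> u"]) (simp_all add: \<rho>_mult[symmetric])
qed

text \<open>This is \<open>A D\<close>, and \<open>N\<close> is \<open>D A\<close>. Because D has
  local units, each element is fixed by a single \<open>d\<close>, and a common unit of two such
  \<open>d\<close> fixes the sum; so no span has to be taken.\<close>

definition "M = {m \<in> carrier A. \<exists>d\<in>D. m \<otimes> d = m}"
definition "N = {n \<in> carrier A. \<exists>d\<in>D. d \<otimes> n = n}"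

lemma M_closed [simp]: "m \<in> M \<Longrightarrow> m \<in> carrier A"
  by (simp add: M_def)

lemma N_closed [simp]: "n \<in> N \<Longrightarrow> n \<in> carrier A"
  by (simp add: N_def)

lemma M_unit: "m \<in> M \<Longrightarrow> \<exists>d\<in>D. m \<otimes> d = m"
  unfolding M_def mem_Collect_eq by (rule conjunct2)

lemma N_unit: "n \<in> N \<Longrightarrow> \<exists>d\<in>D. d \<otimes> n = n"
  unfolding N_def mem_Collect_eq by (rule conjunct2)

lemma M_intro: "m \<in> carrier A \<Longrightarrow> d \<in> D \<Longrightarrow> m \<otimes> d = m \<Longrightarrow> m \<in> M"
  unfolding M_def by (intro CollectI conjI bexI)

lemma N_intro: "n \<in> carrier A \<Longrightarrow> d \<in> D \<Longrightarrow> d \<otimes> n = n \<Longrightarrow> n \<in> N"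
  unfolding N_def by (intro CollectI conjI bexI)

lemma M_I:
  assumes "m \<in> M"
  shows "m \<in> I"
proof -
  obtain d where "d \<in> D" "m \<otimes> d = m"
    using M_unit[OF assms] by (elim bexE)
  then show ?thesis
    using I.I_l_closed[OF D_I, of d m] assms by simp
qed

lemma N_I:
  assumes "n \<in> N"
  shows "n \<in> I"
proof -
  obtain d where "d \<in> D" "d \<otimes> n = n"
    using N_unit[OF assms] by (elim bexE)
  then show ?thesis
    using I.I_r_closed[OF D_I, of d n] assms by simp
qed

lemma D_M:
  assumes "d \<in> D"
  shows "d \<in> M"
proof -
  obtain u where "u \<in> D" "d \<otimes> u = d"
    using D_unit[OF assms assms] by (elim bexE conjE)
  then show ?thesis
    using assms by (intro M_intro[of _ u] D_closed)
qed

lemma D_N: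
  assumes "d \<in> D"
  shows "d \<in> N"
proof -
  obtain u where "u \<in> D" "u \<otimes> d = d"
    using D_unit[OF assms assms] by (elim bexE conjE)
  then show ?thesis
    using assms by (intro N_intro[of _ u] D_closed)
qed

lemma D_zero: "\<zero> \<in> D"
proof -
  have "\<rho> \<zero>\<^bsub>B\<^esub> \<oplus> \<rho> \<zero>\<^bsub>B\<^esub> = \<rho> \<zero>\<^bsub>B\<^esub>"
    using \<rho>_add[of "\<zero>\<^bsub>B\<^esub>" "\<zero>\<^bsub>B\<^esub>"] by simp
  then have "\<rho> \<zero>\<^bsub>B\<^esub> = \<zero>"
    using \<rho>_closed[of "\<zero>\<^bsub>B\<^esub>"] A.add.l_cancel_one by simp
  then show ?thesis
    by (intro image_eqI[of _ _ "\<zero>\<^bsub>B\<^esub>"]) simp_all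
qed

lemma M_add:
  assumes "m \<in> M" "m' \<in> M"
  shows "m \<oplus> m' \<in> M"
proof -
  obtain d d' where d: "d \<in> D" "m \<otimes> d = m" "d' \<in> D" "m' \<otimes> d' = m'"
    using assms M_unit by meson
  obtain u where u: "u \<in> D" "d \<otimes> u = d" "d' \<otimes> u = d'"
    using D_unit[OF d(1,3)] by blast
  have "m \<otimes> u = m" "m' \<otimes> u = m'"
    using A.m_assoc[of m d u] A.m_assoc[of m' d' u] assms d u by simp_all
  then show ?thesis
    using assms u by (intro M_intro[of _ u]) (simp_all add: A.l_distr)
qed

lemma N_add:
  assumes "n \<in> N" "n' \<in> N"
  shows "n \<oplus> n' \<in> N"
proof -
  obtain d d' where d: "d \<in> D" "d \<otimes> n = n" "d' \<in> D" "d' \<otimes> n' = n'"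
    using assms N_unit by meson
  obtain u where u: "u \<in> D" "u \<otimes> d = d" "u \<otimes> d' = d'"
    using D_unit[OF d(1,3)] by blast
  have "u \<otimes> n = n" "u \<otimes> n' = n'"
    using A.m_assoc[of u d n] A.m_assoc[of u d' n'] assms d u by simp_all
  then show ?thesis
    using assms u by (intro N_intro[of _ u]) (simp_all add: A.r_distr)
qed

lemma M_l_mult:
  assumes "x \<in> carrier A" "m \<in> M"
  shows "x \<otimes> m \<in> M"
proof -
  obtain d where "d \<in> D" "m \<otimes> d = m"
    using M_unit[OF assms(2)] by (elim bexE)
  then show ?thesis
    using assms by (intro M_intro[of _ d]) (simp_all add: A.m_assoc)
qed

lemma N_r_mult:
  assumes "x \<in> carrier A" "n \<in> N"
  shows "n \<otimes> x \<in> N"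
proof -
  obtain d where "d \<in> D" "d \<otimes> n = n"
    using N_unit[OF assms(2)] by (elim bexE)
  then show ?thesis
    using assms by (intro N_intro[of _ d]) (simp_all add: A.m_assoc[symmetric])
qed

lemma M_a_inv:
  assumes "m \<in> M"
  shows "\<ominus> m \<in> M"
proof -
  obtain d where "d \<in> D" "m \<otimes> d = m"
    using M_unit[OF assms] by (elim bexE)
  then show ?thesis
    using assms by (intro M_intro[of _ d]) (simp_all add: A.l_minus)
qed

lemma N_a_inv:
  assumes "n \<in> N"
  shows "\<ominus> n \<in> N"
proof -
  obtain d where "d \<in> D" "d \<otimes> n = n"
    using N_unit[OF assms] by (elim bexE)
  then show ?thesis
    using assms by (intro N_intro[of _ d]) (simp_all add: A.r_minus)
qed

lemma M_r_mult:
  assumes "m \<in> M" "d \<in> D"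
  shows "m \<otimes> d \<in> M"
proof -
  obtain u where "u \<in> D" "d \<otimes> u = d"
    using D_unit[OF assms(2,2)] by (elim bexE conjE)
  then show ?thesis
    using assms by (intro M_intro[of _ u]) (simp_all add: A.m_assoc)
qed

lemma N_l_mult:
  assumes "n \<in> N" "d \<in> D"
  shows "d \<otimes> n \<in> N"
proof -
  obtain u where "u \<in> D" "u \<otimes> d = d"
    using D_unit[OF assms(2,2)] by (elim bexE conjE)
  then show ?thesis
    using assms by (intro N_intro[of _ u]) (simp_all add: A.m_assoc[symmetric])
qed

text \<open>With \<open>d\<close> fixing \<open>n\<close> and \<open>d'\<close> fixing
  \<open>m\<close>, the product \<open>n m = d n m d'\<close> lies in \<open>D A D\<close>, hence in
  D.\<close>

lemma N_M_D:
  assumes "n \<in> N" "m \<in> M"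
  shows "n \<otimes> m \<in> D"
proof -
  obtain d d' where d: "d \<in> D" "d \<otimes> n = n" "d' \<in> D" "m \<otimes> d' = m"
    using M_unit[OF assms(2)] N_unit[OF assms(1)] by blast
  have "d \<otimes> (n \<otimes> m) \<otimes> d' = n \<otimes> m"
    using d assms A.m_assoc[of d n m] A.m_assoc[of n m d'] by simp
  moreover have "d \<otimes> (n \<otimes> m) \<otimes> d' \<in> D"
    using d(1,3) corner[of _ "n \<otimes> m"] assms by (elim imageE) simp
  ultimately show ?thesis
    by simp
qed

text \<open>The span is an ideal because M absorbs factors on the left and N on the right. It
  contains D because \<open>d = d u\<close> for some \<open>u\<close> in D.\<close>

lemma span_M_N: "add_span A {m \<otimes> n | m n. m \<in> M \<and> n \<in> N} = I" (is "add_span A ?S = I")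
proof
  have S: "?S \<subseteq> carrier A" "?S \<subseteq> I"
    using I.I_r_closed[OF M_I] by auto
  show "add_span A ?S \<subseteq> I"
    using I.is_additive_subgroup S(2) by (rule A.add_span_least)
  have "rng_ideal (add_span A ?S) A"
  proof (rule A.span_rng_ideal[OF S(1)])
    fix x y assume x: "x \<in> carrier A" and "y \<in> ?S"
    then obtain m n where y: "y = m \<otimes> n" "m \<in> M" "n \<in> N"
      by blast
    have "x \<otimes> y = (x \<otimes> m) \<otimes> n" "y \<otimes> x = m \<otimes> (n \<otimes> x)"
      using x y by (simp_all add: A.m_assoc)
    then show "x \<otimes> y \<in> ?S" "y \<otimes> x \<in> ?S"
      using M_l_mult[OF x y(2)] N_r_mult[OF x y(3)] y by blast+
  qed
  moreover have "D \<subseteq> add_span A ?S"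
  proof
    fix d assume d: "d \<in> D"
    then obtain u where "u \<in> D" "d \<otimes> u = d"
      using D_unit[OF d d] by blast
    then have "d \<in> ?S"
      using D_M[OF d] D_N[of u] by (intro CollectI exI[of _ d] exI[of _ u]) simp
    then show "d \<in> add_span A ?S"
      by (rule generate.incl)
  qed
  ultimately show "I \<subseteq> add_span A ?S"
    by (rule A.rng_genideal_least)
qed

section \<open>The Morita context of a corner\<close>

definition \<rho>i where "\<rho>i = inv_into (carrier B) \<rho>"

lemma \<rho>i: "b \<in> carrier B \<Longrightarrow> \<rho>i (\<rho> b) = b"
  unfolding \<rho>i_def using \<rho>_inj by (rule inv_into_f_f)

lemma \<rho>i_simps:
  "d \<in> D \<Longrightarrow> \<rho>i d \<in> carrier B" "d \<in> D \<Longrightarrow> \<rho> (\<rho>i d) = d"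
  "d \<in> D \<Longrightarrow> d' \<in> D \<Longrightarrow> \<rho>i (d \<oplus> d') = \<rho>i d \<oplus>\<^bsub>B\<^esub> \<rho>i d'"
  "d \<in> D \<Longrightarrow> b \<in> carrier B \<Longrightarrow> \<rho>i (\<rho> b \<otimes> d) = b \<otimes>\<^bsub>B\<^esub> \<rho>i d"
  "d \<in> D \<Longrightarrow> b \<in> carrier B \<Longrightarrow> \<rho>i (d \<otimes> \<rho> b) = \<rho>i d \<otimes>\<^bsub>B\<^esub> b"
  by (auto simp: \<rho>i \<rho>_add[symmetric] \<rho>_mult[symmetric])

text \<open>Morita contexts have to live on the type \<open>('a + 'b) list\<close>, whence the encoding.\<close>

definition enc :: "'a \<Rightarrow> ('a + 'b) list" where "enc x = [Inl x]"
definition dec :: "('a + 'b) list \<Rightarrow> 'a" where "dec xs = projl (hd xs)"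

lemma dec_enc [simp]: "dec (enc x) = x"
  by (simp add: enc_def dec_def)

lemma enc_eq [simp]: "enc x = enc y \<longleftrightarrow> x = y"
  by (simp add: enc_def)

definition MM :: "('a, 'b, ('a + 'b) list) bimodule" where
  "MM = \<lparr>carrier = enc ` M, mult = undefined, one = undefined, zero = enc \<zero>,
    add = (\<lambda>x y. enc (dec x \<oplus> dec y)), smult = (\<lambda>a x. enc (a \<otimes> dec x)),
    rsmult = (\<lambda>x b. enc (dec x \<otimes> \<rho> b))\<rparr>"

definition NN :: "('b, 'a, ('a + 'b) list) bimodule" where
  "NN = \<lparr>carrier = enc ` N, mult = undefined, one = undefined, zero = enc \<zero>,
    add = (\<lambda>x y. enc (dec x \<oplus> dec y)), smult = (\<lambda>b x. enc (\<rho> b \<otimes> dec x)),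
    rsmult = (\<lambda>x a. enc (dec x \<otimes> a))\<rparr>"

lemma MM_simps [simp]: "carrier MM = enc ` M" "\<zero>\<^bsub>MM\<^esub> = enc \<zero>" "x \<oplus>\<^bsub>MM\<^esub> y = enc (dec x \<oplus> dec y)"
  "a \<odot>\<^bsub>MM\<^esub> x = enc (a \<otimes> dec x)" "x \<boxdot>\<^bsub>MM\<^esub> b = enc (dec x \<otimes> \<rho> b)"
  by (simp_all add: MM_def)

lemma NN_simps [simp]: "carrier NN = enc ` N" "\<zero>\<^bsub>NN\<^esub> = enc \<zero>" "x \<oplus>\<^bsub>NN\<^esub> y = enc (dec x \<oplus> dec y)"
  "b \<odot>\<^bsub>NN\<^esub> x = enc (\<rho> b \<otimes> dec x)" "x \<boxdot>\<^bsub>NN\<^esub> a = enc (dec x \<otimes> a)"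
  by (simp_all add: NN_def)

lemma MM_group: "abelian_group MM"
proof (rule abelian_groupI)
  fix x assume "x \<in> carrier MM"
  then obtain m where m: "m \<in> M" "x = enc m" by auto
  then show "\<exists>y\<in>carrier MM. y \<oplus>\<^bsub>MM\<^esub> x = \<zero>\<^bsub>MM\<^esub>"
    by (intro bexI[of _ "enc (\<ominus> m)"]) (auto simp: A.l_neg M_a_inv)
qed (auto simp: M_add A.a_ac D_M[OF D_zero])

lemma NN_group: "abelian_group NN"
proof (rule abelian_groupI)
  fix x assume "x \<in> carrier NN"
  then obtain n where n: "n \<in> N" "x = enc n" by auto
  then show "\<exists>y\<in>carrier NN. y \<oplus>\<^bsub>NN\<^esub> x = \<zero>\<^bsub>NN\<^esub>"
    by (intro bexI[of _ "enc (\<ominus> n)"]) (auto simp: A.l_neg N_a_inv)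
qed (auto simp: N_add A.a_ac D_N[OF D_zero])

lemma MM_bimodule: "unital_bimodule AI B MM"
proof (intro unital_bimodule.intro unital_bimodule_axioms.intro I.restricted_rng B.rng_axioms MM_group)
  interpret MM: abelian_group MM by (rule MM_group)
  show "add_span MM {a \<odot>\<^bsub>MM\<^esub> m |a m. a \<in> carrier AI \<and> m \<in> carrier MM} = carrier MM"
  proof (rule MM.add_span_eq_carrier)
    show "carrier MM \<subseteq> {a \<odot>\<^bsub>MM\<^esub> m |a m. a \<in> carrier AI \<and> m \<in> carrier MM}"
    proof
      fix x assume "x \<in> carrier MM"
      then obtain m where m: "m \<in> M" "x = enc m" by auto
      \<comment> \<open>M lies in I, so \<open>m = m d\<close> exhibits \<open>m\<close> as the ring
        element \<open>m\<close> acting on the module element \<open>d\<close>.\<close>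
      obtain d where "d \<in> D" "m \<otimes> d = m"
        using M_unit[OF m(1)] by blast
      then show "x \<in> {a \<odot>\<^bsub>MM\<^esub> m |a m. a \<in> carrier AI \<and> m \<in> carrier MM}"
        using m M_I[OF m(1)] D_M[of d] by (intro CollectI exI[of _ m] exI[of _ "enc d"]) simp
    qed
  qed (auto simp: M_l_mult I.ideal_carrier)
  show "add_span MM {m \<boxdot>\<^bsub>MM\<^esub> b |b m. b \<in> carrier B \<and> m \<in> carrier MM} = carrier MM"
  proof (rule MM.add_span_eq_carrier)
    show "carrier MM \<subseteq> {m \<boxdot>\<^bsub>MM\<^esub> b |b m. b \<in> carrier B \<and> m \<in> carrier MM}"
    proof
      fix x assume "x \<in> carrier MM"
      then obtain m where m: "m \<in> M" "x = enc m" by auto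
      obtain b where "b \<in> carrier B" "m \<otimes> \<rho> b = m"
        using M_unit[OF m(1)] by blast
      then show "x \<in> {m \<boxdot>\<^bsub>MM\<^esub> b |b m. b \<in> carrier B \<and> m \<in> carrier MM}"
        using m by (intro CollectI exI[of _ b] exI[of _ "enc m"]) simp
    qed
  qed (auto simp: M_r_mult)
qed (auto simp: M_l_mult M_r_mult I.ideal_carrier \<rho>_closed \<rho>_add \<rho>_mult A.l_distr A.r_distr A.m_assoc)

lemma NN_bimodule: "unital_bimodule B AI NN"
proof (intro unital_bimodule.intro unital_bimodule_axioms.intro I.restricted_rng B.rng_axioms NN_group)
  interpret NN: abelian_group NN by (rule NN_group)
  show "add_span NN {b \<odot>\<^bsub>NN\<^esub> n |b n. b \<in> carrier B \<and> n \<in> carrier NN} = carrier NN"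
  proof (rule NN.add_span_eq_carrier)
    show "carrier NN \<subseteq> {b \<odot>\<^bsub>NN\<^esub> n |b n. b \<in> carrier B \<and> n \<in> carrier NN}"
    proof
      fix x assume "x \<in> carrier NN"
      then obtain n where n: "n \<in> N" "x = enc n" by auto
      obtain b where "b \<in> carrier B" "\<rho> b \<otimes> n = n"
        using N_unit[OF n(1)] by blast
      then show "x \<in> {b \<odot>\<^bsub>NN\<^esub> n |b n. b \<in> carrier B \<and> n \<in> carrier NN}"
        using n by (intro CollectI exI[of _ b] exI[of _ "enc n"]) simp
    qed
  qed (auto simp: N_l_mult)
  show "add_span NN {n \<boxdot>\<^bsub>NN\<^esub> a |a n. a \<in> carrier AI \<and> n \<in> carrier NN} = carrier NN"
  proof (rule NN.add_span_eq_carrier)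
    show "carrier NN \<subseteq> {n \<boxdot>\<^bsub>NN\<^esub> a |a n. a \<in> carrier AI \<and> n \<in> carrier NN}"
    proof
      fix x assume "x \<in> carrier NN"
      then obtain n where n: "n \<in> N" "x = enc n" by auto
      obtain d where "d \<in> D" "d \<otimes> n = n"
        using N_unit[OF n(1)] by blast
      then show "x \<in> {n \<boxdot>\<^bsub>NN\<^esub> a |a n. a \<in> carrier AI \<and> n \<in> carrier NN}"
        using n N_I[OF n(1)] D_N[of d] by (intro CollectI exI[of _ n] exI[of _ "enc d"]) simp
    qed
  qed (auto simp: N_r_mult I.ideal_carrier)
qed (auto simp: N_l_mult N_r_mult I.ideal_carrier \<rho>_closed \<rho>_add \<rho>_mult A.l_distr A.r_distr A.m_assoc)

text \<open>Both pairings are multiplication in A; \<open>\<psi>\<close> is carried back to B, which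
  is possible because products from N and M lie in D.\<close>

definition \<phi> where "\<phi> x y = dec x \<otimes> dec y"
definition \<psi> where "\<psi> y x = \<rho>i (dec y \<otimes> dec x)"

lemma pairing_MN: "surj_pairing AI B MM NN \<phi>"
proof -
  have "{\<phi> m n |m n. m \<in> carrier MM \<and> n \<in> carrier NN} = {m \<otimes> n | m n. m \<in> M \<and> n \<in> N}"
    unfolding \<phi>_def by force
  moreover have "{m \<otimes> n | m n. m \<in> M \<and> n \<in> N} \<subseteq> I"
    using I.I_r_closed[OF M_I] by auto
  ultimately have "add_span AI {\<phi> m n |m n. m \<in> carrier MM \<and> n \<in> carrier NN} = carrier AI"
    using span_M_N I.restricted_add_span by simp
  then show ?thesis
    unfolding surj_pairing_def
    by (intro conjI) (auto simp: \<phi>_def I.I_r_closed M_I I.ideal_carrier \<rho>_closed A.l_distr A.r_distr A.m_assoc)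
qed

lemma pairing_NM: "surj_pairing B AI NN MM \<psi>"
proof -
  let ?S = "{\<psi> n m |n m. n \<in> carrier NN \<and> m \<in> carrier MM}"
  have "add_span B ?S = carrier B"
  proof (rule B.add_span_eq_carrier)
    show "carrier B \<subseteq> ?S"
    proof
      fix b assume b: "b \<in> carrier B"
      then obtain u where u: "u \<in> D" "u \<otimes> \<rho> b = \<rho> b"
        using D_unit[of "\<rho> b" "\<rho> b"] by blast
      then show "b \<in> ?S"
        using b D_N[of u] D_M[of "\<rho> b"]
        by (intro CollectI exI[of _ "enc u"] exI[of _ "enc (\<rho> b)"]) (simp add: \<psi>_def \<rho>i)
    qed
  qed (auto simp: \<psi>_def \<rho>i_simps N_M_D)
  moreover have "\<rho>i (n \<otimes> (m \<otimes> \<rho> b)) = \<rho>i (n \<otimes> m) \<otimes>\<^bsub>B\<^esub> b" if "n \<in> N" "m \<in> M" "b \<in> carrier B" for n m b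
    using that by (simp add: A.m_assoc[symmetric] \<rho>_closed \<rho>i_simps N_M_D)
  ultimately show ?thesis
    unfolding surj_pairing_def
    by (intro conjI) (auto simp: \<psi>_def \<rho>i_simps N_M_D I.ideal_carrier \<rho>_closed A.l_distr A.r_distr A.m_assoc)
qed

theorem morita_equivalent_corner:
  assumes "has_local_units AI"
  shows "morita_equivalent AI B"
proof -
  have "surj_morita_context AI B MM NN \<phi> \<psi>"
    unfolding surj_morita_context_def
    by (intro conjI MM_bimodule NN_bimodule pairing_MN pairing_NM)
      (auto simp: \<phi>_def \<psi>_def \<rho>i_simps N_M_D A.m_assoc)
  then show ?thesis
    unfolding morita_equivalent_def
    by (intro conjI I.restricted_rng B.rng_axioms B_units assms exI)
qed

end

section \<open>Ideals of hereditary pairs\<close>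

context lfam
begin

text \<open>For \<open>e\<close> in W the vertex and the sum both contribute \<open>P e\<close> and
  cancel. The gap acts on edges like the vertex \<open>v\<close> with the edges in W
  deleted.\<close>

lemma gap_P:
  assumes "v \<in> verts E" "finite W" "W \<subseteq> out_arcs E v" "e \<in> arcs E"
  shows "gap v W \<otimes> P e = (if tail E e = v \<and> e \<notin> W then P e else \<zero>)"
proof -
  have W: "W \<subseteq> arcs E"
    using assms(3) by auto
  have "finsum A (\<lambda>f. P f \<otimes> G f) W \<otimes> P e = finsum A (\<lambda>f. P f \<otimes> G f \<otimes> P e) W"
    using assms W by (intro finsum_l_distr) auto
  also have "\<dots> = finsum A (\<lambda>f. if f = e then P e else \<zero>) W"
    using assms W by (intro finsum_cong') (auto simp: m_assoc G_P_if P_V)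
  also have "\<dots> = (if e \<in> W then P e else \<zero>)"
  proof (cases "e \<in> W")
    case True
    then have "finsum A (\<lambda>f. if f = e then P e else \<zero>) W = (if e = e then P e else \<zero>)"
      using assms by (intro finsum_singleton_support) auto
    then show ?thesis
      using True by simp
  next
    case False
    then have "finsum A (\<lambda>f. if f = e then P e else \<zero>) W = finsum A (\<lambda>f. \<zero>) W"
      by (intro finsum_cong') auto
    then show ?thesis
      using False by (simp add: finsum_zero)
  qed
  finally have eq: "finsum A (\<lambda>f. P f \<otimes> G f) W \<otimes> P e = (if e \<in> W then P e else \<zero>)" .
  have "finsum A (\<lambda>f. P f \<otimes> G f) W \<in> carrier A"
    using W by (auto intro!: finsum_closed)
  then have "gap v W \<otimes> P e = (if v = tail E e then P e else \<zero>) \<ominus> (if e \<in> W then P e else \<zero>)"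
    unfolding gap_def using assms eq by (simp add: l_diff_distr V_P_if)
  also have "\<dots> = (if tail E e = v \<and> e \<notin> W then P e else \<zero>)"
    using assms(3,4) by (auto simp: minus_eq_zero_iff)
  finally show ?thesis .
qed

lemma G_gap:
  assumes "v \<in> verts E" "finite W" "W \<subseteq> out_arcs E v" "e \<in> arcs E"
  shows "G e \<otimes> gap v W = (if tail E e = v \<and> e \<notin> W then G e else \<zero>)"
proof -
  have W: "W \<subseteq> arcs E"
    using assms(3) by auto
  have "G e \<otimes> finsum A (\<lambda>f. P f \<otimes> G f) W = finsum A (\<lambda>f. G e \<otimes> (P f \<otimes> G f)) W"
    using assms W by (intro finsum_r_distr) auto
  also have "\<dots> = finsum A (\<lambda>f. if f = e then G e else \<zero>) W"
  proof (rule finsum_cong')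
    fix f assume "f \<in> W"
    then have "G e \<otimes> (P f \<otimes> G f) = (G e \<otimes> P f) \<otimes> G f" "f \<in> arcs E"
      using assms W by (auto simp: m_assoc)
    then show "G e \<otimes> (P f \<otimes> G f) = (if f = e then G e else \<zero>)"
      using assms by (auto simp: G_P_if V_G)
  qed (use assms in auto)
  also have "\<dots> = (if e \<in> W then G e else \<zero>)"
  proof (cases "e \<in> W")
    case True
    then have "finsum A (\<lambda>f. if f = e then G e else \<zero>) W = (if e = e then G e else \<zero>)"
      using assms by (intro finsum_singleton_support) auto
    then show ?thesis
      using True by simp
  next
    case False
    then have "finsum A (\<lambda>f. if f = e then G e else \<zero>) W = finsum A (\<lambda>f. \<zero>) W"
      by (intro finsum_cong') auto
    then show ?thesis
      using False by (simp add: finsum_zero)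
  qed
  finally have eq: "G e \<otimes> finsum A (\<lambda>f. P f \<otimes> G f) W = (if e \<in> W then G e else \<zero>)" .
  have "finsum A (\<lambda>f. P f \<otimes> G f) W \<in> carrier A"
    using W by (auto intro!: finsum_closed)
  then have "G e \<otimes> gap v W = (if v = tail E e then G e else \<zero>) \<ominus> (if e \<in> W then G e else \<zero>)"
    unfolding gap_def using assms eq by (simp add: r_diff_distr G_V_if)
  also have "\<dots> = (if tail E e = v \<and> e \<notin> W then G e else \<zero>)"
    using assms(3,4) by (auto simp: minus_eq_zero_iff)
  finally show ?thesis .
qed

lemma V_gap:
  assumes "v \<in> verts E" "W \<subseteq> out_arcs E v" "finite W"
  shows "V v \<otimes> gap v W = gap v W"
proof -
  have "V v \<otimes> finsum A (\<lambda>e. P e \<otimes> G e) W = finsum A (\<lambda>e. V v \<otimes> (P e \<otimes> G e)) W"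
    using assms by (intro finsum_r_distr) auto
  also have "\<dots> = finsum A (\<lambda>e. P e \<otimes> G e) W"
    using assms by (intro finsum_cong') (auto simp: m_assoc[symmetric] V_P_if subset_iff)
  finally show ?thesis
    unfolding gap_def using assms by (subst r_diff_distr) (auto simp: V_idem intro!: finsum_closed)
qed

lemma gap_V:
  assumes "v \<in> verts E" "W \<subseteq> out_arcs E v" "finite W"
  shows "gap v W \<otimes> V v = gap v W"
proof -
  have "finsum A (\<lambda>e. P e \<otimes> G e) W \<otimes> V v = finsum A (\<lambda>e. P e \<otimes> G e \<otimes> V v) W"
    using assms by (intro finsum_l_distr) auto
  also have "\<dots> = finsum A (\<lambda>e. P e \<otimes> G e) W"
    using assms by (intro finsum_cong') (auto simp: m_assoc G_V_if subset_iff)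
  finally show ?thesis
    unfolding gap_def using assms by (subst l_diff_distr) (auto simp: V_idem intro!: finsum_closed)
qed

lemma gap_idem:
  assumes "v \<in> verts E" "W \<subseteq> out_arcs E v" "finite W"
  shows "gap v W \<otimes> gap v W = gap v W"
proof -
  have W: "W \<subseteq> arcs E"
    using assms by auto
  have g: "gap v W \<in> carrier A"
    using assms(1) W by (rule gap_closed)
  have "gap v W \<otimes> gap v W = gap v W \<ominus> finsum A (\<lambda>e. gap v W \<otimes> P e \<otimes> G e) W"
    using assms W by (intro gap_P_Real g gap_V) auto
  also have "finsum A (\<lambda>e. gap v W \<otimes> P e \<otimes> G e) W = finsum A (\<lambda>e. \<zero>) W"
    using assms W by (intro finsum_cong') (auto simp: gap_P)
  finally show ?thesis
    using g by (simp add: finsum_zero)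
qed

lemma gap_Hom:
  assumes "v \<in> verts E" "W \<subseteq> arcs E"
  shows "gap v W \<in> Hom 0"
  unfolding gap_def
proof (intro Hom_diff V_Hom assms finsum_in_subgroup[OF Hom_subgroup])
  fix e assume "e \<in> W"
  then show "P e \<otimes> G e \<in> Hom 0"
    using Hom_mult[OF P_Hom G_Hom, of e e] assms by auto
qed

text \<open>Edges cancel in pairs as long as the two paths agree, and at the first difference the
  product is zero. In a nonzero product one of the paths must therefore run out.\<close>

lemma walk_comparison:
  assumes "awalk u p w" "awalk v q w'" "sp u p \<otimes> pp v q \<noteq> \<zero>"
  shows "u = v \<and> (\<exists>r. q = p @ r \<or> p = q @ r)"
  using assms
proof (induction p arbitrary: u v q)
  case Nil
  then have "V u \<otimes> pp v q = (if u = v then pp v q else \<zero>)"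
    by (intro V_absorb_l) (auto simp: V_pp awalk_verts_ends awalk_Nil_iff)
  then show ?case
    using Nil by (cases "u = v") auto
next
  case (Cons e p)
  then have e: "e \<in> arcs E" "u = tail E e" "awalk (head E e) p w"
    by (auto simp: awalk_Cons_iff)
  show ?case
  proof (cases q)
    case Nil
    then have v: "v \<in> verts E"
      using Cons.prems by (auto simp: awalk_Nil_iff)
    have "sp u (e # p) \<otimes> pp v q = sp (head E e) p \<otimes> (G e \<otimes> V v)"
      using Nil e v by (simp add: m_assoc)
    then have "v = u"
      using Cons.prems(3) e v by (cases "v = tail E e") (simp_all add: G_V_if)
    then show ?thesis
      using Nil by simp
  next
    case (Cons f q')
    then have f: "f \<in> arcs E" "v = tail E f" "awalk (head E f) q' w'"
      using Cons.prems by (auto simp: awalk_Cons_iff)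
    have eq: "sp u (e # p) \<otimes> pp v q = sp (head E e) p \<otimes> (G e \<otimes> P f \<otimes> pp (head E f) q')"
      using Cons e f by (simp add: m_assoc)
    then have ef: "e = f"
      using Cons.prems(3) e f by (cases "e = f") (simp_all add: G_P_neq)
    then have "sp (head E e) p \<otimes> pp (head E e) q' \<noteq> \<zero>"
      using Cons.prems(3) eq e f by (simp add: G_P V_pp)
    then have "\<exists>r. q' = p @ r \<or> p = q' @ r"
      using Cons.IH[OF e(3)] f(3) ef by blast
    then show ?thesis
      using ef e f Cons by auto
  qed
qed

end

text \<open>The common setting of (1) and (2): S empty gives (1), and the two sets of an admissible
  pair give (2).\<close>

locale hered_pair = clpa E R for E :: "('v, 'e) pre_digraph" and R :: "'r::comm_ring_1 itself" +
  fixes X S :: "'v set"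
  assumes hereditary: "hereditary E X" and S_breaking: "S \<subseteq> breaking E X"
begin

abbreviation "EP \<equiv> pair_graph E X S"
abbreviation "LP \<equiv> leavitt R EP"
abbreviation "exits v \<equiv> {e \<in> out_arcs E v. head E e \<notin> X}"

text \<open>The image of the vertex \<open>v\<close> of \<open>pair_graph\<close>. Of the edges
  leaving \<open>v\<close> in S that graph keeps only those into X, so the exits have to be
  subtracted.\<close>

definition pV where "pV v = (if v \<in> X then lvtx R E v else F.gap v (exits v))"

lemma X_verts: "v \<in> X \<Longrightarrow> v \<in> verts E"
  using hereditary by (auto simp: hereditary_def)

lemma X_closed: "e \<in> arcs E \<Longrightarrow> tail E e \<in> X \<Longrightarrow> head E e \<in> X"
  using hereditary by (auto simp: hereditary_def)

lemma S_props: "v \<in> S \<Longrightarrow> v \<in> verts E" "v \<in> S \<Longrightarrow> v \<notin> X" "v \<in> S \<Longrightarrow> infinite (out_arcs E v)"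
  "v \<in> S \<Longrightarrow> finite (exits v)"
  using S_breaking unfolding breaking_def by (simp_all add: subset_iff)

lemma XS_verts: "v \<in> X \<union> S \<Longrightarrow> v \<in> verts E"
  using X_verts S_props by blast

lemma exits_subset: "exits v \<subseteq> out_arcs E v"
  by blast

lemma EP_simps [simp]: "verts EP = X \<union> S" "tail EP = tail E" "head EP = head E"
  by (simp_all add: pair_graph_def)

lemma EP_arcs: "e \<in> arcs EP \<longleftrightarrow> e \<in> arcs E \<and> tail E e \<in> X \<union> S \<and> head E e \<in> X"
  using X_closed by (auto simp: pair_graph_def)

lemma EP_arc_props:
  assumes "e \<in> arcs EP"
  shows "e \<in> arcs E" "tail E e \<in> X \<or> tail E e \<in> S" "head E e \<in> X"
  using assms by (simp_all add: EP_arcs)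

sublocale P: clpa EP R
proof
  show "tail EP e \<in> verts EP" "head EP e \<in> verts EP" if "e \<in> arcs EP" for e
    using that by (auto simp: EP_arcs)
  show "countable (arcs EP)"
    by (rule countable_subset[OF _ countable_arcs]) (auto simp: EP_arcs)
qed

lemma pV_X: "v \<in> X \<Longrightarrow> pV v = lvtx R E v"
  by (simp add: pV_def)

lemma pV_closed [simp]: "v \<in> X \<union> S \<Longrightarrow> pV v \<in> carrier L"
  using XS_verts[of v] by (auto simp: pV_def intro!: F.gap_closed)

lemma V_pV: "v \<in> X \<union> S \<Longrightarrow> lvtx R E v \<otimes>\<^bsub>L\<^esub> pV v = pV v"
  using XS_verts[of v] F.V_gap[OF XS_verts exits_subset S_props(4), of v] by (auto simp: pV_def F.V_idem)

lemma pV_V: "v \<in> X \<union> S \<Longrightarrow> pV v \<otimes>\<^bsub>L\<^esub> lvtx R E v = pV v"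
  using XS_verts[of v] F.gap_V[OF XS_verts exits_subset S_props(4), of v] by (auto simp: pV_def F.V_idem)

lemma V_pV_if: "w \<in> verts E \<Longrightarrow> v \<in> X \<union> S \<Longrightarrow> lvtx R E w \<otimes>\<^bsub>L\<^esub> pV v = (if w = v then pV v else \<zero>\<^bsub>L\<^esub>)"
  by (rule F.V_absorb_l) (simp_all add: V_pV XS_verts)

lemma pV_V_if: "w \<in> verts E \<Longrightarrow> v \<in> X \<union> S \<Longrightarrow> pV v \<otimes>\<^bsub>L\<^esub> lvtx R E w = (if w = v then pV v else \<zero>\<^bsub>L\<^esub>)"
  by (rule F.V_absorb_r) (simp_all add: pV_V XS_verts)

lemma pV_pV:
  assumes "v \<in> X \<union> S" "w \<in> X \<union> S"
  shows "pV v \<otimes>\<^bsub>L\<^esub> pV w = (if v = w then pV v else \<zero>\<^bsub>L\<^esub>)"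
proof (cases "v = w")
  case True
  then show ?thesis
    using assms XS_verts[of v] F.gap_idem[OF XS_verts exits_subset S_props(4), of v]
    by (auto simp: pV_def F.V_idem)
next
  case False
  have "pV v \<otimes>\<^bsub>L\<^esub> pV w = pV v \<otimes>\<^bsub>L\<^esub> (lvtx R E w \<otimes>\<^bsub>L\<^esub> pV w)"
    using assms by (simp add: V_pV)
  also have "\<dots> = pV v \<otimes>\<^bsub>L\<^esub> lvtx R E w \<otimes>\<^bsub>L\<^esub> pV w"
    using assms XS_verts by (simp add: L.m_assoc)
  finally show ?thesis
    using assms XS_verts[of w] False by (simp add: pV_V_if)
qed

text \<open>\<open>pV v\<close> keeps exactly the edges of \<open>pair_graph\<close> that leave
  \<open>v\<close>: for \<open>v\<close> in X by heredity, for \<open>v\<close> in S because the gap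
  removes the exits.\<close>

lemma pV_P:
  assumes "v \<in> X \<union> S" "e \<in> arcs E"
  shows "pV v \<otimes>\<^bsub>L\<^esub> ledg R E e = (if tail E e = v \<and> e \<in> arcs EP then ledg R E e else \<zero>\<^bsub>L\<^esub>)"
proof (cases "v \<in> X")
  case True
  then show ?thesis
    using assms X_closed[of e] XS_verts[of v] by (auto simp: pV_def EP_arcs F.V_P_if)
next
  case False
  then have v: "v \<in> S" using assms by auto
  have "(tail E e = v \<and> e \<notin> exits v) \<longleftrightarrow> (tail E e = v \<and> e \<in> arcs EP)"
    using assms v by (auto simp: EP_arcs)
  then show ?thesis
    using F.gap_P[OF S_props(1)[OF v] S_props(4)[OF v] exits_subset assms(2)] False
    unfolding pV_def by simp
qed

lemma G_pV:
  assumes "v \<in> X \<union> S" "e \<in> arcs E"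
  shows "lgst R E e \<otimes>\<^bsub>L\<^esub> pV v = (if tail E e = v \<and> e \<in> arcs EP then lgst R E e else \<zero>\<^bsub>L\<^esub>)"
proof (cases "v \<in> X")
  case True
  then show ?thesis
    using assms X_closed[of e] XS_verts[of v] by (auto simp: pV_def EP_arcs F.G_V_if)
next
  case False
  then have v: "v \<in> S" using assms by auto
  have "(tail E e = v \<and> e \<notin> exits v) \<longleftrightarrow> (tail E e = v \<and> e \<in> arcs EP)"
    using assms v by (auto simp: EP_arcs)
  then show ?thesis
    using F.G_gap[OF S_props(1)[OF v] S_props(4)[OF v] exits_subset assms(2)] False
    unfolding pV_def by simp
qed

text \<open>At \<open>v\<close> in X the same edges leave \<open>v\<close> in both graphs. At
  \<open>v\<close> in S there is no sum relation to check, as infinitely many edges lead from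
  \<open>v\<close> into X.\<close>

lemma pair_family: "lfam L EP pV (ledg R E) (lgst R E)"
proof (intro lfam.intro L.ralg_axioms P.wf_digraph_axioms lfam_axioms.intro)
  fix v assume v: "v \<in> verts EP" "finite (out_arcs EP v)" "out_arcs EP v \<noteq> {}"
  show "pV v = finsum L (\<lambda>e. ledg R E e \<otimes>\<^bsub>L\<^esub> lgst R E e) (out_arcs EP v)"
  proof (cases "v \<in> X")
    case True
    then have "out_arcs EP v = out_arcs E v"
      using X_closed by (auto simp: out_arcs_def EP_arcs)
    then show ?thesis
      using F.V_sum[of v] v True X_verts[of v] by (simp add: pV_def)
  next
    case False
    then have "v \<in> S" using v by simp
    moreover have "out_arcs E v \<subseteq> out_arcs EP v \<union> exits v"
      using \<open>v \<in> S\<close> by (auto simp: EP_arcs)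
    ultimately show ?thesis
      using v(2) S_props(3,4)[of v] finite_subset by blast
  qed
qed (simp_all add: EP_arc_props pV_pV pV_P G_pV pV_X F.P_V F.V_G F.G_P F.G_P_neq)

definition \<rho> where
  "\<rho> = (SOME h. h \<in> alg_hom LP L \<and> (\<forall>v\<in>verts EP. h (lvtx R EP v) = pV v) \<and>
    (\<forall>e\<in>arcs EP. h (ledg R EP e) = ledg R E e) \<and> (\<forall>e\<in>arcs EP. h (lgst R EP e) = lgst R E e))"

lemma \<rho>_props: "\<rho> \<in> alg_hom LP L" "v \<in> X \<union> S \<Longrightarrow> \<rho> (lvtx R EP v) = pV v"
  "e \<in> arcs EP \<Longrightarrow> \<rho> (ledg R EP e) = ledg R E e" "e \<in> arcs EP \<Longrightarrow> \<rho> (lgst R EP e) = lgst R E e"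
proof -
  have "\<exists>h. h \<in> alg_hom LP L \<and> (\<forall>v\<in>verts EP. h (lvtx R EP v) = pV v) \<and>
    (\<forall>e\<in>arcs EP. h (ledg R EP e) = ledg R E e) \<and> (\<forall>e\<in>arcs EP. h (lgst R EP e) = lgst R E e)"
    using lfam.leavitt_universal[OF pair_family, of R] by (simp only: Bex_def)
  from someI_ex[OF this, folded \<rho>_def]
  show "\<rho> \<in> alg_hom LP L" "v \<in> X \<union> S \<Longrightarrow> \<rho> (lvtx R EP v) = pV v"
    "e \<in> arcs EP \<Longrightarrow> \<rho> (ledg R EP e) = ledg R E e" "e \<in> arcs EP \<Longrightarrow> \<rho> (lgst R EP e) = lgst R E e"
    by simp_all
qed

sublocale \<rho>: alg_morphism LP L \<rho>
  using P.L.ralg_axioms L.ralg_axioms \<rho>_props(1) by (rule alg_morphismI)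

lemma \<rho>_graded: "x \<in> P.F.Hom k \<Longrightarrow> \<rho> x \<in> F.Hom k"
proof (rule P.F.hom_graded[OF \<rho>.alg_morphism_axioms])
  show "\<rho> (lvtx R EP v) \<in> F.Hom 0" if "v \<in> verts EP" for v
    using that X_verts[of v] S_props(1)[of v] by (auto simp: \<rho>_props pV_def intro!: F.V_Hom F.gap_Hom)
  show "\<rho> (ledg R EP e) \<in> F.Hom 1" if "e \<in> arcs EP" for e
    using that F.P_Hom[of e] by (simp add: \<rho>_props EP_arcs)
  show "\<rho> (lgst R EP e) \<in> F.Hom (- 1)" if "e \<in> arcs EP" for e
    using that F.G_Hom[of e] by (simp add: \<rho>_props EP_arcs)
qed (auto intro: F.Hom_add F.Hom_smult F.Hom_mult)

text \<open>For \<open>v\<close> in S some edge leads from \<open>v\<close> into X, and compressing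
  by it turns \<open>c \<odot> pV v\<close> into \<open>c\<close> times its head.\<close>

lemma smult_pV_nonzero:
  assumes "v \<in> X \<union> S" "c \<noteq> 0"
  shows "c \<odot>\<^bsub>L\<^esub> pV v \<noteq> \<zero>\<^bsub>L\<^esub>"
proof (cases "v \<in> X")
  case True
  then show ?thesis
    using smult_vertex_nonzero[of v c] X_verts[of v] assms(2) by (simp add: pV_def)
next
  case False
  then have v: "v \<in> S" using assms by auto
  have "\<not> out_arcs E v \<subseteq> exits v"
    using S_props(3,4)[OF v] finite_subset by blast
  then obtain e where e: "e \<in> arcs E" "tail E e = v" "head E e \<in> X"
    unfolding subset_iff by auto
  then have eEP: "e \<in> arcs EP"
    using v by (simp add: EP_arcs)
  show ?thesis
  proof
    assume "c \<odot>\<^bsub>L\<^esub> pV v = \<zero>\<^bsub>L\<^esub>"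
    then have "lgst R E e \<otimes>\<^bsub>L\<^esub> ((c \<odot>\<^bsub>L\<^esub> pV v) \<otimes>\<^bsub>L\<^esub> ledg R E e) = \<zero>\<^bsub>L\<^esub>"
      using e(1) by simp
    moreover have "lgst R E e \<otimes>\<^bsub>L\<^esub> ((c \<odot>\<^bsub>L\<^esub> pV v) \<otimes>\<^bsub>L\<^esub> ledg R E e) = c \<odot>\<^bsub>L\<^esub> lvtx R E (head E e)"
      using assms(1) e eEP by (simp add: L.smult_mult_l L.smult_mult_r pV_P F.G_P)
    ultimately show False
      using smult_vertex_nonzero[of "head E e" c] X_verts e assms(2) by simp
  qed
qed

text \<open>\<open>\<rho>\<close> preserves degrees, so the components of an element of the kernel
  lie in the kernel. By \<open>homogeneous_reduction\<close> with the zero ideal, a nonzero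
  component would yield a nonzero multiple of a vertex there, against
  \<open>smult_pV_nonzero\<close>.\<close>

lemma \<rho>_inj: "inj_on \<rho> (carrier LP)"
  unfolding \<rho>.inj_on_iff_ker
proof
  fix x assume x: "x \<in> \<rho>.ker"
  then have "x \<in> carrier LP"
    by (simp add: \<rho>.ker_def)
  from P.finite_homogeneous_sum[OF this] obtain N f where
    f: "finite N" "\<forall>k. f k \<in> P.F.Hom k" "\<forall>k. k \<notin> N \<longrightarrow> f k = \<zero>\<^bsub>LP\<^esub>" "x = finsum LP f N"
    by (elim exE conjE)
  have c: "f \<in> N \<rightarrow> carrier LP"
    using f(2) P.F.Hom_in_carrier by (auto simp: Pi_def)
  have zero: "rng_ideal {\<zero>\<^bsub>LP\<^esub>} LP"
    by (rule P.L.rng_idealI) auto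
  have "f k = \<zero>\<^bsub>LP\<^esub>" if k: "k \<in> N" for k
  proof (rule ccontr)
    assume nz: "f k \<noteq> \<zero>\<^bsub>LP\<^esub>"
    have "finsum L (\<lambda>k. \<rho> (f k)) N = \<zero>\<^bsub>L\<^esub>"
      using x c unfolding f(4) by (simp add: \<rho>.ker_def \<rho>.h_finsum[symmetric])
    then have "\<rho> (f k) = \<zero>\<^bsub>L\<^esub>"
      by (rule homogeneous_independent[OF f(1) \<rho>_graded[OF f(2)[rule_format]] _ k])
    then have ker: "f k \<in> \<rho>.ker"
      using c k by (auto simp: \<rho>.ker_def)
    have "\<exists>c. c \<noteq> 0 \<and> ((\<exists>v\<in>verts EP - {}. c \<odot>\<^bsub>LP\<^esub> lvtx R EP v \<in> \<rho>.ker) \<or>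
      (\<exists>v\<in>breaking EP {} - {}. c \<odot>\<^bsub>LP\<^esub> P.F.gap v {e \<in> out_arcs EP v. head EP e \<notin> {}} \<in> \<rho>.ker))"
      by (rule P.F.homogeneous_reduction[OF zero \<rho>.ker_ideal _ _ _ f(2)[rule_format] ker])
        (use nz in \<open>auto simp: \<rho>.ker_def\<close>)
    moreover have "breaking EP {} = {}"
      by (auto simp: breaking_def out_arcs_def)
    ultimately obtain c v where "c \<noteq> 0" "v \<in> X \<union> S" "c \<odot>\<^bsub>LP\<^esub> lvtx R EP v \<in> \<rho>.ker"
      by auto
    then show False
      using smult_pV_nonzero[of v c] by (auto simp: \<rho>.ker_def \<rho>.h_smult \<rho>_props)
  qed
  then have "finsum LP f N = finsum LP (\<lambda>k. \<zero>\<^bsub>LP\<^esub>) N"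
    by (intro P.L.finsum_cong') auto
  then show "x \<in> {\<zero>\<^bsub>LP\<^esub>}"
    unfolding f(4) by (simp add: P.L.finsum_zero)
qed

section \<open>The image of the smaller algebra as a corner\<close>

abbreviation "D \<equiv> \<rho> ` carrier LP"

lemma D_carrier: "d \<in> D \<Longrightarrow> d \<in> carrier L"
  by auto

lemma D_intros: "v \<in> X \<union> S \<Longrightarrow> pV v \<in> D" "e \<in> arcs EP \<Longrightarrow> ledg R E e \<in> D"
  "e \<in> arcs EP \<Longrightarrow> lgst R E e \<in> D" "\<zero>\<^bsub>L\<^esub> \<in> D"
  using \<rho>_props(2)[of v] \<rho>_props(3,4)[of e] by (auto intro!: image_eqI[of "pV v" \<rho> "lvtx R EP v"]
    image_eqI[of "ledg R E e" \<rho> "ledg R EP e"] image_eqI[of "lgst R E e" \<rho> "lgst R EP e"]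
    image_eqI[of "\<zero>\<^bsub>L\<^esub>" \<rho> "\<zero>\<^bsub>LP\<^esub>"])

lemma D_closed: "d \<in> D \<Longrightarrow> d' \<in> D \<Longrightarrow> d \<oplus>\<^bsub>L\<^esub> d' \<in> D" "d \<in> D \<Longrightarrow> d' \<in> D \<Longrightarrow> d \<otimes>\<^bsub>L\<^esub> d' \<in> D"
  "d \<in> D \<Longrightarrow> c \<odot>\<^bsub>L\<^esub> d \<in> D"
  by (auto simp: \<rho>.h_add[symmetric] \<rho>.h_mult[symmetric] \<rho>.h_smult[symmetric])

lemma D_subgroup: "additive_subgroup D L"
  by (rule L.add_subgroupI) (auto simp: \<rho>.h_add[symmetric] \<rho>.h_a_inv[symmetric] intro: D_intros(4))

text \<open>By heredity a path that starts in X stays in X, so all its edges belong to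
  \<open>pair_graph\<close>.\<close>

lemma pp_D: "v \<in> X \<Longrightarrow> awalk v p w \<Longrightarrow> F.pp v p \<in> D \<and> F.sp v p \<in> D"
proof (induction p arbitrary: v)
  case Nil
  then show ?case
    using D_intros(1)[of v] by (simp add: pV_def)
next
  case (Cons e p)
  then have e: "e \<in> arcs E" "tail E e = v" "awalk (head E e) p w"
    by (auto simp: awalk_Cons_iff)
  then have "e \<in> arcs EP" "head E e \<in> X"
    using Cons.prems X_closed[of e] by (auto simp: EP_arcs)
  then show ?case
    using Cons.IH[of "head E e"] e(3) by (simp add: D_closed D_intros)
qed

text \<open>The first edge decides: \<open>pV v\<close> kills it unless it belongs to
  \<open>pair_graph\<close>, and then its head is in X, where \<open>pp_D\<close> takes
  over.\<close>

lemma pV_pp_D: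
  assumes v: "v \<in> X \<union> S" and p: "awalk u p w"
  shows "pV v \<otimes>\<^bsub>L\<^esub> F.pp u p \<in> D"
proof (cases p)
  case Nil
  have "u \<in> verts E"
    using p by (rule awalk_hd_in_verts)
  then have "pV v \<otimes>\<^bsub>L\<^esub> F.pp u p = (if u = v then pV v else \<zero>\<^bsub>L\<^esub>)"
    unfolding Nil using v by (simp add: pV_V_if)
  then show ?thesis
    using D_intros(1)[OF v] D_intros(4) by (cases "u = v") (simp_all only: simp_thms if_True if_False)
next
  case (Cons e p')
  then have e: "e \<in> arcs E" "awalk (head E e) p' w"
    using p by (auto simp: awalk_Cons_iff)
  have "pV v \<otimes>\<^bsub>L\<^esub> F.pp u p = (pV v \<otimes>\<^bsub>L\<^esub> ledg R E e) \<otimes>\<^bsub>L\<^esub> F.pp (head E e) p'"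
    using v e Cons by (simp add: L.m_assoc)
  also have "\<dots> \<in> D"
  proof (cases "tail E e = v \<and> e \<in> arcs EP")
    case True
    then show ?thesis
      using v e pp_D[of "head E e" p' w] by (simp add: pV_P EP_arcs D_closed D_intros)
  next
    case False
    then show ?thesis
      unfolding pV_P[OF v e(1)] if_not_P[OF False] using e(2) D_intros(4) by simp
  qed
  finally show ?thesis .
qed

lemma sp_pV_D:
  assumes v: "v \<in> X \<union> S" and p: "awalk u p w"
  shows "F.sp u p \<otimes>\<^bsub>L\<^esub> pV v \<in> D"
proof (cases p)
  case Nil
  have "u \<in> verts E"
    using p by (rule awalk_hd_in_verts)
  then have "F.sp u p \<otimes>\<^bsub>L\<^esub> pV v = (if u = v then pV v else \<zero>\<^bsub>L\<^esub>)"
    unfolding Nil using v by (simp add: V_pV_if)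
  then show ?thesis
    using D_intros(1)[OF v] D_intros(4) by (cases "u = v") (simp_all only: simp_thms if_True if_False)
next
  case (Cons e p')
  then have e: "e \<in> arcs E" "awalk (head E e) p' w"
    using p by (auto simp: awalk_Cons_iff)
  have "F.sp u p \<otimes>\<^bsub>L\<^esub> pV v = F.sp (head E e) p' \<otimes>\<^bsub>L\<^esub> (lgst R E e \<otimes>\<^bsub>L\<^esub> pV v)"
    using v e Cons by (simp add: L.m_assoc)
  also have "\<dots> \<in> D"
  proof (cases "tail E e = v \<and> e \<in> arcs EP")
    case True
    then show ?thesis
      using v e pp_D[of "head E e" p' w] by (simp add: G_pV EP_arcs D_closed D_intros)
  next
    case False
    then show ?thesis
      unfolding G_pV[OF v e(1)] if_not_P[OF False] using e(2) D_intros(4) by simp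
  qed
  finally show ?thesis .
qed

text \<open>A sum of vertices acting as a unit in \<open>leavitt R EP\<close> is mapped to a sum of
  \<open>pV v\<close>. This reduces claims about D to products with a single
  \<open>pV v\<close>.\<close>

lemma D_unit_sum:
  assumes "d \<in> D"
  shows "\<exists>W. finite W \<and> W \<subseteq> X \<union> S \<and> d = finsum L (\<lambda>v. pV v \<otimes>\<^bsub>L\<^esub> d) W \<and> d = finsum L (\<lambda>v. d \<otimes>\<^bsub>L\<^esub> pV v) W"
proof -
  obtain b where b: "b \<in> carrier LP" "d = \<rho> b"
    using assms by (elim imageE)
  have b_single: "finite {b}" "{b} \<subseteq> carrier LP"
    using b by simp_all
  obtain W where W: "finite W" "W \<subseteq> verts EP" "\<forall>x\<in>{b}. P.U W \<otimes>\<^bsub>LP\<^esub> x = x \<and> x \<otimes>\<^bsub>LP\<^esub> P.U W = x"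
    using P.vertex_unit[OF b_single] by (elim exE conjE)
  have U: "\<rho> (P.U W) = finsum L pV W"
  proof -
    have "\<rho> (P.U W) = finsum L (\<lambda>v. \<rho> (lvtx R EP v)) W"
      using W(2) by (intro \<rho>.h_finsum) auto
    also have "\<dots> = finsum L pV W"
      using W(2) by (intro L.finsum_cong') (auto simp: \<rho>_props)
    finally show ?thesis .
  qed
  have c: "pV \<in> W \<rightarrow> carrier L" "d \<in> carrier L"
    using W(2) b by auto
  have "d = finsum L pV W \<otimes>\<^bsub>L\<^esub> d" "d = d \<otimes>\<^bsub>L\<^esub> finsum L pV W"
    unfolding U[symmetric] b(2) using b(1) W(3) P.U_closed[OF W(2)] by (simp_all add: \<rho>.h_mult[symmetric])
  then have "d = finsum L (\<lambda>v. pV v \<otimes>\<^bsub>L\<^esub> d) W" "d = finsum L (\<lambda>v. d \<otimes>\<^bsub>L\<^esub> pV v) W"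
    using L.finsum_l_distr[OF c W(1)] L.finsum_r_distr[OF c W(1)] by simp_all
  then show ?thesis
    using W(1,2) by (intro exI[of _ W]) simp
qed

lemma sp_D:
  assumes d: "d \<in> D" and p: "awalk u p w"
  shows "F.sp u p \<otimes>\<^bsub>L\<^esub> d \<in> D"
proof -
  obtain W where W: "finite W" "W \<subseteq> X \<union> S" "d = finsum L (\<lambda>v. pV v \<otimes>\<^bsub>L\<^esub> d) W"
    using D_unit_sum[OF d] by (elim exE conjE)
  have c: "d \<in> carrier L" "(\<lambda>v. pV v \<otimes>\<^bsub>L\<^esub> d) \<in> W \<rightarrow> carrier L"
    using d W by auto
  have "F.sp u p \<otimes>\<^bsub>L\<^esub> d = finsum L (\<lambda>v. F.sp u p \<otimes>\<^bsub>L\<^esub> (pV v \<otimes>\<^bsub>L\<^esub> d)) W"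
    using p by (subst W(3), intro L.finsum_r_distr[OF c(2) _ W(1)]) auto
  also have "\<dots> \<in> D"
  proof (rule L.finsum_in_subgroup[OF D_subgroup])
    fix v assume "v \<in> W"
    then have v: "v \<in> X \<union> S" using W by auto
    have "F.sp u p \<otimes>\<^bsub>L\<^esub> (pV v \<otimes>\<^bsub>L\<^esub> d) = F.sp u p \<otimes>\<^bsub>L\<^esub> pV v \<otimes>\<^bsub>L\<^esub> d"
      using v p c by (simp add: L.m_assoc)
    then show "F.sp u p \<otimes>\<^bsub>L\<^esub> (pV v \<otimes>\<^bsub>L\<^esub> d) \<in> D"
      using sp_pV_D[OF v p] d by (simp add: D_closed)
  qed
  finally show ?thesis .
qed

lemma pp_D_right:
  assumes d: "d \<in> D" and p: "awalk u p w"
  shows "d \<otimes>\<^bsub>L\<^esub> F.pp u p \<in> D"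
proof -
  obtain W where W: "finite W" "W \<subseteq> X \<union> S" "d = finsum L (\<lambda>v. d \<otimes>\<^bsub>L\<^esub> pV v) W"
    using D_unit_sum[OF d] by (elim exE conjE)
  have c: "d \<in> carrier L" "(\<lambda>v. d \<otimes>\<^bsub>L\<^esub> pV v) \<in> W \<rightarrow> carrier L"
    using d W by auto
  have "d \<otimes>\<^bsub>L\<^esub> F.pp u p = finsum L (\<lambda>v. (d \<otimes>\<^bsub>L\<^esub> pV v) \<otimes>\<^bsub>L\<^esub> F.pp u p) W"
    using p by (subst W(3), intro L.finsum_l_distr[OF c(2) _ W(1)]) auto
  also have "\<dots> \<in> D"
  proof (rule L.finsum_in_subgroup[OF D_subgroup])
    fix v assume "v \<in> W"
    then have v: "v \<in> X \<union> S" using W by auto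
    have "d \<otimes>\<^bsub>L\<^esub> pV v \<otimes>\<^bsub>L\<^esub> F.pp u p = d \<otimes>\<^bsub>L\<^esub> (pV v \<otimes>\<^bsub>L\<^esub> F.pp u p)"
      using v p c by (simp add: L.m_assoc)
    then show "d \<otimes>\<^bsub>L\<^esub> pV v \<otimes>\<^bsub>L\<^esub> F.pp u p \<in> D"
      using pV_pp_D[OF v p] d by (simp add: D_closed)
  qed
  finally show ?thesis .
qed

text \<open>It suffices to treat monomials, and \<open>d (pp u p \<otimes> sp v q) d'\<close> is the
  product of \<open>d \<otimes> pp u p\<close> and \<open>sp v q \<otimes> d'\<close>, both of which
  lie in D.\<close>

lemma corner:
  assumes "d \<in> D" "x \<in> carrier L" "d' \<in> D"
  shows "d \<otimes>\<^bsub>L\<^esub> x \<otimes>\<^bsub>L\<^esub> d' \<in> D"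
proof -
  have c: "d \<in> carrier L" "d' \<in> carrier L"
    using assms by auto
  let ?T = "{x \<in> carrier L. d \<otimes>\<^bsub>L\<^esub> x \<otimes>\<^bsub>L\<^esub> d' \<in> D}"
  interpret D: additive_subgroup D L by (rule D_subgroup)
  have T: "additive_subgroup ?T L"
    by (rule L.add_subgroupI) (use c D_intros(4) in \<open>auto simp: L.l_distr L.r_distr L.l_minus L.r_minus D_closed\<close>)
  have hom: "x \<in> ?T" if "x \<in> F.Hom k" for x k
    using that
  proof (induction rule: F.Hom_induct)
    case (mon a u p v q w)
    have "d \<otimes>\<^bsub>L\<^esub> (a \<odot>\<^bsub>L\<^esub> (F.pp u p \<otimes>\<^bsub>L\<^esub> F.sp v q)) \<otimes>\<^bsub>L\<^esub> d' = a \<odot>\<^bsub>L\<^esub> ((d \<otimes>\<^bsub>L\<^esub> F.pp u p) \<otimes>\<^bsub>L\<^esub> (F.sp v q \<otimes>\<^bsub>L\<^esub> d'))"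
      using mon c by (simp add: L.smult_mult_l L.smult_mult_r L.m_assoc)
    then show ?case
      using mon pp_D_right[OF assms(1) mon(1)] sp_D[OF assms(3) mon(2)] by (simp add: D_closed)
  next
    case (add x y)
    then show ?case
      using T by (intro additive_subgroup.a_closed)
  qed (rule additive_subgroup.zero_closed[OF T])
  obtain N f where f: "finite N" "\<forall>k. f k \<in> F.Hom k" "\<forall>k. k \<notin> N \<longrightarrow> f k = \<zero>\<^bsub>L\<^esub>" "x = finsum L f N"
    using finite_homogeneous_sum[OF assms(2)] by (elim exE conjE)
  have "x \<in> ?T"
    unfolding f(4) using f(2) hom by (intro L.finsum_in_subgroup[OF T]) blast
  then show ?thesis
    by simp
qed

sublocale MC: morita_corner L LP \<rho>
proof (intro morita_corner.intro morita_corner_axioms.intro L.rng_axioms P.L.rng_axioms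
    \<rho>_inj P.leavitt_local_units)
  show "\<rho> b \<otimes>\<^bsub>L\<^esub> x \<otimes>\<^bsub>L\<^esub> \<rho> b' \<in> D" if "b \<in> carrier LP" "x \<in> carrier L" "b' \<in> carrier LP" for b x b'
    using that by (intro corner imageI)
qed (simp_all add: \<rho>.h_add \<rho>.h_mult)

section \<open>Local units of the ideal\<close>

lemma V_D:
  assumes d: "d \<in> D" and w: "w \<in> verts E"
  shows "lvtx R E w \<otimes>\<^bsub>L\<^esub> d = (if w \<in> X \<union> S then pV w \<otimes>\<^bsub>L\<^esub> d else \<zero>\<^bsub>L\<^esub>)"
proof -
  obtain W where W: "finite W" "W \<subseteq> X \<union> S" "d = finsum L (\<lambda>v. pV v \<otimes>\<^bsub>L\<^esub> d) W"
    using D_unit_sum[OF d] by (elim exE conjE)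
  have c: "(\<lambda>v. pV v \<otimes>\<^bsub>L\<^esub> d) \<in> W \<rightarrow> carrier L" "d \<in> carrier L"
    using d W by auto
  have sum: "y \<otimes>\<^bsub>L\<^esub> d = finsum L (\<lambda>v. y \<otimes>\<^bsub>L\<^esub> pV v \<otimes>\<^bsub>L\<^esub> d) W" if y: "y \<in> carrier L" for y
  proof -
    have "y \<otimes>\<^bsub>L\<^esub> d = finsum L (\<lambda>v. y \<otimes>\<^bsub>L\<^esub> (pV v \<otimes>\<^bsub>L\<^esub> d)) W"
      using y by (subst W(3), intro L.finsum_r_distr[OF c(1) _ W(1)])
    also have "\<dots> = finsum L (\<lambda>v. y \<otimes>\<^bsub>L\<^esub> pV v \<otimes>\<^bsub>L\<^esub> d) W"
      using y c(2) subsetD[OF W(2)] by (intro L.finsum_cong') (simp_all add: L.m_assoc Pi_def)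
    finally show ?thesis .
  qed
  show ?thesis
  proof (cases "w \<in> X \<union> S")
    case True
    have "lvtx R E w \<otimes>\<^bsub>L\<^esub> d = finsum L (\<lambda>v. lvtx R E w \<otimes>\<^bsub>L\<^esub> pV v \<otimes>\<^bsub>L\<^esub> d) W"
      using w by (intro sum) simp
    also have "\<dots> = finsum L (\<lambda>v. pV w \<otimes>\<^bsub>L\<^esub> pV v \<otimes>\<^bsub>L\<^esub> d) W"
      using c(2) w True subsetD[OF W(2)] by (intro L.finsum_cong') (simp_all add: V_pV_if pV_pV Pi_def)
    also have "\<dots> = pV w \<otimes>\<^bsub>L\<^esub> d"
      using True by (intro sum[symmetric]) simp
    finally show ?thesis
      using True by simp
  next
    case False
    have "lvtx R E w \<otimes>\<^bsub>L\<^esub> d = finsum L (\<lambda>v. lvtx R E w \<otimes>\<^bsub>L\<^esub> pV v \<otimes>\<^bsub>L\<^esub> d) W"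
      using w by (intro sum) simp
    also have "\<dots> = finsum L (\<lambda>v. \<zero>\<^bsub>L\<^esub>) W"
    proof (rule L.finsum_cong')
      fix v assume "v \<in> W"
      then have "v \<in> X \<union> S" "w \<noteq> v"
        using W(2) False by auto
      then show "lvtx R E w \<otimes>\<^bsub>L\<^esub> pV v \<otimes>\<^bsub>L\<^esub> d = \<zero>\<^bsub>L\<^esub>"
        using w c(2) by (simp add: V_pV_if)
    qed auto
    finally show ?thesis
      using False by (simp add: L.finsum_zero)
  qed
qed

lemma D_V:
  assumes d: "d \<in> D" and w: "w \<in> verts E"
  shows "d \<otimes>\<^bsub>L\<^esub> lvtx R E w = (if w \<in> X \<union> S then d \<otimes>\<^bsub>L\<^esub> pV w else \<zero>\<^bsub>L\<^esub>)"
proof -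
  obtain W where W: "finite W" "W \<subseteq> X \<union> S" "d = finsum L (\<lambda>v. d \<otimes>\<^bsub>L\<^esub> pV v) W"
    using D_unit_sum[OF d] by (elim exE conjE)
  have c: "(\<lambda>v. d \<otimes>\<^bsub>L\<^esub> pV v) \<in> W \<rightarrow> carrier L" "d \<in> carrier L"
    using d W by auto
  have sum: "d \<otimes>\<^bsub>L\<^esub> y = finsum L (\<lambda>v. d \<otimes>\<^bsub>L\<^esub> (pV v \<otimes>\<^bsub>L\<^esub> y)) W" if y: "y \<in> carrier L" for y
  proof -
    have "d \<otimes>\<^bsub>L\<^esub> y = finsum L (\<lambda>v. d \<otimes>\<^bsub>L\<^esub> pV v \<otimes>\<^bsub>L\<^esub> y) W"
      using y by (subst W(3), intro L.finsum_l_distr[OF c(1) _ W(1)])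
    also have "\<dots> = finsum L (\<lambda>v. d \<otimes>\<^bsub>L\<^esub> (pV v \<otimes>\<^bsub>L\<^esub> y)) W"
      using y c(2) subsetD[OF W(2)] by (intro L.finsum_cong') (simp_all add: L.m_assoc Pi_def)
    finally show ?thesis .
  qed
  show ?thesis
  proof (cases "w \<in> X \<union> S")
    case True
    have "d \<otimes>\<^bsub>L\<^esub> lvtx R E w = finsum L (\<lambda>v. d \<otimes>\<^bsub>L\<^esub> (pV v \<otimes>\<^bsub>L\<^esub> lvtx R E w)) W"
      using w by (intro sum) simp
    also have "\<dots> = finsum L (\<lambda>v. d \<otimes>\<^bsub>L\<^esub> (pV v \<otimes>\<^bsub>L\<^esub> pV w)) W"
      using c(2) w True subsetD[OF W(2)] by (intro L.finsum_cong') (auto simp: pV_V_if pV_pV Pi_def)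
    also have "\<dots> = d \<otimes>\<^bsub>L\<^esub> pV w"
      using True by (intro sum[symmetric]) simp
    finally show ?thesis
      using True by simp
  next
    case False
    have "d \<otimes>\<^bsub>L\<^esub> lvtx R E w = finsum L (\<lambda>v. d \<otimes>\<^bsub>L\<^esub> (pV v \<otimes>\<^bsub>L\<^esub> lvtx R E w)) W"
      using w by (intro sum) simp
    also have "\<dots> = finsum L (\<lambda>v. \<zero>\<^bsub>L\<^esub>) W"
    proof (rule L.finsum_cong')
      fix v assume "v \<in> W"
      then have "v \<in> X \<union> S" "w \<noteq> v"
        using W(2) False by auto
      then show "d \<otimes>\<^bsub>L\<^esub> (pV v \<otimes>\<^bsub>L\<^esub> lvtx R E w) = \<zero>\<^bsub>L\<^esub>"
        using w c(2) by (simp add: pV_V_if)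
    qed auto
    finally show ?thesis
      using False by (simp add: L.finsum_zero)
  qed
qed

text \<open>The idempotents \<open>\<alpha> \<alpha>\<^sup>*\<close> and \<open>\<alpha> v\<^sup>H \<alpha>\<^sup>*\<close> of the local units.\<close>

definition pidem where "pidem u p w = F.pp u p \<otimes>\<^bsub>L\<^esub> (pV w \<otimes>\<^bsub>L\<^esub> F.sp u p)"

definition "pidems = {pidem u p w | u p w. awalk u p w \<and> w \<in> X \<union> S}"

lemma pidem_in_I: "awalk u p w \<Longrightarrow> w \<in> X \<union> S \<Longrightarrow> pidem u p w \<in> MC.I"
  unfolding pidem_def by (intro MC.I.I_l_closed MC.I.I_r_closed MC.D_I D_intros(1)) auto

lemma pidem_closed: "awalk u p w \<Longrightarrow> w \<in> X \<union> S \<Longrightarrow> pidem u p w \<in> carrier L"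
  unfolding pidem_def by (intro L.m_closed) auto

text \<open>In both products \<open>sp u p \<otimes> pp u p\<close> collapses to a vertex in the
  middle. What remains is that \<open>pV w\<close> commutes with the idempotent of the rest
  \<open>r\<close> of the longer path.\<close>

lemma pidem_mult_prefix:
  assumes p: "awalk u p w" "w \<in> X \<union> S" and r: "awalk w r w'" "w' \<in> X \<union> S"
  shows "pidem u p w \<otimes>\<^bsub>L\<^esub> pidem u (p @ r) w' = pidem u (p @ r) w' \<otimes>\<^bsub>L\<^esub> pidem u p w"
proof -
  let ?Q = "F.pp w r \<otimes>\<^bsub>L\<^esub> (pV w' \<otimes>\<^bsub>L\<^esub> F.sp w r)"
  have wv: "w \<in> verts E" "w' \<in> verts E"
    using p r XS_verts by auto
  have c [simp]: "?Q \<in> carrier L" "pV w \<in> carrier L" "F.pp u p \<in> carrier L" "F.sp u p \<in> carrier L"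
    using p r by (auto intro!: L.m_closed)
  have Q: "pidem u (p @ r) w' = F.pp u p \<otimes>\<^bsub>L\<^esub> (?Q \<otimes>\<^bsub>L\<^esub> F.sp u p)"
    unfolding pidem_def F.pp_append[OF p(1) r(1)] F.sp_append[OF p(1) r(1)]
    using p r by (simp add: L.m_assoc)
  \<comment> \<open>For empty \<open>r\<close> the idempotent is \<open>pV w\<close> itself.
    Otherwise \<open>pV w\<close> on the left keeps or kills the first edge of \<open>r\<close>, and
    on the right its ghost edge, by the same criterion.\<close>
  have comm: "pV w \<otimes>\<^bsub>L\<^esub> ?Q = ?Q \<otimes>\<^bsub>L\<^esub> pV w"
  proof (cases r)
    case Nil
    then have "w' = w"
      using r by (simp add: awalk_Nil_iff)
    then have "?Q = pV w"
      using Nil p(2) wv by (simp add: pV_V V_pV)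
    then show ?thesis by simp
  next
    case (Cons f r')
    then have f: "f \<in> arcs E" "awalk (head E f) r' w'"
      using r by (auto simp: awalk_Cons_iff)
    let ?Y = "F.pp (head E f) r' \<otimes>\<^bsub>L\<^esub> (pV w' \<otimes>\<^bsub>L\<^esub> F.sp (head E f) r')"
    have Y: "?Y \<in> carrier L"
      using f r by (auto intro!: L.m_closed)
    have QY: "?Q = ledg R E f \<otimes>\<^bsub>L\<^esub> (?Y \<otimes>\<^bsub>L\<^esub> lgst R E f)"
      using Cons f r by (simp add: L.m_assoc)
    have "pV w \<otimes>\<^bsub>L\<^esub> ?Q = (pV w \<otimes>\<^bsub>L\<^esub> ledg R E f) \<otimes>\<^bsub>L\<^esub> (?Y \<otimes>\<^bsub>L\<^esub> lgst R E f)"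
      unfolding QY using f Y by (simp add: L.m_assoc)
    moreover have "?Q \<otimes>\<^bsub>L\<^esub> pV w = ledg R E f \<otimes>\<^bsub>L\<^esub> (?Y \<otimes>\<^bsub>L\<^esub> (lgst R E f \<otimes>\<^bsub>L\<^esub> pV w))"
      unfolding QY using f Y by (simp add: L.m_assoc)
    ultimately show ?thesis
      unfolding pV_P[OF p(2) f(1)] G_pV[OF p(2) f(1)] using f Y by simp
  qed
  have "pidem u p w \<otimes>\<^bsub>L\<^esub> pidem u (p @ r) w' =
      F.pp u p \<otimes>\<^bsub>L\<^esub> (pV w \<otimes>\<^bsub>L\<^esub> (F.sp u p \<otimes>\<^bsub>L\<^esub> F.pp u p) \<otimes>\<^bsub>L\<^esub> ?Q \<otimes>\<^bsub>L\<^esub> F.sp u p)"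
    unfolding Q unfolding pidem_def using c by (simp only: L.m_assoc L.m_closed)
  also have "\<dots> = F.pp u p \<otimes>\<^bsub>L\<^esub> (pV w \<otimes>\<^bsub>L\<^esub> ?Q \<otimes>\<^bsub>L\<^esub> F.sp u p)"
    by (simp only: F.sp_pp[OF p(1)] pV_V[OF p(2)])
  also have "\<dots> = F.pp u p \<otimes>\<^bsub>L\<^esub> (?Q \<otimes>\<^bsub>L\<^esub> (lvtx R E w \<otimes>\<^bsub>L\<^esub> pV w) \<otimes>\<^bsub>L\<^esub> F.sp u p)"
    by (simp only: comm V_pV[OF p(2)])
  also have "\<dots> = F.pp u p \<otimes>\<^bsub>L\<^esub> (?Q \<otimes>\<^bsub>L\<^esub> ((F.sp u p \<otimes>\<^bsub>L\<^esub> F.pp u p) \<otimes>\<^bsub>L\<^esub> pV w) \<otimes>\<^bsub>L\<^esub> F.sp u p)"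
    by (simp only: F.sp_pp[OF p(1)])
  also have "\<dots> = pidem u (p @ r) w' \<otimes>\<^bsub>L\<^esub> pidem u p w"
    unfolding Q unfolding pidem_def using c by (simp only: L.m_assoc L.m_closed)
  finally show ?thesis .
qed

lemma pidem_idem:
  assumes "awalk u p w" "w \<in> X \<union> S"
  shows "pidem u p w \<otimes>\<^bsub>L\<^esub> pidem u p w = pidem u p w"
proof -
  have c: "pV w \<in> carrier L" "F.pp u p \<in> carrier L" "F.sp u p \<in> carrier L"
    using assms by auto
  have "pidem u p w \<otimes>\<^bsub>L\<^esub> pidem u p w =
      F.pp u p \<otimes>\<^bsub>L\<^esub> (pV w \<otimes>\<^bsub>L\<^esub> (F.sp u p \<otimes>\<^bsub>L\<^esub> F.pp u p) \<otimes>\<^bsub>L\<^esub> pV w \<otimes>\<^bsub>L\<^esub> F.sp u p)"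
    unfolding pidem_def using c by (simp only: L.m_assoc L.m_closed)
  then show ?thesis
    using assms(2) by (simp add: F.sp_pp[OF assms(1)] pV_V pV_pV pidem_def)
qed

text \<open>If one path is a prefix of the other, this is \<open>pidem_mult_prefix\<close>;
  otherwise both products are zero by \<open>walk_comparison\<close>.\<close>

lemma pidem_comm:
  assumes p: "awalk u p w" "w \<in> X \<union> S" and q: "awalk v p' w'" "w' \<in> X \<union> S"
  shows "pidem u p w \<otimes>\<^bsub>L\<^esub> pidem v p' w' = pidem v p' w' \<otimes>\<^bsub>L\<^esub> pidem u p w"
proof (cases "u = v \<and> (\<exists>r. p' = p @ r \<or> p = p' @ r)")
  case True
  then obtain r where r: "u = v" "p' = p @ r \<or> p = p' @ r"
    by auto
  from r(2) show ?thesis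
  proof
    assume qr: "p' = p @ r"
    then have "awalk (awlast u p) r w'"
      using q(1) r(1) by simp
    then have "awalk w r w'"
      using p(1) by (auto elim: awalkE)
    then show ?thesis
      using pidem_mult_prefix[OF p _ q(2), of r] r(1) qr by simp
  next
    assume pr: "p = p' @ r"
    then have "awalk (awlast v p') r w"
      using p(1) r(1) by simp
    then have "awalk w' r w"
      using q(1) by (auto elim: awalkE)
    then show ?thesis
      using pidem_mult_prefix[OF q _ p(2), of r] r(1) pr by simp
  qed
next
  case False
  have c: "pV w \<in> carrier L" "F.pp u p \<in> carrier L" "F.sp u p \<in> carrier L"
    "pV w' \<in> carrier L" "F.pp v p' \<in> carrier L" "F.sp v p' \<in> carrier L"
    using p q by auto
  have zero: "F.sp u p \<otimes>\<^bsub>L\<^esub> F.pp v p' = \<zero>\<^bsub>L\<^esub>" "F.sp v p' \<otimes>\<^bsub>L\<^esub> F.pp u p = \<zero>\<^bsub>L\<^esub>"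
    using F.walk_comparison[OF p(1) q(1)] F.walk_comparison[OF q(1) p(1)] False by blast+
  have "pidem u p w \<otimes>\<^bsub>L\<^esub> pidem v p' w' =
      F.pp u p \<otimes>\<^bsub>L\<^esub> (pV w \<otimes>\<^bsub>L\<^esub> (F.sp u p \<otimes>\<^bsub>L\<^esub> F.pp v p') \<otimes>\<^bsub>L\<^esub> pV w' \<otimes>\<^bsub>L\<^esub> F.sp v p')"
    unfolding pidem_def using c by (simp only: L.m_assoc L.m_closed)
  moreover have "pidem v p' w' \<otimes>\<^bsub>L\<^esub> pidem u p w =
      F.pp v p' \<otimes>\<^bsub>L\<^esub> (pV w' \<otimes>\<^bsub>L\<^esub> (F.sp v p' \<otimes>\<^bsub>L\<^esub> F.pp u p) \<otimes>\<^bsub>L\<^esub> pV w \<otimes>\<^bsub>L\<^esub> F.sp u p)"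
    unfolding pidem_def using c by (simp only: L.m_assoc L.m_closed)
  ultimately show ?thesis
    using c by (simp add: zero)
qed

text \<open>Speaking of all \<open>u\<close> that fix the finitely many idempotents makes sums easy,
  as the union of two sets W covers both summands. One \<open>u\<close> that serves on both sides is
  constructed only in \<open>I_local_units\<close>.\<close>

definition l_covered where
  "l_covered x \<longleftrightarrow> (\<exists>W. finite W \<and> W \<subseteq> pidems \<and> (\<forall>u\<in>carrier L. (\<forall>e\<in>W. u \<otimes>\<^bsub>L\<^esub> e = e) \<longrightarrow> u \<otimes>\<^bsub>L\<^esub> x = x))"

definition r_covered where
  "r_covered x \<longleftrightarrow> (\<exists>W. finite W \<and> W \<subseteq> pidems \<and> (\<forall>u\<in>carrier L. (\<forall>e\<in>W. e \<otimes>\<^bsub>L\<^esub> u = e) \<longrightarrow> x \<otimes>\<^bsub>L\<^esub> u = x))"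

lemma l_covered_closed:
  shows "l_covered \<zero>\<^bsub>L\<^esub>"
    and "x \<in> carrier L \<Longrightarrow> l_covered x \<Longrightarrow> l_covered (\<ominus>\<^bsub>L\<^esub> x)"
    and "x \<in> carrier L \<Longrightarrow> y \<in> carrier L \<Longrightarrow> l_covered x \<Longrightarrow> l_covered y \<Longrightarrow> l_covered (x \<oplus>\<^bsub>L\<^esub> y)"
proof -
  show "l_covered \<zero>\<^bsub>L\<^esub>"
    unfolding l_covered_def by (intro exI[of _ "{}"]) simp
  show "l_covered (\<ominus>\<^bsub>L\<^esub> x)" if x: "x \<in> carrier L" "l_covered x"
    using x(2) unfolding l_covered_def by (elim ex_forward) (simp add: x(1) L.r_minus)
  assume x: "x \<in> carrier L" "l_covered x" and y: "y \<in> carrier L" "l_covered y"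
  obtain W where W: "finite W" "W \<subseteq> pidems" "\<forall>u\<in>carrier L. (\<forall>e\<in>W. u \<otimes>\<^bsub>L\<^esub> e = e) \<longrightarrow> u \<otimes>\<^bsub>L\<^esub> x = x"
    using x unfolding l_covered_def by (elim conjE exE)
  obtain W' where W': "finite W'" "W' \<subseteq> pidems" "\<forall>u\<in>carrier L. (\<forall>e\<in>W'. u \<otimes>\<^bsub>L\<^esub> e = e) \<longrightarrow> u \<otimes>\<^bsub>L\<^esub> y = y"
    using y unfolding l_covered_def by (elim conjE exE)
  show "l_covered (x \<oplus>\<^bsub>L\<^esub> y)"
    unfolding l_covered_def using x(1) y(1) W W'
    by (intro conjI exI[of _ "W \<union> W'"]) (simp_all add: L.r_distr)
qed

lemma r_covered_closed:
  shows "r_covered \<zero>\<^bsub>L\<^esub>"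
    and "x \<in> carrier L \<Longrightarrow> r_covered x \<Longrightarrow> r_covered (\<ominus>\<^bsub>L\<^esub> x)"
    and "x \<in> carrier L \<Longrightarrow> y \<in> carrier L \<Longrightarrow> r_covered x \<Longrightarrow> r_covered y \<Longrightarrow> r_covered (x \<oplus>\<^bsub>L\<^esub> y)"
proof -
  show "r_covered \<zero>\<^bsub>L\<^esub>"
    unfolding r_covered_def by (intro exI[of _ "{}"]) simp
  show "r_covered (\<ominus>\<^bsub>L\<^esub> x)" if x: "x \<in> carrier L" "r_covered x"
    using x(2) unfolding r_covered_def by (elim ex_forward) (simp add: x(1) L.l_minus)
  assume x: "x \<in> carrier L" "r_covered x" and y: "y \<in> carrier L" "r_covered y"
  obtain W where W: "finite W" "W \<subseteq> pidems" "\<forall>u\<in>carrier L. (\<forall>e\<in>W. e \<otimes>\<^bsub>L\<^esub> u = e) \<longrightarrow> x \<otimes>\<^bsub>L\<^esub> u = x"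
    using x unfolding r_covered_def by (elim conjE exE)
  obtain W' where W': "finite W'" "W' \<subseteq> pidems" "\<forall>u\<in>carrier L. (\<forall>e\<in>W'. e \<otimes>\<^bsub>L\<^esub> u = e) \<longrightarrow> y \<otimes>\<^bsub>L\<^esub> u = y"
    using y unfolding r_covered_def by (elim conjE exE)
  show "r_covered (x \<oplus>\<^bsub>L\<^esub> y)"
    unfolding r_covered_def using x(1) y(1) W W'
    by (intro conjI exI[of _ "W \<union> W'"]) (simp_all add: L.l_distr)
qed

lemma l_covered_r_mult: "l_covered x \<Longrightarrow> x \<in> carrier L \<Longrightarrow> y \<in> carrier L \<Longrightarrow> l_covered (x \<otimes>\<^bsub>L\<^esub> y)"
  unfolding l_covered_def by (elim ex_forward) (simp add: L.m_assoc[symmetric])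

lemma r_covered_l_mult: "r_covered x \<Longrightarrow> x \<in> carrier L \<Longrightarrow> y \<in> carrier L \<Longrightarrow> r_covered (y \<otimes>\<^bsub>L\<^esub> x)"
  unfolding r_covered_def by (elim ex_forward) (simp add: L.m_assoc)

text \<open>The idempotent of the path itself suffices: \<open>pidem u p w\<close> fixes
  \<open>pp u p \<otimes> d\<close>, because on D the vertex \<open>w\<close> acts as
  \<open>pV w\<close>. If \<open>w\<close> is outside X and S, it acts as zero and so does the
  product vanish.\<close>

lemma pp_D_covered:
  assumes p: "awalk u p w" and d: "d \<in> D"
  shows "l_covered (F.pp u p \<otimes>\<^bsub>L\<^esub> d)" "r_covered (d \<otimes>\<^bsub>L\<^esub> F.sp u p)"
proof -
  have c: "d \<in> carrier L" "F.pp u p \<in> carrier L" "F.sp u p \<in> carrier L" "w \<in> verts E"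
    using d p awalk_last_in_verts by auto
  have l: "F.pp u p \<otimes>\<^bsub>L\<^esub> d = F.pp u p \<otimes>\<^bsub>L\<^esub> (lvtx R E w \<otimes>\<^bsub>L\<^esub> d)"
    using c F.pp_V[OF p] by (simp add: L.m_assoc[symmetric])
  have r: "d \<otimes>\<^bsub>L\<^esub> F.sp u p = (d \<otimes>\<^bsub>L\<^esub> lvtx R E w) \<otimes>\<^bsub>L\<^esub> F.sp u p"
    using c F.V_sp[OF p] by (simp add: L.m_assoc)
  show "l_covered (F.pp u p \<otimes>\<^bsub>L\<^esub> d)"
  proof (cases "w \<in> X \<union> S")
    case True
    have pc: "pidem u p w \<in> carrier L" "pV w \<in> carrier L"
      using pidem_closed[OF p True] True by simp_all
    have x: "F.pp u p \<otimes>\<^bsub>L\<^esub> d = F.pp u p \<otimes>\<^bsub>L\<^esub> (pV w \<otimes>\<^bsub>L\<^esub> d)"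
      using l V_D[OF d c(4)] True by simp
    have "pidem u p w \<otimes>\<^bsub>L\<^esub> (F.pp u p \<otimes>\<^bsub>L\<^esub> d) = F.pp u p \<otimes>\<^bsub>L\<^esub> (pV w \<otimes>\<^bsub>L\<^esub> (F.sp u p \<otimes>\<^bsub>L\<^esub> F.pp u p) \<otimes>\<^bsub>L\<^esub> d)"
      unfolding pidem_def using c pc by (simp only: L.m_assoc L.m_closed)
    also have "\<dots> = F.pp u p \<otimes>\<^bsub>L\<^esub> d"
      unfolding x using True by (simp add: F.sp_pp[OF p] pV_V)
    finally have e: "pidem u p w \<otimes>\<^bsub>L\<^esub> (F.pp u p \<otimes>\<^bsub>L\<^esub> d) = F.pp u p \<otimes>\<^bsub>L\<^esub> d" .
    have "y \<otimes>\<^bsub>L\<^esub> (F.pp u p \<otimes>\<^bsub>L\<^esub> d) = F.pp u p \<otimes>\<^bsub>L\<^esub> d"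
      if y: "y \<in> carrier L" "y \<otimes>\<^bsub>L\<^esub> pidem u p w = pidem u p w" for y
    proof -
      have "y \<otimes>\<^bsub>L\<^esub> (pidem u p w \<otimes>\<^bsub>L\<^esub> (F.pp u p \<otimes>\<^bsub>L\<^esub> d)) = (y \<otimes>\<^bsub>L\<^esub> pidem u p w) \<otimes>\<^bsub>L\<^esub> (F.pp u p \<otimes>\<^bsub>L\<^esub> d)"
        using y(1) pc c by (simp add: L.m_assoc)
      then show ?thesis
        unfolding y(2) e .
    qed
    then show ?thesis
      unfolding l_covered_def pidems_def using p True
      by (intro exI[of _ "{pidem u p w}"] conjI ballI impI) auto
  next
    case False
    then have "F.pp u p \<otimes>\<^bsub>L\<^esub> d = \<zero>\<^bsub>L\<^esub>"
      using l V_D[OF d c(4)] c(2) by simp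
    then show ?thesis
      unfolding l_covered_def by (intro exI[of _ "{}"]) simp
  qed
  show "r_covered (d \<otimes>\<^bsub>L\<^esub> F.sp u p)"
  proof (cases "w \<in> X \<union> S")
    case True
    have pc: "pidem u p w \<in> carrier L" "pV w \<in> carrier L"
      using pidem_closed[OF p True] True by simp_all
    have x: "d \<otimes>\<^bsub>L\<^esub> F.sp u p = (d \<otimes>\<^bsub>L\<^esub> pV w) \<otimes>\<^bsub>L\<^esub> F.sp u p"
      using r D_V[OF d c(4)] True by simp
    have "(d \<otimes>\<^bsub>L\<^esub> F.sp u p) \<otimes>\<^bsub>L\<^esub> pidem u p w = d \<otimes>\<^bsub>L\<^esub> ((F.sp u p \<otimes>\<^bsub>L\<^esub> F.pp u p) \<otimes>\<^bsub>L\<^esub> pV w) \<otimes>\<^bsub>L\<^esub> F.sp u p"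
      unfolding pidem_def using c pc by (simp only: L.m_assoc L.m_closed)
    also have "\<dots> = d \<otimes>\<^bsub>L\<^esub> F.sp u p"
      unfolding x using True by (simp add: F.sp_pp[OF p] V_pV)
    finally have e: "(d \<otimes>\<^bsub>L\<^esub> F.sp u p) \<otimes>\<^bsub>L\<^esub> pidem u p w = d \<otimes>\<^bsub>L\<^esub> F.sp u p" .
    have "(d \<otimes>\<^bsub>L\<^esub> F.sp u p) \<otimes>\<^bsub>L\<^esub> y = d \<otimes>\<^bsub>L\<^esub> F.sp u p"
      if y: "y \<in> carrier L" "pidem u p w \<otimes>\<^bsub>L\<^esub> y = pidem u p w" for y
    proof -
      have "((d \<otimes>\<^bsub>L\<^esub> F.sp u p) \<otimes>\<^bsub>L\<^esub> pidem u p w) \<otimes>\<^bsub>L\<^esub> y = (d \<otimes>\<^bsub>L\<^esub> F.sp u p) \<otimes>\<^bsub>L\<^esub> (pidem u p w \<otimes>\<^bsub>L\<^esub> y)"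
        using y(1) pc c by (simp add: L.m_assoc)
      then show ?thesis
        unfolding y(2) e .
    qed
    then show ?thesis
      unfolding r_covered_def pidems_def using p True
      by (intro exI[of _ "{pidem u p w}"] conjI ballI impI) auto
  next
    case False
    then have "d \<otimes>\<^bsub>L\<^esub> F.sp u p = \<zero>\<^bsub>L\<^esub>"
      using r D_V[OF d c(4)] c(3) by simp
    then show ?thesis
      unfolding r_covered_def by (intro exI[of _ "{}"]) simp
  qed
qed

lemma homogeneous_span_induct:
  assumes "additive_subgroup T L" "x \<in> carrier L"
    and "\<And>a u p v q w. awalk u p w \<Longrightarrow> awalk v q w \<Longrightarrow> a \<odot>\<^bsub>L\<^esub> (F.pp u p \<otimes>\<^bsub>L\<^esub> F.sp v q) \<in> T"
  shows "x \<in> T"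
proof -
  have hom: "x \<in> T" if "x \<in> F.Hom k" for x k
    using that
  proof (induction rule: F.Hom_induct)
    case (mon a u p v q w)
    then show ?case
      by (intro assms(3))
  qed (use assms(1) in \<open>auto intro: additive_subgroup.a_closed additive_subgroup.zero_closed\<close>)
  obtain N f where f: "finite N" "\<forall>k. f k \<in> F.Hom k" "\<forall>k. k \<notin> N \<longrightarrow> f k = \<zero>\<^bsub>L\<^esub>" "x = finsum L f N"
    using finite_homogeneous_sum[OF assms(2)] by (elim exE conjE)
  show ?thesis
    unfolding f(4) using f(2) hom by (intro L.finsum_in_subgroup[OF assms(1)]) blast
qed

lemma mult_D_covered:
  assumes x: "x \<in> carrier L" and d: "d \<in> D"
  shows "l_covered (x \<otimes>\<^bsub>L\<^esub> d)" "r_covered (d \<otimes>\<^bsub>L\<^esub> x)"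
proof -
  have c: "d \<in> carrier L" using d by auto
  have "x \<in> {y \<in> carrier L. l_covered (y \<otimes>\<^bsub>L\<^esub> d)}"
  proof (rule homogeneous_span_induct[OF _ x])
    show "additive_subgroup {y \<in> carrier L. l_covered (y \<otimes>\<^bsub>L\<^esub> d)} L"
    proof (rule L.add_subgroupI)
      show "\<zero>\<^bsub>L\<^esub> \<in> {y \<in> carrier L. l_covered (y \<otimes>\<^bsub>L\<^esub> d)}"
        using c l_covered_closed(1) by simp
      show "\<ominus>\<^bsub>L\<^esub> y \<in> {y \<in> carrier L. l_covered (y \<otimes>\<^bsub>L\<^esub> d)}" if "y \<in> {y \<in> carrier L. l_covered (y \<otimes>\<^bsub>L\<^esub> d)}" for y
        using that c by (simp add: L.l_minus l_covered_closed(2))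
      show "y \<oplus>\<^bsub>L\<^esub> z \<in> {y \<in> carrier L. l_covered (y \<otimes>\<^bsub>L\<^esub> d)}"
        if "y \<in> {y \<in> carrier L. l_covered (y \<otimes>\<^bsub>L\<^esub> d)}" "z \<in> {y \<in> carrier L. l_covered (y \<otimes>\<^bsub>L\<^esub> d)}" for y z
        using that c by (simp add: L.l_distr l_covered_closed(3))
    qed simp
    fix a u p v q w assume pq: "awalk u p w" "awalk v q w"
    have "(a \<odot>\<^bsub>L\<^esub> (F.pp u p \<otimes>\<^bsub>L\<^esub> F.sp v q)) \<otimes>\<^bsub>L\<^esub> d = F.pp u p \<otimes>\<^bsub>L\<^esub> (a \<odot>\<^bsub>L\<^esub> (F.sp v q \<otimes>\<^bsub>L\<^esub> d))"
      using pq c by (simp add: L.smult_mult_l L.smult_mult_r L.m_assoc)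
    then show "a \<odot>\<^bsub>L\<^esub> (F.pp u p \<otimes>\<^bsub>L\<^esub> F.sp v q) \<in> {y \<in> carrier L. l_covered (y \<otimes>\<^bsub>L\<^esub> d)}"
      using pq pp_D_covered(1)[OF pq(1) D_closed(3)[OF sp_D[OF d pq(2)]]] by simp
  qed
  then show "l_covered (x \<otimes>\<^bsub>L\<^esub> d)" by (elim CollectE conjE)
  have "x \<in> {y \<in> carrier L. r_covered (d \<otimes>\<^bsub>L\<^esub> y)}"
  proof (rule homogeneous_span_induct[OF _ x])
    show "additive_subgroup {y \<in> carrier L. r_covered (d \<otimes>\<^bsub>L\<^esub> y)} L"
    proof (rule L.add_subgroupI)
      show "\<zero>\<^bsub>L\<^esub> \<in> {y \<in> carrier L. r_covered (d \<otimes>\<^bsub>L\<^esub> y)}"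
        using c r_covered_closed(1) by simp
      show "\<ominus>\<^bsub>L\<^esub> y \<in> {y \<in> carrier L. r_covered (d \<otimes>\<^bsub>L\<^esub> y)}" if "y \<in> {y \<in> carrier L. r_covered (d \<otimes>\<^bsub>L\<^esub> y)}" for y
        using that c by (simp add: L.r_minus r_covered_closed(2))
      show "y \<oplus>\<^bsub>L\<^esub> z \<in> {y \<in> carrier L. r_covered (d \<otimes>\<^bsub>L\<^esub> y)}"
        if "y \<in> {y \<in> carrier L. r_covered (d \<otimes>\<^bsub>L\<^esub> y)}" "z \<in> {y \<in> carrier L. r_covered (d \<otimes>\<^bsub>L\<^esub> y)}" for y z
        using that c by (simp add: L.r_distr r_covered_closed(3))
    qed simp
    fix a u p v q w assume pq: "awalk u p w" "awalk v q w"
    have "d \<otimes>\<^bsub>L\<^esub> (a \<odot>\<^bsub>L\<^esub> (F.pp u p \<otimes>\<^bsub>L\<^esub> F.sp v q)) = (a \<odot>\<^bsub>L\<^esub> (d \<otimes>\<^bsub>L\<^esub> F.pp u p)) \<otimes>\<^bsub>L\<^esub> F.sp v q"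
      using pq c by (simp add: L.smult_mult_l L.smult_mult_r L.m_assoc)
    then show "a \<odot>\<^bsub>L\<^esub> (F.pp u p \<otimes>\<^bsub>L\<^esub> F.sp v q) \<in> {y \<in> carrier L. r_covered (d \<otimes>\<^bsub>L\<^esub> y)}"
      using pq pp_D_covered(2)[OF pq(2) D_closed(3)[OF pp_D_right[OF d pq(1)]]] by simp
  qed
  then show "r_covered (d \<otimes>\<^bsub>L\<^esub> x)" by (elim CollectE conjE)
qed

text \<open>Left coverage passes to right multiples but not obviously to left ones. Therefore the
  auxiliary ideal asks that all left multiples be left covered and all right multiples right
  covered; a sum of vertices acting as a unit on \<open>x\<close> leads back to
  \<open>x\<close>.\<close>

lemma I_covered:
  assumes x: "x \<in> MC.I"
  shows "l_covered x" "r_covered x"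
proof -
  have cx: "x \<in> carrier L"
    using x by (rule MC.I.ideal_carrier)
  obtain W where W: "W \<subseteq> verts E" "U W \<otimes>\<^bsub>L\<^esub> x = x \<and> x \<otimes>\<^bsub>L\<^esub> U W = x"
    using vertex_unit[of "{x}"] cx by auto
  let ?J = "{x \<in> carrier L. \<forall>y\<in>carrier L. l_covered (y \<otimes>\<^bsub>L\<^esub> x) \<and> r_covered (x \<otimes>\<^bsub>L\<^esub> y)}"
  have "rng_ideal ?J L"
  proof (rule L.rng_idealI)
    show "\<zero>\<^bsub>L\<^esub> \<in> ?J"
      using l_covered_closed(1) r_covered_closed(1) by simp
    show "x \<oplus>\<^bsub>L\<^esub> y \<in> ?J" if "x \<in> ?J" "y \<in> ?J" for x y
      using that by (simp add: L.l_distr L.r_distr l_covered_closed(3) r_covered_closed(3))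
    show "\<ominus>\<^bsub>L\<^esub> x \<in> ?J" if "x \<in> ?J" for x
      using that by (simp add: L.l_minus L.r_minus l_covered_closed(2) r_covered_closed(2))
    fix a x assume a: "a \<in> ?J" and x: "x \<in> carrier L"
    have "l_covered (y \<otimes>\<^bsub>L\<^esub> (x \<otimes>\<^bsub>L\<^esub> a))" "r_covered (x \<otimes>\<^bsub>L\<^esub> a \<otimes>\<^bsub>L\<^esub> y)"
      "l_covered (y \<otimes>\<^bsub>L\<^esub> (a \<otimes>\<^bsub>L\<^esub> x))" "r_covered (a \<otimes>\<^bsub>L\<^esub> x \<otimes>\<^bsub>L\<^esub> y)" if y: "y \<in> carrier L" for y
    proof -
      have ca: "a \<in> carrier L" "\<And>z. z \<in> carrier L \<Longrightarrow> l_covered (z \<otimes>\<^bsub>L\<^esub> a)" "\<And>z. z \<in> carrier L \<Longrightarrow> r_covered (a \<otimes>\<^bsub>L\<^esub> z)"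
        using a by auto
      show "l_covered (y \<otimes>\<^bsub>L\<^esub> (x \<otimes>\<^bsub>L\<^esub> a))" "r_covered (a \<otimes>\<^bsub>L\<^esub> x \<otimes>\<^bsub>L\<^esub> y)"
        using ca(2)[of "y \<otimes>\<^bsub>L\<^esub> x"] ca(3)[of "x \<otimes>\<^bsub>L\<^esub> y"] ca(1) x y by (simp_all add: L.m_assoc)
      show "r_covered (x \<otimes>\<^bsub>L\<^esub> a \<otimes>\<^bsub>L\<^esub> y)" "l_covered (y \<otimes>\<^bsub>L\<^esub> (a \<otimes>\<^bsub>L\<^esub> x))"
        using r_covered_l_mult[OF ca(3)[OF y], of x] l_covered_r_mult[OF ca(2)[OF y], of x] ca(1) x y
        by (simp_all add: L.m_assoc)
    qed
    then show "x \<otimes>\<^bsub>L\<^esub> a \<in> ?J" "a \<otimes>\<^bsub>L\<^esub> x \<in> ?J"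
      using a x by simp_all
  qed simp
  moreover have "D \<subseteq> ?J"
    using mult_D_covered D_carrier by blast
  ultimately have "MC.I \<subseteq> ?J"
    by (rule L.rng_genideal_least)
  then have "x \<in> ?J"
    using x by (rule subsetD)
  then have "l_covered (U W \<otimes>\<^bsub>L\<^esub> x)" "r_covered (x \<otimes>\<^bsub>L\<^esub> U W)"
    using U_closed[OF W(1)] by simp_all
  then show "l_covered x" "r_covered x"
    using W(2) by simp_all
qed

text \<open>The join \<open>u\<close> of the finitely many idempotents involved fixes them from the
  left, and from the right as well because it commutes with them.\<close>

lemma I_local_units: "has_local_units MC.AI"
  unfolding has_local_units_def
proof (intro allI impI)
  fix Y assume "finite Y \<and> Y \<subseteq> carrier MC.AI"
  then have Y: "finite Y" "Y \<subseteq> MC.I"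
    by simp_all
  have "\<exists>W. \<forall>x\<in>Y. finite (W x) \<and> W x \<subseteq> pidems \<and>
    (\<forall>u\<in>carrier L. (\<forall>e\<in>W x. u \<otimes>\<^bsub>L\<^esub> e = e) \<longrightarrow> u \<otimes>\<^bsub>L\<^esub> x = x)"
    using I_covered(1)[OF subsetD[OF Y(2)]] unfolding l_covered_def by (intro bchoice ballI)
  then obtain Wl where Wl: "\<forall>x\<in>Y. finite (Wl x) \<and> Wl x \<subseteq> pidems \<and>
    (\<forall>u\<in>carrier L. (\<forall>e\<in>Wl x. u \<otimes>\<^bsub>L\<^esub> e = e) \<longrightarrow> u \<otimes>\<^bsub>L\<^esub> x = x)"
    by (elim exE)
  have "\<exists>W. \<forall>x\<in>Y. finite (W x) \<and> W x \<subseteq> pidems \<and>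
    (\<forall>u\<in>carrier L. (\<forall>e\<in>W x. e \<otimes>\<^bsub>L\<^esub> u = e) \<longrightarrow> x \<otimes>\<^bsub>L\<^esub> u = x)"
    using I_covered(2)[OF subsetD[OF Y(2)]] unfolding r_covered_def by (intro bchoice ballI)
  then obtain Wr where Wr: "\<forall>x\<in>Y. finite (Wr x) \<and> Wr x \<subseteq> pidems \<and>
    (\<forall>u\<in>carrier L. (\<forall>e\<in>Wr x. e \<otimes>\<^bsub>L\<^esub> u = e) \<longrightarrow> x \<otimes>\<^bsub>L\<^esub> u = x)"
    by (elim exE)
  let ?W = "(\<Union>x\<in>Y. Wl x \<union> Wr x)"
  have W: "finite ?W" "?W \<subseteq> pidems"
    using Wl Wr Y(1) by (simp, blast)
  have pc: "pidems \<subseteq> MC.I" "pidems \<subseteq> carrier L"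
    using pidem_in_I pidem_closed unfolding pidems_def by blast+
  have "\<exists>u\<in>MC.I. u \<otimes>\<^bsub>L\<^esub> u = u \<and> (\<forall>e\<in>pidems. u \<otimes>\<^bsub>L\<^esub> e = e \<otimes>\<^bsub>L\<^esub> u) \<and> (\<forall>e\<in>?W. u \<otimes>\<^bsub>L\<^esub> e = e)"
  proof (rule L.commuting_idempotents_join[OF pc(2) _ _ MC.I.rng_ideal_axioms pc(1) W])
    show "e \<otimes>\<^bsub>L\<^esub> e = e" if "e \<in> pidems" for e
      using that unfolding pidems_def by (elim CollectE exE conjE) (simp add: pidem_idem)
    show "e \<otimes>\<^bsub>L\<^esub> f = f \<otimes>\<^bsub>L\<^esub> e" if "e \<in> pidems" "f \<in> pidems" for e f
      using that unfolding pidems_def by (elim CollectE exE conjE) (simp add: pidem_comm)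
  qed
  then obtain u where u: "u \<in> MC.I" "u \<otimes>\<^bsub>L\<^esub> u = u" "\<forall>e\<in>pidems. u \<otimes>\<^bsub>L\<^esub> e = e \<otimes>\<^bsub>L\<^esub> u" "\<forall>e\<in>?W. u \<otimes>\<^bsub>L\<^esub> e = e"
    by (elim bexE conjE)
  have cu: "u \<in> carrier L"
    using u(1) by (rule MC.I.ideal_carrier)
  have "u \<otimes>\<^bsub>L\<^esub> x = x \<and> x \<otimes>\<^bsub>L\<^esub> u = x" if x: "x \<in> Y" for x
  proof
    have l: "u \<otimes>\<^bsub>L\<^esub> e = e" if "e \<in> Wl x" for e
      using u(4) x that by blast
    have r: "e \<otimes>\<^bsub>L\<^esub> u = e" if "e \<in> Wr x" for e
    proof -
      have "e \<in> ?W" "e \<in> pidems"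
        using x that W(2) by blast+
      then show ?thesis
        using bspec[OF u(4), of e] bspec[OF u(3), of e] by simp
    qed
    show "u \<otimes>\<^bsub>L\<^esub> x = x"
      using bspec[OF Wl x] cu l by simp
    show "x \<otimes>\<^bsub>L\<^esub> u = x"
      using bspec[OF Wr x] cu r by simp
  qed
  then show "\<exists>u\<in>carrier MC.AI. u \<otimes>\<^bsub>MC.AI\<^esub> u = u \<and> (\<forall>x\<in>Y. u \<otimes>\<^bsub>MC.AI\<^esub> x = x \<and> x \<otimes>\<^bsub>MC.AI\<^esub> u = x)"
    using u(1,2) by (intro bexI[of _ u]) simp_all
qed

text \<open>Every \<open>d\<close> in D is a finite sum of products \<open>pV v \<otimes> d\<close>,
  so D generates the same ideal as the \<open>pV v\<close>, which are the vertices in X and the gaps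
  at S.\<close>

lemma I_eq: "MC.I = rng_genideal L (lvtx R E ` X \<union> lbreak R E X ` S)"
proof
  let ?J = "rng_genideal L (lvtx R E ` X \<union> lbreak R E X ` S)"
  have lbreak: "lbreak R E X v = pV v" if "v \<in> S" for v
    using that S_props(2) by (simp add: lbreak_def lgap_eq pV_def)
  have gens: "lvtx R E ` X \<union> lbreak R E X ` S = pV ` (X \<union> S)"
    unfolding image_Un by (intro arg_cong2[of _ _ _ _ "(\<union>)"] image_cong refl) (simp_all add: pV_X lbreak)
  have J: "rng_ideal ?J L"
    unfolding gens by (rule L.rng_genideal_ideal) auto
  interpret J: rng_ideal ?J L by (rule J)
  have pV: "pV v \<in> ?J" if "v \<in> X \<union> S" for v
    unfolding gens using that by (intro L.rng_genideal_incl imageI)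
  show "MC.I \<subseteq> ?J"
  proof (rule L.rng_genideal_least[OF J], rule subsetI)
    fix d assume d: "d \<in> D"
    obtain W where W: "W \<subseteq> X \<union> S" "d = finsum L (\<lambda>v. pV v \<otimes>\<^bsub>L\<^esub> d) W"
      using D_unit_sum[OF d] by (elim exE conjE)
    have "finsum L (\<lambda>v. pV v \<otimes>\<^bsub>L\<^esub> d) W \<in> ?J"
      using W(1) d by (intro L.finsum_in_subgroup[OF J.is_additive_subgroup] J.I_r_closed pV D_carrier) auto
    then show "d \<in> ?J"
      using W(2) by simp
  qed
  show "?J \<subseteq> MC.I"
    unfolding gens by (rule L.rng_genideal_least[OF MC.I.rng_ideal_axioms]) (use MC.D_I D_intros(1) in blast)
qed

theorem pair_ideal_morita:
  "morita_equivalent (L\<lparr>carrier := rng_genideal L (lvtx R E ` X \<union> lbreak R E X ` S)\<rparr>) (leavitt R (pair_graph E X S))"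
  using MC.morita_equivalent_corner[OF I_local_units] unfolding I_eq .

end

theorem theorem3p10:
  fixes R :: "'r::comm_ring_1 itself"
    and E :: "('v, 'e) pre_digraph"
  assumes "wf_digraph E" and "countable (verts E)" and "countable (arcs E)"
  shows "(\<forall>X. hereditary E X \<longrightarrow>
           morita_equivalent ((leavitt R E)\<lparr>carrier := vertex_ideal R E X\<rparr>)
             (leavitt R (restrict_graph E X)))
       \<and> (\<forall>H S. admissible_pair E H S \<longrightarrow>
           morita_equivalent ((leavitt R E)\<lparr>carrier := pair_ideal R E H S\<rparr>)
             (leavitt R (pair_graph E H S)))
       \<and> (\<forall>H S. admissible_pair E H S \<longrightarrow>
           (\<exists>\<theta> \<in> alg_hom (leavitt R (quotient_graph E H S))
                  (alg_quot (leavitt R E) (pair_ideal R E H S)).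
             canonical_on_generators R E H S \<theta> \<and>
             bij_betw \<theta> (carrier (leavitt R (quotient_graph E H S)))
               (carrier (alg_quot (leavitt R E) (pair_ideal R E H S)))))
       \<and> bij_betw (\<lambda>(H, S). pair_ideal R E H S)
           {(H, S). admissible_pair E H S}
           {I. graded_ideal R E I \<and> basic_ideal R E I}"
proof -
  interpret clpa E R
    using assms(1,3) by (intro clpa.intro lpa.intro clpa_axioms.intro)
  show ?thesis
  proof (intro conjI allI impI)
    fix X assume "hereditary E X"
    then interpret hered_pair E R X "{}"
      by unfold_locales simp_all
    have "restrict_graph E X = pair_graph E X {}"
      by (simp add: restrict_graph_def pair_graph_def)
    then show "morita_equivalent ((leavitt R E)\<lparr>carrier := vertex_ideal R E X\<rparr>) (leavitt R (restrict_graph E X))"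
      using pair_ideal_morita by (simp add: vertex_ideal_def)
  next
    fix H S assume "admissible_pair E H S"
    then interpret hered_pair E R H S
      by unfold_locales (simp_all add: admissible_pair_def)
    show "morita_equivalent ((leavitt R E)\<lparr>carrier := pair_ideal R E H S\<rparr>) (leavitt R (pair_graph E H S))"
      using pair_ideal_morita by (simp add: pair_ideal_def)
  next
    fix H S assume "admissible_pair E H S"
    then interpret adm_pair E R H S
      by (rule adm_pairI)
    show "\<exists>\<theta> \<in> alg_hom (leavitt R (quotient_graph E H S)) (alg_quot (leavitt R E) (pair_ideal R E H S)).
        canonical_on_generators R E H S \<theta> \<and>
        bij_betw \<theta> (carrier (leavitt R (quotient_graph E H S))) (carrier (alg_quot (leavitt R E) (pair_ideal R E H S)))"
      by (rule quotient_isomorphism)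
  qed (rule pair_ideal_correspondence)
qed

end
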